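(* Let $\epsilon>0$, $\Omega_\epsilon=\mathbb{R}\times(0,\epsilon)$, let $\alpha_0\in\mathbb{R}\setminus\{0\}$ and let $\alpha:\mathbb{R}\to\mathbb{R}$ be such that $\alpha-\alpha_0\in W^{1,\infty}(\mathbb{R})$, $\alpha-\alpha_0$ is integrable on $\mathbb{R}$, and $\lim_{|x|\to+\infty}(\alpha(x)-\alpha_0)=0$. Suppose that either (i) $\alpha_0>0$ and $\int_{\mathbb{R}}(\alpha(x)-\alpha_0)\,dx>0$, or (ii) $\alpha_0<0$ and $\int_{\mathbb{R}}(\alpha(x)-\alpha_0)\,dx<0$. Then $$\inf\sigma(-\Delta_\alpha^{\Omega_\epsilon})<-\alpha_0^2.$$
   Context: The operator $-\Delta_\alpha^{\Omega_\epsilon}$ is the self-adjoint operator in $L^2(\Omega_\epsilon)$ acting as the negative Laplacian $\psi\mapsto-\Delta\psi$, with domain the set of all $\psi\in H^2(\Omega_\epsilon)$ satisfying, in the sense of traces, for a.e. $x\in\mathbb{R}$, $$-\frac{\partial\psi}{\partial y}(x,0)-\alpha(x)\psi(x,0)=0,\qquad \frac{\partial\psi}{\partial y}(x,\epsilon)+\alpha(x)\psi(x,\epsilon)=0.$$ It is the self-adjoint operator associated with the closed, lower bounded sesquilinear form with domain $H^1(\Omega_\epsilon)$, $$b_\alpha^{\Omega_\epsilon}(\phi,\psi)=\int_{\Omega_\epsilon}\overline{\nabla\phi}\cdot\nabla\psi\,dx\,dy+\int_{\mathbb{R}}\alpha(x)\Big(\overline{\mathrm{tr}(\phi)}(x,\epsilon)\,\mathrm{tr}(\psi)(x,\epsilon)-\overline{\mathrm{tr}(\phi)}(x,0)\,\mathrm{tr}(\psi)(x,0)\Big)dx,$$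 where $\mathrm{tr}$ is the trace map $H^1(\Omega_\epsilon)\to L^2(\partial\Omega_\epsilon)$. $\sigma(T)$ denotes the spectrum of $T$. *)

theory Defs
  imports "HOL-Analysis.Analysis"
begin

text \<open>
  Elements of the Lebesgue and Sobolev spaces below are represented by functions on the whole
  type; their values outside the set \<open>\<Omega>\<close> are irrelevant, and functions agreeing almost
  everywhere on \<open>\<Omega>\<close> represent the same element.
\<close>

definition Linf :: "'a::euclidean_space set \<Rightarrow> ('a \<Rightarrow> 'b::{banach,second_countable_topology}) set" where
  "Linf \<Omega> = {u \<in> borel_measurable (lebesgue_on \<Omega>). \<exists>C. AE z in lebesgue_on \<Omega>. norm (u z) \<le> C}"

definition L2 :: "'a::euclidean_space set \<Rightarrow> ('a \<Rightarrow> 'b::{banach,second_countable_topology}) set" where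
  "L2 \<Omega> = {u \<in> borel_measurable (lebesgue_on \<Omega>). integrable (lebesgue_on \<Omega>) (\<lambda>z. (norm (u z))\<^sup>2)}"

definition L2_norm :: "'a::euclidean_space set \<Rightarrow> ('a \<Rightarrow> 'b::{banach,second_countable_topology}) \<Rightarrow> real" where
  "L2_norm \<Omega> u = sqrt (LINT z|lebesgue_on \<Omega>. (norm (u z))\<^sup>2)"

abbreviation partial_deriv ::
  "'a::euclidean_space \<Rightarrow> ('a \<Rightarrow> 'b::real_normed_vector) \<Rightarrow> 'a \<Rightarrow> 'b" where
  "partial_deriv b f \<equiv> (\<lambda>z. frechet_derivative f (at z) b)"

primrec Ck :: "nat \<Rightarrow> ('a::euclidean_space \<Rightarrow> 'b::real_normed_vector) \<Rightarrow> bool" where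
  "Ck 0 f \<longleftrightarrow> continuous_on UNIV f"
| "Ck (Suc k) f \<longleftrightarrow> (\<forall>z. f differentiable (at z)) \<and> (\<forall>b\<in>Basis. Ck k (partial_deriv b f))"

definition test_functions :: "'a::euclidean_space set \<Rightarrow> ('a \<Rightarrow> 'b::real_normed_vector) set" where
  "test_functions \<Omega> =
     {\<phi>. (\<forall>k. Ck k \<phi>) \<and> compact (closure {z. \<phi> z \<noteq> 0}) \<and> closure {z. \<phi> z \<noteq> 0} \<subseteq> \<Omega>}"

definition has_weak_deriv ::
  "'a::euclidean_space set \<Rightarrow> 'a \<Rightarrow> ('a \<Rightarrow> 'b::{banach,second_countable_topology}) \<Rightarrow> ('a \<Rightarrow> 'b) \<Rightarrow> bool" where
  "has_weak_deriv \<Omega> b u v \<longleftrightarrow>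
     (\<forall>K. compact K \<and> K \<subseteq> \<Omega> \<longrightarrow> u absolutely_integrable_on K \<and> v absolutely_integrable_on K) \<and>
     (\<forall>\<phi> :: 'a \<Rightarrow> real. \<phi> \<in> test_functions \<Omega> \<longrightarrow>
        (LINT z|lebesgue_on \<Omega>. partial_deriv b \<phi> z *\<^sub>R u z) = - (LINT z|lebesgue_on \<Omega>. \<phi> z *\<^sub>R v z))"

text \<open>
  \<open>sobolev \<Omega> X k\<close> consists of the functions all of whose weak derivatives of order at most \<open>k\<close>
  on \<open>\<Omega>\<close> exist and lie in \<open>X\<close>; for \<open>X = L2 \<Omega>\<close> this is \<open>H\<^sup>k(\<Omega>)\<close>, for \<open>X = Linf \<Omega>\<close> it is
  \<open>W\<^sup>k\<^sup>,\<^sup>\<infinity>(\<Omega>)\<close>.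
\<close>

primrec sobolev ::
  "'a::euclidean_space set \<Rightarrow> ('a \<Rightarrow> 'b::{banach,second_countable_topology}) set \<Rightarrow> nat \<Rightarrow> ('a \<Rightarrow> 'b) set" where
  "sobolev \<Omega> X 0 = X"
| "sobolev \<Omega> X (Suc k) = {u \<in> X. \<forall>b\<in>Basis. \<exists>v\<in>sobolev \<Omega> X k. has_weak_deriv \<Omega> b u v}"

definition has_weak_laplacian ::
  "'a::euclidean_space set \<Rightarrow> ('a \<Rightarrow> 'b::{banach,second_countable_topology}) \<Rightarrow> ('a \<Rightarrow> 'b) \<Rightarrow> bool" where
  "has_weak_laplacian \<Omega> u w \<longleftrightarrow>
     (\<exists>d1 d2. (\<forall>b\<in>Basis. has_weak_deriv \<Omega> b u (d1 b) \<and> has_weak_deriv \<Omega> b (d1 b) (d2 b)) \<and>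
              (AE z in lebesgue_on \<Omega>. w z = (\<Sum>b\<in>Basis. d2 b z)))"

definition strip :: "real \<Rightarrow> (real \<times> real) set" where
  "strip \<epsilon> = UNIV \<times> {0<..<\<epsilon>}"

text \<open>
  \<open>has_trace \<epsilon> s u g\<close> (used for \<open>s = 0\<close> and \<open>s = \<epsilon>\<close>): \<open>u \<in> H\<^sup>1(strip \<epsilon>)\<close>, and \<open>g\<close> is the value
  at \<open>u\<close> of the continuous extension to \<open>H\<^sup>1(strip \<epsilon>)\<close> of the restriction map
  \<open>\<phi> \<mapsto> \<phi>(\<cdot>, s)\<close>, \<open>\<phi>\<close> smooth with compact support in the plane (not in the strip), with
  values in \<open>L\<^sup>2\<close> of the real line.
\<close>

definition has_trace :: "real \<Rightarrow> real \<Rightarrow> (real \<times> real \<Rightarrow> complex) \<Rightarrow> (real \<Rightarrow> complex) \<Rightarrow> bool" where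
  "has_trace \<epsilon> s u g \<longleftrightarrow>
     u \<in> L2 (strip \<epsilon>) \<and> g \<in> L2 UNIV \<and>
     (\<exists>du \<phi>. (\<forall>b\<in>Basis. du b \<in> L2 (strip \<epsilon>) \<and> has_weak_deriv (strip \<epsilon>) b u (du b)) \<and>
       (\<forall>n::nat. \<phi> n \<in> test_functions UNIV) \<and>
       (\<lambda>n. L2_norm (strip \<epsilon>) (\<lambda>z. \<phi> n z - u z)) \<longlonglongrightarrow> 0 \<and>
       (\<forall>b\<in>Basis. (\<lambda>n. L2_norm (strip \<epsilon>) (\<lambda>z. partial_deriv b (\<phi> n) z - du b z)) \<longlonglongrightarrow> 0) \<and>
       (\<lambda>n. L2_norm UNIV (\<lambda>x. \<phi> n (x, s) - g x)) \<longlonglongrightarrow> 0)"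

definition robin_condition :: "real \<Rightarrow> (real \<Rightarrow> real) \<Rightarrow> (real \<times> real \<Rightarrow> complex) \<Rightarrow> bool" where
  "robin_condition \<epsilon> \<alpha> \<psi> \<longleftrightarrow>
     (\<exists>\<psi>y g0 h0 g1 h1.
        has_weak_deriv (strip \<epsilon>) (0, 1) \<psi> \<psi>y \<and>
        has_trace \<epsilon> 0 \<psi> g0 \<and> has_trace \<epsilon> 0 \<psi>y h0 \<and>
        has_trace \<epsilon> \<epsilon> \<psi> g1 \<and> has_trace \<epsilon> \<epsilon> \<psi>y h1 \<and>
        (AE x in lebesgue. - h0 x - complex_of_real (\<alpha> x) * g0 x = 0 \<and>
                           h1 x + complex_of_real (\<alpha> x) * g1 x = 0))"

text \<open>
  An operator in \<open>L\<^sup>2(\<Omega>)\<close> is given by its graph, closed under almost everywhere equality.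
\<close>

definition robin_laplacian ::
  "real \<Rightarrow> (real \<Rightarrow> real) \<Rightarrow> ((real \<times> real \<Rightarrow> complex) \<times> (real \<times> real \<Rightarrow> complex)) set" where
  "robin_laplacian \<epsilon> \<alpha> =
     {(\<psi>, f). \<psi> \<in> sobolev (strip \<epsilon>) (L2 (strip \<epsilon>)) 2 \<and> robin_condition \<epsilon> \<alpha> \<psi> \<and>
              f \<in> L2 (strip \<epsilon>) \<and> has_weak_laplacian (strip \<epsilon>) \<psi> (\<lambda>z. - f z)}"

text \<open>
  \<open>\<lambda>\<close> is in the resolvent set of \<open>T\<close> iff \<open>T - \<lambda>\<close> maps the domain of \<open>T\<close> bijectively onto \<open>L\<^sup>2(\<Omega>)\<close>
  with bounded inverse; the three conjuncts are surjectivity, injectivity and boundedness.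
\<close>

definition resolvent_set ::
  "'a::euclidean_space set \<Rightarrow> (('a \<Rightarrow> complex) \<times> ('a \<Rightarrow> complex)) set \<Rightarrow> complex set" where
  "resolvent_set \<Omega> T = {l.
     (\<forall>f\<in>L2 \<Omega>. \<exists>(\<psi>, h)\<in>T. AE z in lebesgue_on \<Omega>. h z - l * \<psi> z = f z) \<and>
     (\<forall>(\<psi>1, h1)\<in>T. \<forall>(\<psi>2, h2)\<in>T.
        (AE z in lebesgue_on \<Omega>. h1 z - l * \<psi>1 z = h2 z - l * \<psi>2 z) \<longrightarrow>
        (AE z in lebesgue_on \<Omega>. \<psi>1 z = \<psi>2 z)) \<and>
     (\<exists>C. \<forall>(\<psi>, h)\<in>T. L2_norm \<Omega> \<psi> \<le> C * L2_norm \<Omega> (\<lambda>z. h z - l * \<psi> z))}"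

definition spectrum ::
  "'a::euclidean_space set \<Rightarrow> (('a \<Rightarrow> complex) \<times> ('a \<Rightarrow> complex)) set \<Rightarrow> complex set" where
  "spectrum \<Omega> T = - resolvent_set \<Omega> T"

text \<open>
  Infimum of the real spectral points, in the extended reals so that it is the genuine infimum
  also for empty or unbounded sets. The spectrum of a self-adjoint operator is real.
\<close>

definition inf_spectrum ::
  "'a::euclidean_space set \<Rightarrow> (('a \<Rightarrow> complex) \<times> ('a \<Rightarrow> complex)) set \<Rightarrow> ereal" where
  "inf_spectrum \<Omega> T = (INF t\<in>{t::real. complex_of_real t \<in> spectrum \<Omega> T}. ereal t)"

end

theory Submission
  imports Defs "HOL-Computational_Algebra.Polynomial"
begin

text \<open>
  Since \<open>\<alpha>\<close> depends on \<open>x\<close> only, the boundary term of the form \<open>b\<^sub>\<alpha>\<close> is the integral over the strip of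
  \<open>\<alpha> \<partial>\<^sub>y(\<phi> \<psi>)\<close>. Hence \<open>b\<^sub>\<alpha>\<close> is bounded below by \<open>- (sup \<bar>\<alpha>\<bar>)\<^sup>2\<close>, and
  \<open>\<langle>v, T \<psi>\<rangle> = b\<^sub>\<alpha>(v, \<psi>)\<close> for \<open>\<psi>\<close> in the domain of the operator \<open>T\<close> and smooth \<open>v\<close>.
  The infimum \<open>m\<close> of the Rayleigh quotient of \<open>b\<^sub>\<alpha>\<close> over smooth functions lies in the spectrum, so that
  neither self-adjointness of \<open>T\<close> nor the spectral theorem is needed.

  For \<open>u(x, y) = B(x / L) exp (- \<alpha>\<^sub>0 y)\<close> with a smooth bump \<open>B\<close> one finds
  \<open>b\<^sub>\<alpha>(u, u) + \<alpha>\<^sub>0\<^sup>2 \<parallel>u\<parallel>\<^sup>2 = N (\<integral> (B'(x / L) / L)\<^sup>2 dx - 2 \<alpha>\<^sub>0 \<integral> (\<alpha> - \<alpha>\<^sub>0) B(x / L)\<^sup>2 dx)\<close> with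
  \<open>N = \<integral>\<^sub>0\<^sup>\<epsilon> exp (- 2 \<alpha>\<^sub>0 y) dy > 0\<close>. As \<open>L\<close> grows, the first integral vanishes and the second tends to
  \<open>B(0)\<^sup>2 \<integral> (\<alpha> - \<alpha>\<^sub>0) dx\<close>, so \<open>m < - \<alpha>\<^sub>0\<^sup>2\<close>.
\<close>

subsection \<open>Smooth functions\<close>

text \<open>Test functions of the plane satisfy no boundary condition: they belong to the form, but
  in general not to the domain of the operator, so a small Rayleigh quotient alone says nothing
  about the spectrum. The link is a solution \<xi> of \<open>(T - m) \<xi> = v\<close> for a test
  function \<open>v\<close>: \<xi> lies in the domain, pairs with test functions by Green's formula,
  and is itself an H^1 limit of test functions by the definition of its trace. Inequalities known
  for test functions thus extend to \<xi>.

  With the boundary term written over the strip, continuity of the form in H^1 is the Cauchy-Schwarz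
  inequality, and its lower bound is a completed square in \<open>q + \<alpha> v\<close>, where
  \<open>q\<close> is the \<open>y\<close>-derivative of \<open>v\<close>.

  The threshold arises because both boundary conditions say that the \<open>y\<close>-derivative of
  \<open>\<psi>\<close> is \<open>- \<alpha> \<psi>\<close>. For constant
  \<open>\<alpha> = \<alpha>\<^sub>0\<close> they are solved by
  \<open>exp (- \<alpha>\<^sub>0 y)\<close>, of transverse energy
  \<open>- \<alpha>\<^sub>0\<^sup>2\<close>. Cutting off in \<open>x\<close> at scale
  \<open>L\<close> costs a term of order \<open>1 / L\<close>, while the gain from
  \<open>\<alpha> - \<alpha>\<^sub>0\<close> has a nonzero limit, negative in both cases.\<close>

lemma partial_deriv_eq:
  assumes "\<And>z. (f has_derivative f' z) (at z)"
  shows "partial_deriv b f = (\<lambda>z. f' z b)"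
  using frechet_derivative_at[OF assms] by (metis (full_types))

lemma Ck_SucI:
  assumes "\<And>z. (f has_derivative f' z) (at z)" "\<And>b. b \<in> Basis \<Longrightarrow> Ck k (\<lambda>z. f' z b)"
  shows "Ck (Suc k) f"
  using assms partial_deriv_eq[OF assms(1)] by (auto simp: differentiable_def)

lemma Ck_Suc_has_derivative:
  "Ck (Suc k) f \<Longrightarrow> (f has_derivative frechet_derivative f (at z)) (at z)"
  using frechet_derivative_works by auto

lemma Ck_Suc_imp_Ck: "Ck (Suc k) f \<Longrightarrow> Ck k f"
proof (induction k arbitrary: f)
  case 0
  then show ?case
    by (auto intro!: continuous_at_imp_continuous_on differentiable_imp_continuous_within)
qed auto

lemma Ck_imp_continuous: "Ck k f \<Longrightarrow> continuous_on UNIV f"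
  by (induction k) (use Ck_Suc_imp_Ck in auto)

lemma Ck_const: "Ck k (\<lambda>z. c)"
  by (induction k arbitrary: c) (auto intro!: Ck_SucI[where f'="\<lambda>_ _. 0"] simp del: Ck.simps(2))

lemma Ck_bounded_linear:
  assumes "bounded_linear g" "Ck k f"
  shows "Ck k (\<lambda>z. g (f z))"
  using assms(2)
proof (induction k arbitrary: f)
  case 0
  then show ?case
    using bounded_linear.continuous_on[OF assms(1)] by auto
next
  case (Suc k)
  show ?case
  proof (rule Ck_SucI)
    show "((\<lambda>z. g (f z)) has_derivative (\<lambda>h. g (frechet_derivative f (at z) h))) (at z)" for z
      by (rule bounded_linear.has_derivative[OF assms(1) Ck_Suc_has_derivative[OF Suc.prems]])
    show "Ck k (\<lambda>z. g (partial_deriv b f z))" if "b \<in> Basis" for b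
      using Suc.prems that by (intro Suc.IH) auto
  qed
qed

lemma Ck_linear_map: "bounded_linear g \<Longrightarrow> Ck k g"
proof (cases k)
  case (Suc j)
  assume "bounded_linear g"
  then show ?thesis unfolding Suc
    by (intro Ck_SucI[where f'="\<lambda>_. g"] bounded_linear_imp_has_derivative Ck_const)
qed (simp add: linear_continuous_on)

lemma Ck_add: "Ck k f \<Longrightarrow> Ck k g \<Longrightarrow> Ck k (\<lambda>z. f z + g z)"
proof (induction k arbitrary: f g)
  case (Suc k)
  show ?case
    by (rule Ck_SucI[OF has_derivative_add[OF Ck_Suc_has_derivative[OF Suc.prems(1)]
            Ck_Suc_has_derivative[OF Suc.prems(2)]]]) (use Suc in auto)
qed (auto intro: continuous_on_add)

lemma Ck_scaleR:
  fixes f :: "'a::euclidean_space \<Rightarrow> real"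
  shows "Ck k f \<Longrightarrow> Ck k g \<Longrightarrow> Ck k (\<lambda>z. f z *\<^sub>R g z)"
proof (induction k arbitrary: f g)
  case (Suc k)
  show ?case
  proof (rule Ck_SucI[OF has_derivative_scaleR[OF Ck_Suc_has_derivative[OF Suc.prems(1)]
            Ck_Suc_has_derivative[OF Suc.prems(2)]]])
    show "Ck k (\<lambda>z. f z *\<^sub>R partial_deriv b g z + partial_deriv b f z *\<^sub>R g z)"
      if "b \<in> Basis" for b
      using Suc.prems that by (intro Ck_add Suc.IH Ck_Suc_imp_Ck[of k f] Ck_Suc_imp_Ck[of k g]) auto
  qed
qed (auto intro: continuous_on_scaleR)

text \<open>The outer function enters as the sequence of its successive derivatives, with the index
  free in the induction. The sequence is obtained by iterating \<open>flat_step\<close> for the flat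
  functions, and is constant for \<open>exp\<close>.\<close>

lemma Ck_compose_real:
  fixes F :: "nat \<Rightarrow> real \<Rightarrow> real"
  assumes F: "\<And>n t. (F n has_field_derivative F (Suc n) t) (at t)"
  shows "Ck k g \<Longrightarrow> Ck k (\<lambda>z. F n (g z))"
proof (induction k arbitrary: n)
  case 0
  have "continuous_on UNIV (F n)"
    using DERIV_continuous_on[of UNIV "F n"] F by blast
  then show ?case using 0 by (auto intro: continuous_on_compose2)
next
  case (Suc k)
  show ?case
  proof (rule Ck_SucI)
    show "((\<lambda>z. F n (g z)) has_derivative
            (\<lambda>h. frechet_derivative g (at z) h *\<^sub>R F (Suc n) (g z))) (at z)" for z
      using DERIV_compose_FDERIV[OF F Ck_Suc_has_derivative[OF Suc.prems]] by simp
    show "Ck k (\<lambda>z. partial_deriv b g z *\<^sub>R F (Suc n) (g z))" if "b \<in> Basis" for b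
      using Suc that Ck_Suc_imp_Ck[of k g] by (intro Ck_scaleR Suc.IH) auto
  qed
qed

lemma Ck_prod:
  fixes f :: "'i \<Rightarrow> 'a::euclidean_space \<Rightarrow> real"
  assumes "\<And>i. i \<in> I \<Longrightarrow> Ck k (f i)"
  shows "Ck k (\<lambda>z. \<Prod>i\<in>I. f i z)"
  using assms
proof (induction I rule: infinite_finite_induct)
  case (insert i I)
  have "Ck k (\<lambda>z. f i z *\<^sub>R (\<Prod>i\<in>I. f i z))"
    using insert by (intro Ck_scaleR) auto
  then show ?case using insert by simp
qed (auto intro: Ck_const)

text \<open>The functions \<open>p(1 / t) exp (- 1 / t)\<close> with \<open>p\<close> a polynomial, extended by zero to \<open>t \<le> 0\<close>, are
  closed under differentiation, hence smooth.\<close>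

definition flat :: "real poly \<Rightarrow> real \<Rightarrow> real" where
  "flat p t = (if t \<le> 0 then 0 else poly p (1 / t) * exp (- (1 / t)))"

lemma poly_exp_tendsto_0: "((\<lambda>s::real. poly p s * exp (- s)) \<longlongrightarrow> 0) at_top"
proof -
  have "((\<lambda>s::real. \<Sum>i\<le>degree p. coeff p i * (s ^ i / exp s)) \<longlongrightarrow> (\<Sum>i\<le>degree p. coeff p i * 0)) at_top"
    by (intro tendsto_intros tendsto_power_div_exp_0)
  then show ?thesis
    by (simp add: poly_altdef exp_minus sum_distrib_right sum_divide_distrib field_simps)
qed

lemma flat_tendsto_0: "((\<lambda>t. flat p t) \<longlongrightarrow> 0) (at 0)"
proof -
  have "((\<lambda>t. poly p (inverse t) * exp (- inverse t)) \<longlongrightarrow> 0) (at_right 0)"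
    using filterlim_compose[OF poly_exp_tendsto_0 filterlim_inverse_at_top_right] .
  then have "(flat p \<longlongrightarrow> 0) (at_right 0)"
    by (rule Lim_transform_eventually)
       (auto simp: flat_def eventually_at_right_less field_simps intro: eventually_mono[OF eventually_at_right_less])
  moreover have "(flat p \<longlongrightarrow> 0) (at_left 0)"
    by (rule Lim_transform_eventually[OF tendsto_const])
       (auto simp: flat_def intro: eventually_mono[OF eventually_at_left_real[of "-1"]])
  ultimately show ?thesis using filterlim_split_at by blast
qed

text \<open>In the variable s = 1 / t the derivative d/dt is - s^2 d/ds, which turns p(s) exp(- s)
  into s^2 (p(s) - p'(s)) exp(- s); the factor \<open>[:0, 0, 1:]\<close> is s^2.\<close>

definition flat_step :: "real poly \<Rightarrow> real poly" where
  "flat_step p = [:0, 0, 1:] * (p - pderiv p)"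

lemma flat_has_derivative: "(flat p has_field_derivative flat (flat_step p) t) (at t)"
proof (cases t "0::real" rule: linorder_cases)
  case less
  have "((\<lambda>_. 0) has_field_derivative 0) (at t)" by simp
  then have "(flat p has_field_derivative 0) (at t)"
    by (rule has_field_derivative_transform_within_open[where S="{..<0}"])
       (use less in \<open>auto simp: flat_def\<close>)
  then show ?thesis using less by (simp add: flat_def)
next
  case greater
  have "((\<lambda>t. poly p (1 / t) * exp (- (1 / t))) has_field_derivative flat (flat_step p) t) (at t)"
  proof -
    have "((\<lambda>t. inverse t) has_field_derivative - (1 / t\<^sup>2)) (at t)"
      using greater by (auto intro!: derivative_eq_intros simp: field_simps power2_eq_square)
    then have i: "((\<lambda>t. 1 / t) has_field_derivative - (1 / t\<^sup>2)) (at t)"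
      by (simp add: inverse_eq_divide)
    show ?thesis
      using DERIV_mult[OF DERIV_chain2[OF poly_DERIV i] DERIV_chain2[OF DERIV_exp DERIV_minus[OF i]]] greater
      by (simp add: flat_def flat_step_def power2_eq_square algebra_simps)
  qed
  then show ?thesis
    by (rule has_field_derivative_transform_within_open[where S="{0<..}"])
       (use greater in \<open>auto simp: flat_def\<close>)
next
  case equal
  \<comment> \<open>Since \<open>flat p 0 = 0\<close>, the difference quotient at 0 only multiplies
    the polynomial in 1 / h by its variable. It is again a flat function and tends to 0.\<close>
  have eq: "(flat p h - flat p 0) / h = flat (pCons 0 p) h" for h
    by (simp add: flat_def)
  show ?thesis
    unfolding equal DERIV_def
    using flat_tendsto_0[of "pCons 0 p"] eq by (simp add: flat_def[of _ 0])
qed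

lemma flat_smooth:
  assumes "\<And>k. Ck k g"
  shows "Ck k (\<lambda>z. flat p (g z))"
  using Ck_compose_real[of "\<lambda>n. flat ((flat_step ^^ n) p)" k g 0] assms flat_has_derivative by simp


subsection \<open>Test functions\<close>

lemma test_functionsI:
  assumes "\<And>k. Ck k f" "{z. f z \<noteq> 0} \<subseteq> K" "compact K" "K \<subseteq> \<Omega>"
  shows "f \<in> test_functions \<Omega>"
proof -
  have "closure {z. f z \<noteq> 0} \<subseteq> K"
    using assms(2,3) by (simp add: closure_minimal compact_imp_closed)
  then show ?thesis
    using assms compact_Int_closed[OF assms(3), of "closure {z. f z \<noteq> 0}"]
    by (auto simp: test_functions_def inf_absorb2)
qed

lemma test_functionsD:
  assumes "f \<in> test_functions \<Omega>"
  obtains K where "\<And>k. Ck k f" "compact K" "K \<subseteq> \<Omega>" "\<And>z. z \<notin> K \<Longrightarrow> f z = 0"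
  using assms closure_subset[of "{z. f z \<noteq> 0}"] unfolding test_functions_def by blast

lemma test_functions_has_derivative:
  "f \<in> test_functions \<Omega> \<Longrightarrow> (f has_derivative frechet_derivative f (at z)) (at z)"
  by (auto simp: test_functions_def intro!: Ck_Suc_has_derivative[of 0])

lemma test_functions_continuous: "f \<in> test_functions \<Omega> \<Longrightarrow> continuous_on UNIV f"
  by (auto simp: test_functions_def intro!: Ck_imp_continuous[of 0])

lemma test_functions_measurable: "f \<in> test_functions \<Omega> \<Longrightarrow> f \<in> borel_measurable borel"
  by (intro borel_measurable_continuous_onI test_functions_continuous)

lemma test_functions_bounded:
  assumes "f \<in> test_functions \<Omega>"
  obtains C where "C \<ge> 0" "\<And>z. norm (f z) \<le> C"
proof -
  obtain K where K: "compact K" "\<And>z. z \<notin> K \<Longrightarrow> f z = 0"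
    using test_functionsD[OF assms] by metis
  have "compact (f ` K)"
    by (intro compact_continuous_image K continuous_on_subset[OF test_functions_continuous[OF assms]]) auto
  then obtain C where C: "\<And>z. z \<in> K \<Longrightarrow> norm (f z) \<le> C"
    by (metis bounded_iff compact_imp_bounded imageI)
  have "norm (f z) \<le> max C 0" for z
    using C[of z] K(2)[of z] by (cases "z \<in> K") auto
  then show ?thesis using that[of "max C 0"] by auto
qed

lemma test_functions_partial_deriv:
  assumes f: "f \<in> test_functions \<Omega>" and b: "b \<in> Basis"
  shows "partial_deriv b f \<in> test_functions \<Omega>"
proof -
  obtain K where K: "\<And>k. Ck k f" "compact K" "K \<subseteq> \<Omega>" "\<And>z. z \<notin> K \<Longrightarrow> f z = 0"
    using test_functionsD[OF f] by metis
  have "partial_deriv b f z = 0" if z: "z \<notin> K" for z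
  proof -
    have "((\<lambda>_. 0) has_derivative (\<lambda>_. 0)) (at z)" by simp
    then have "(f has_derivative (\<lambda>_. 0)) (at z)"
      by (rule has_derivative_transform_within_open[OF _ open_Compl[of K]])
         (use K z in \<open>auto simp: compact_imp_closed\<close>)
    from frechet_derivative_at[OF this] show ?thesis by metis
  qed
  moreover have "Ck k (partial_deriv b f)" for k
    using K(1)[of "Suc k"] b by auto
  ultimately show ?thesis
    by (intro test_functionsI[of _ K] K) auto
qed

lemma test_functions_scaleR:
  fixes \<eta> :: "'a::euclidean_space \<Rightarrow> real"
  assumes "\<And>k. Ck k \<eta>" "f \<in> test_functions \<Omega>"
  shows "(\<lambda>z. \<eta> z *\<^sub>R f z) \<in> test_functions \<Omega>"
proof -
  obtain K where "\<And>k. Ck k f" "compact K" "K \<subseteq> \<Omega>" "\<And>z. z \<notin> K \<Longrightarrow> f z = 0"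
    using test_functionsD[OF assms(2)] by metis
  then show ?thesis
    by (intro test_functionsI[of _ K] Ck_scaleR assms(1)) auto
qed

lemma test_functions_add:
  assumes "f \<in> test_functions \<Omega>" "g \<in> test_functions \<Omega>"
  shows "(\<lambda>z. f z + g z) \<in> test_functions \<Omega>"
proof -
  obtain K where "\<And>k. Ck k f" "compact K" "K \<subseteq> \<Omega>" "\<And>z. z \<notin> K \<Longrightarrow> f z = 0"
    using test_functionsD[OF assms(1)] by metis
  moreover obtain L where "\<And>k. Ck k g" "compact L" "L \<subseteq> \<Omega>" "\<And>z. z \<notin> L \<Longrightarrow> g z = 0"
    using test_functionsD[OF assms(2)] by metis
  ultimately show ?thesis
    by (intro test_functionsI[of _ "K \<union> L"] Ck_add compact_Un) force+
qed

lemma test_functions_bounded_linear: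
  assumes "bounded_linear g" "f \<in> test_functions \<Omega>"
  shows "(\<lambda>z. g (f z)) \<in> test_functions \<Omega>"
proof -
  obtain K where "\<And>k. Ck k f" "compact K" "K \<subseteq> \<Omega>" "\<And>z. z \<notin> K \<Longrightarrow> f z = 0"
    using test_functionsD[OF assms(2)] by metis
  then show ?thesis
    using linear_0[OF bounded_linear.linear[OF assms(1)]]
    by (intro test_functionsI[of _ K] Ck_bounded_linear[OF assms(1)]) force+
qed

subsection \<open>The space \<open>L\<^sup>2\<close>\<close>

text \<open>For complex values this is the real part of the Hermitian product. It turns
  \<open>L2\<close> into a real inner product space, which suffices for the Cauchy-Schwarz
  inequality and for shifts of the operator by real numbers.\<close>

definition ip :: "'a::euclidean_space set \<Rightarrow> ('a \<Rightarrow> 'b::euclidean_space) \<Rightarrow> ('a \<Rightarrow> 'b) \<Rightarrow> real" where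
  "ip \<Omega> f g = (LINT z|lebesgue_on \<Omega>. f z \<bullet> g z)"

lemma ip_commute: "ip \<Omega> f g = ip \<Omega> g f"
  by (simp add: ip_def inner_commute)

lemma ip_cong_AE:
  assumes "f \<in> L2 \<Omega>" "f' \<in> L2 \<Omega>" "g \<in> L2 \<Omega>" "AE z in lebesgue_on \<Omega>. f z = f' z"
  shows "ip \<Omega> f g = ip \<Omega> f' g"
  unfolding ip_def using assms
  by (intro integral_cong_AE) (auto simp: L2_def)

lemma ip_nonneg: "ip \<Omega> f f \<ge> 0"
  by (simp add: ip_def)

lemma L2_norm_square: "(L2_norm \<Omega> f)\<^sup>2 = ip \<Omega> f f"
  by (simp add: L2_norm_def ip_def power2_norm_eq_inner)

lemma L2_norm_nonneg: "L2_norm \<Omega> f \<ge> 0"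
  by (simp add: L2_norm_def)

lemma integrable_inner_L2:
  fixes f g :: "'a::euclidean_space \<Rightarrow> 'b::euclidean_space"
  assumes "f \<in> L2 \<Omega>" "g \<in> L2 \<Omega>"
  shows "integrable (lebesgue_on \<Omega>) (\<lambda>z. f z \<bullet> g z)"
proof (rule Bochner_Integration.integrable_bound)
  show "integrable (lebesgue_on \<Omega>) (\<lambda>z. (norm (f z))\<^sup>2 + (norm (g z))\<^sup>2)"
    using assms by (auto simp: L2_def)
  have "norm (f z \<bullet> g z) \<le> norm ((norm (f z))\<^sup>2 + (norm (g z))\<^sup>2)" for z
    using Cauchy_Schwarz_ineq2[of "f z" "g z"] zero_le_power2[of "norm (f z) - norm (g z)"]
      sum_squares_bound[of "norm (f z)" "norm (g z)"] mult_nonneg_nonneg[OF norm_ge_zero[of "f z"] norm_ge_zero[of "g z"]]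
    by simp
  then show "AE z in lebesgue_on \<Omega>. norm (f z \<bullet> g z) \<le> norm ((norm (f z))\<^sup>2 + (norm (g z))\<^sup>2)"
    by simp
qed (use assms in \<open>auto simp: L2_def\<close>)

lemma L2_add:
  fixes f g :: "'a::euclidean_space \<Rightarrow> 'b::euclidean_space"
  assumes "f \<in> L2 \<Omega>" "g \<in> L2 \<Omega>"
  shows "(\<lambda>z. f z + g z) \<in> L2 \<Omega>"
proof -
  have "integrable (lebesgue_on \<Omega>) (\<lambda>z. (norm (f z))\<^sup>2 + 2 * (f z \<bullet> g z) + (norm (g z))\<^sup>2)"
    using assms integrable_inner_L2[OF assms] by (auto simp: L2_def)
  also have "(\<lambda>z. (norm (f z))\<^sup>2 + 2 * (f z \<bullet> g z) + (norm (g z))\<^sup>2) = (\<lambda>z. (norm (f z + g z))\<^sup>2)"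
    by (intro ext, simp add: power2_norm_eq_inner inner_add_left inner_add_right inner_commute)
  finally show ?thesis using assms by (auto simp: L2_def)
qed

lemma L2_mult_bounded:
  fixes f :: "'a::euclidean_space \<Rightarrow> 'b::euclidean_space"
  assumes f: "f \<in> L2 \<Omega>" and w: "w \<in> borel_measurable (lebesgue_on \<Omega>)" and \<Omega>: "\<Omega> \<in> sets lebesgue"
    and le: "\<And>z. z \<in> \<Omega> \<Longrightarrow> \<bar>w z\<bar> \<le> C"
  shows "(\<lambda>z. w z *\<^sub>R f z) \<in> L2 \<Omega>"
proof -
  have "integrable (lebesgue_on \<Omega>) (\<lambda>z. (norm (w z *\<^sub>R f z))\<^sup>2)"
  proof (rule Bochner_Integration.integrable_bound)
    show "integrable (lebesgue_on \<Omega>) (\<lambda>z. C\<^sup>2 * (norm (f z))\<^sup>2)"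
      using f by (auto simp: L2_def)
    show "AE z in lebesgue_on \<Omega>. norm ((norm (w z *\<^sub>R f z))\<^sup>2) \<le> norm (C\<^sup>2 * (norm (f z))\<^sup>2)"
      using power_mono[OF le abs_ge_zero, of _ 2]
      by (intro AE_I2) (auto simp: power_mult_distrib intro!: mult_right_mono)
    show "(\<lambda>z. (norm (w z *\<^sub>R f z))\<^sup>2) \<in> borel_measurable (lebesgue_on \<Omega>)"
      using f w by (auto simp: L2_def)
  qed
  then show ?thesis using f w by (auto simp: L2_def)
qed

lemma L2_norm_mult_bounded_le:
  fixes f :: "'a::euclidean_space \<Rightarrow> 'b::euclidean_space"
  assumes f: "f \<in> L2 \<Omega>" and w: "w \<in> borel_measurable (lebesgue_on \<Omega>)" and \<Omega>: "\<Omega> \<in> sets lebesgue"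
    and le: "\<And>z. z \<in> \<Omega> \<Longrightarrow> \<bar>w z\<bar> \<le> C"
  shows "L2_norm \<Omega> (\<lambda>z. w z *\<^sub>R f z) \<le> \<bar>C\<bar> * L2_norm \<Omega> f"
proof -
  have "(LINT z|lebesgue_on \<Omega>. (norm (w z *\<^sub>R f z))\<^sup>2) \<le> (LINT z|lebesgue_on \<Omega>. C\<^sup>2 * (norm (f z))\<^sup>2)"
  proof (rule integral_mono)
    show "integrable (lebesgue_on \<Omega>) (\<lambda>z. (norm (w z *\<^sub>R f z))\<^sup>2)"
      using L2_mult_bounded[OF assms] by (simp add: L2_def)
    show "integrable (lebesgue_on \<Omega>) (\<lambda>z. C\<^sup>2 * (norm (f z))\<^sup>2)"
      using f by (auto simp: L2_def)
    show "(norm (w z *\<^sub>R f z))\<^sup>2 \<le> C\<^sup>2 * (norm (f z))\<^sup>2" if "z \<in> space (lebesgue_on \<Omega>)" for z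
      using power_mono[OF le[of z] abs_ge_zero, of 2] that by (auto simp: power_mult_distrib intro!: mult_right_mono)
  qed
  then show ?thesis
    unfolding L2_norm_def using real_sqrt_le_mono by (fastforce simp: real_sqrt_mult)
qed

lemma L2_scaleR:
  fixes f :: "'a::euclidean_space \<Rightarrow> 'b::euclidean_space"
  assumes "f \<in> L2 \<Omega>"
  shows "(\<lambda>z. c *\<^sub>R f z) \<in> L2 \<Omega>"
  using assms by (auto simp: L2_def power_mult_distrib)

lemma L2_diff:
  fixes f g :: "'a::euclidean_space \<Rightarrow> 'b::euclidean_space"
  assumes "f \<in> L2 \<Omega>" "g \<in> L2 \<Omega>"
  shows "(\<lambda>z. f z - g z) \<in> L2 \<Omega>"
  using L2_add[OF assms(1) L2_scaleR[OF assms(2), of "-1"]] by simp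

lemma ip_add_left:
  "f \<in> L2 \<Omega> \<Longrightarrow> g \<in> L2 \<Omega> \<Longrightarrow> h \<in> L2 \<Omega> \<Longrightarrow> ip \<Omega> (\<lambda>z. f z + g z) h = ip \<Omega> f h + ip \<Omega> g h"
  by (simp add: ip_def inner_add_left integrable_inner_L2)

lemma ip_diff_left:
  "f \<in> L2 \<Omega> \<Longrightarrow> g \<in> L2 \<Omega> \<Longrightarrow> h \<in> L2 \<Omega> \<Longrightarrow> ip \<Omega> (\<lambda>z. f z - g z) h = ip \<Omega> f h - ip \<Omega> g h"
  by (simp add: ip_def inner_diff_left integrable_inner_L2)

lemma ip_scaleR_left: "ip \<Omega> (\<lambda>z. c *\<^sub>R f z) h = c * ip \<Omega> f h"
  by (simp add: ip_def)

text \<open>The discriminant criterion, applied both to the L^2 product and to the form of the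
  shifted operator. Either may vanish on nonzero functions, so the leading coefficient is allowed to
  be zero.\<close>

lemma quadratic_nonneg_imp:
  fixes a b c :: real
  assumes "\<And>t. a + 2 * b * t + c * t\<^sup>2 \<ge> 0"
  shows "b\<^sup>2 \<le> a * c"
proof (cases "c > 0")
  case True
  have "0 \<le> c * (a + 2 * b * (- (b / c)) + c * (- (b / c))\<^sup>2)"
    using assms[of "- (b / c)"] True by simp
  also have "\<dots> = a * c - b\<^sup>2"
    using True by (simp add: field_simps power2_eq_square)
  finally show ?thesis by simp
next
  case False
  have a: "a \<ge> 0" using assms[of 0] by simp
  have "b = 0"
  proof (rule ccontr)
    assume b: "b \<noteq> 0"
    \<comment> \<open>This choice makes the linear term \<open>- (a + 1)\<close>; the quadratic term
      is nonpositive, so the value is at most -1. The second \<open>t\<close> below makes the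
      quadratic term \<open>- (a + 1)\<close> in the same way.\<close>
    define t where "t = - (a + 1) / (2 * b)"
    have "2 * b * t = - (a + 1)" using b by (simp add: t_def)
    moreover have "c * t\<^sup>2 \<le> 0" using False by (simp add: mult_nonpos_nonneg)
    ultimately show False using assms[of t] by simp
  qed
  moreover have "c = 0"
  proof (rule ccontr)
    assume "c \<noteq> 0"
    then have c: "c < 0" using False by simp
    define t where "t = sqrt ((a + 1) / (- c))"
    have "0 \<le> (a + 1) / (- c)" using a c by (intro divide_nonneg_pos) auto
    then have "t\<^sup>2 = (a + 1) / (- c)" unfolding t_def by (rule real_sqrt_pow2)
    then have "c * t\<^sup>2 = - (a + 1)" using c by (simp add: field_simps)
    then show False using assms[of t] \<open>b = 0\<close> by simp
  qed
  ultimately show ?thesis by simp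
qed

lemma ip_Cauchy_Schwarz:
  assumes "f \<in> L2 \<Omega>" "g \<in> L2 \<Omega>"
  shows "\<bar>ip \<Omega> f g\<bar> \<le> L2_norm \<Omega> f * L2_norm \<Omega> g"
proof -
  have "ip \<Omega> f f + 2 * ip \<Omega> f g * t + ip \<Omega> g g * t\<^sup>2 \<ge> 0" for t
  proof -
    let ?h = "\<lambda>z. f z + t *\<^sub>R g z"
    have tg: "(\<lambda>z. t *\<^sub>R g z) \<in> L2 \<Omega>" by (rule L2_scaleR[OF assms(2)])
    have h: "?h \<in> L2 \<Omega>" by (rule L2_add[OF assms(1) tg])
    have "ip \<Omega> ?h ?h = ip \<Omega> f ?h + t * ip \<Omega> g ?h"
      unfolding ip_add_left[OF assms(1) tg h] ip_scaleR_left ..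
    also have "\<dots> = ip \<Omega> ?h f + t * ip \<Omega> ?h g"
      unfolding ip_commute[of \<Omega> f ?h] ip_commute[of \<Omega> g ?h] ..
    also have "\<dots> = ip \<Omega> f f + 2 * ip \<Omega> f g * t + ip \<Omega> g g * t\<^sup>2"
      unfolding ip_add_left[OF assms(1) tg assms(1)] ip_add_left[OF assms(1) tg assms(2)]
        ip_scaleR_left ip_commute[of \<Omega> g f] by (simp add: power2_eq_square algebra_simps)
    finally show ?thesis using ip_nonneg[of \<Omega> ?h] by simp
  qed
  then have "(ip \<Omega> f g)\<^sup>2 \<le> (L2_norm \<Omega> f * L2_norm \<Omega> g)\<^sup>2"
    using quadratic_nonneg_imp by (simp add: power_mult_distrib L2_norm_square)
  then show ?thesis
    by (simp add: abs_le_square_iff[symmetric] L2_norm_nonneg abs_mult)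
qed

lemma ip_tendsto:
  assumes f: "f \<in> L2 \<Omega>" "\<And>n::nat. F n \<in> L2 \<Omega>" "(\<lambda>n. L2_norm \<Omega> (\<lambda>z. F n z - f z)) \<longlonglongrightarrow> 0"
    and g: "g \<in> L2 \<Omega>" "\<And>n::nat. G n \<in> L2 \<Omega>" "(\<lambda>n. L2_norm \<Omega> (\<lambda>z. G n z - g z)) \<longlonglongrightarrow> 0"
  shows "(\<lambda>n. ip \<Omega> (F n) (G n)) \<longlonglongrightarrow> ip \<Omega> f g"
proof -
  let ?a = "\<lambda>n. L2_norm \<Omega> (\<lambda>z. F n z - f z)" and ?b = "\<lambda>n. L2_norm \<Omega> (\<lambda>z. G n z - g z)"
  have le: "norm (ip \<Omega> (F n) (G n) - ip \<Omega> f g) \<le> ?a n * ?b n + L2_norm \<Omega> f * ?b n + ?a n * L2_norm \<Omega> g" for n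
  proof -
    have d: "(\<lambda>z. F n z - f z) \<in> L2 \<Omega>" "(\<lambda>z. G n z - g z) \<in> L2 \<Omega>"
      using f g by (auto intro: L2_diff)
    have "ip \<Omega> (F n) (G n) - ip \<Omega> f g = ip \<Omega> (\<lambda>z. F n z - f z) (\<lambda>z. G n z - g z)
        + ip \<Omega> f (\<lambda>z. G n z - g z) + ip \<Omega> (\<lambda>z. F n z - f z) g"
      unfolding ip_diff_left[OF f(2) f(1) d(2)] ip_diff_left[OF f(2) f(1) g(1)]
        ip_commute[of \<Omega> _ "\<lambda>z. G n z - g z"] ip_diff_left[OF g(2) g(1) f(2)] ip_diff_left[OF g(2) g(1) f(1)]
      by (simp add: ip_commute[of \<Omega> _ "G n"] ip_commute[of \<Omega> g])
    then show ?thesis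
      using ip_Cauchy_Schwarz[OF d] ip_Cauchy_Schwarz[OF f(1) d(2)] ip_Cauchy_Schwarz[OF d(1) g(1)]
      unfolding real_norm_def by linarith
  qed
  have "(\<lambda>n. ?a n * ?b n + L2_norm \<Omega> f * ?b n + ?a n * L2_norm \<Omega> g) \<longlonglongrightarrow> 0 * 0 + L2_norm \<Omega> f * 0 + 0 * L2_norm \<Omega> g"
    by (intro tendsto_intros f g)
  then have "(\<lambda>n. ip \<Omega> (F n) (G n) - ip \<Omega> f g) \<longlonglongrightarrow> 0"
    by (intro Lim_null_comparison[OF always_eventually[OF allI[OF le]]]) simp
  then show ?thesis by (simp add: LIM_zero_iff)
qed

text \<open>The convergence hypothesis of \<open>ip_tendsto\<close> for a factor that is held fixed
  while the other one is approximated.\<close>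

lemma L2_norm_const: "(\<lambda>n::nat. L2_norm \<Omega> (\<lambda>z. f z - f z)) \<longlonglongrightarrow> 0"
  by (simp add: L2_norm_def)

section \<open>From integrals over \<open>lebesgue_on\<close> to integrals over
  \<open>lborel\<close>\<close>

lemma borel_measurable_lebesgue_on:
  "f \<in> borel_measurable borel \<Longrightarrow> f \<in> borel_measurable (lebesgue_on \<Omega>)"
  by (intro measurable_restrict_space1 measurable_completion) simp

text \<open>The spaces are defined with \<open>lebesgue_on\<close>, while Fubini's theorem and the
  fundamental theorem of calculus are applied in \<open>lborel\<close>. This passage is the reason
  for the Borel hypotheses on the weights \<alpha> and \<beta> below.\<close>

lemma integral_lebesgue_on_borel:
  fixes f :: "'a::euclidean_space \<Rightarrow> 'b::{banach,second_countable_topology}"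
  assumes [measurable]: "f \<in> borel_measurable borel" "\<Omega> \<in> sets borel"
  shows "(LINT z|lebesgue_on \<Omega>. f z) = (LINT z|lborel. indicator \<Omega> z *\<^sub>R f z)"
proof -
  have "(LINT z|lebesgue_on \<Omega>. f z) = (LINT z|lebesgue. indicator \<Omega> z *\<^sub>R f z)"
    by (subst integral_restrict_space) auto
  then show ?thesis by (subst integral_completion[symmetric]) auto
qed

lemma integrable_lebesgue_on_borel:
  fixes f :: "'a::euclidean_space \<Rightarrow> 'b::{banach,second_countable_topology}"
  assumes "integrable lborel f" "\<Omega> \<in> sets lebesgue"
  shows "integrable (lebesgue_on \<Omega>) f"
proof -
  have "integrable lebesgue f"
    using assms(1) by (subst integrable_completion) auto
  then show ?thesis
    using assms(2) by (subst integrable_restrict_space) (auto intro!: integrable_mult_indicator)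
qed

lemma L2_compact_support:
  fixes f :: "'a::euclidean_space \<Rightarrow> 'b::euclidean_space"
  assumes f: "continuous_on UNIV f" and K: "compact K" "\<And>z. z \<notin> K \<Longrightarrow> f z = 0" and \<Omega>: "\<Omega> \<in> sets lebesgue"
  shows "f \<in> L2 \<Omega>"
proof -
  have "integrable lborel (\<lambda>z. indicator K z *\<^sub>R (norm (f z))\<^sup>2)"
    by (intro borel_integrable_compact K continuous_intros continuous_on_subset[OF f]) simp
  also have "(\<lambda>z. indicator K z *\<^sub>R (norm (f z))\<^sup>2) = (\<lambda>z. (norm (f z))\<^sup>2)"
    using K(2) by (force simp: indicator_def)
  finally show ?thesis
    unfolding L2_def using \<Omega> borel_measurable_lebesgue_on[OF borel_measurable_continuous_onI[OF f], of \<Omega>]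
    by (simp add: integrable_lebesgue_on_borel)
qed

lemma test_functions_L2:
  fixes f :: "'a::euclidean_space \<Rightarrow> 'b::euclidean_space"
  assumes f: "f \<in> test_functions \<Omega>'" and \<Omega>: "\<Omega> \<in> sets lebesgue"
  shows "f \<in> L2 \<Omega>"
proof -
  obtain K where "compact K" "\<And>z. z \<notin> K \<Longrightarrow> f z = 0"
    using test_functionsD[OF f] by metis
  then show ?thesis
    by (intro L2_compact_support[OF test_functions_continuous[OF f]] \<Omega>)
qed

subsection \<open>Uniqueness of weak derivatives\<close>

lemma flat_one: "flat 1 t = (if t \<le> 0 then 0 else exp (- (1 / t)))"
  by (simp add: flat_def)

lemma flat_one_bounds: "0 \<le> flat 1 t" "flat 1 t \<le> 1"
  by (auto simp: flat_one)

lemma flat_one_tendsto: "(flat 1 \<longlongrightarrow> 1) at_top"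
proof (rule Lim_transform_eventually)
  have "((\<lambda>t::real. exp (- inverse t)) \<longlongrightarrow> exp (- 0)) at_top"
    by (intro tendsto_intros tendsto_inverse_0_at_top filterlim_ident)
  then show "((\<lambda>t::real. exp (- (1 / t))) \<longlongrightarrow> 1) at_top"
    by (simp add: inverse_eq_divide)
  show "\<forall>\<^sub>F t in at_top. exp (- (1 / t)) = flat 1 t"
    using eventually_gt_at_top[of "0::real"] by eventually_elim (simp add: flat_one)
qed

lemma flat_one_scaled_tendsto:
  assumes "t > 0"
  shows "(\<lambda>n. flat 1 (real n * t)) \<longlonglongrightarrow> 1"
proof -
  have "filterlim (\<lambda>n. real n * t) at_top sequentially"
    using filterlim_tendsto_pos_mult_at_top[OF tendsto_const assms filterlim_real_sequentially]
    by (simp add: mult.commute)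
  then show ?thesis using filterlim_compose[OF flat_one_tendsto] by blast
qed

text \<open>Smooth approximations of the indicator of the open box, used instead of mollification.
  Each factor is exp(- 1 / t) at \<open>n\<close> times the signed distance to a face: it tends to 1
  inside, while the function vanishes off the box for every \<open>n\<close>.\<close>

definition box_cutoff :: "'a::euclidean_space \<Rightarrow> 'a \<Rightarrow> nat \<Rightarrow> 'a \<Rightarrow> real" where
  "box_cutoff a c n z =
     (\<Prod>b\<in>Basis. flat 1 (real n * ((z - a) \<bullet> b)) * flat 1 (real n * ((c - z) \<bullet> b)))"

lemma Ck_affine:
  fixes f :: "'a::euclidean_space \<Rightarrow> real"
  assumes "bounded_linear f"
  shows "Ck k (\<lambda>z. f z + d)"
  by (intro Ck_add Ck_linear_map Ck_const assms)

lemma Ck_box_cutoff: "Ck k (box_cutoff a c n)"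
proof -
  have "Ck k (\<lambda>z. \<Prod>b\<in>Basis. flat 1 (real n * ((z - a) \<bullet> b)) *\<^sub>R flat 1 (real n * ((c - z) \<bullet> b)))"
  proof (intro Ck_prod Ck_scaleR flat_smooth)
    fix b :: 'a and k
    have "Ck k (\<lambda>z. real n * (z \<bullet> b) + - real n * (a \<bullet> b))"
      by (intro Ck_affine bounded_linear_intros)
    then show "Ck k (\<lambda>z. real n * ((z - a) \<bullet> b))"
      by (simp add: inner_diff_left algebra_simps)
    have "Ck k (\<lambda>z. - real n * (z \<bullet> b) + real n * (c \<bullet> b))"
      by (intro Ck_affine bounded_linear_intros)
    then show "Ck k (\<lambda>z. real n * ((c - z) \<bullet> b))"
      by (simp add: inner_diff_left algebra_simps)
  qed
  then show ?thesis by (simp add: box_cutoff_def[abs_def])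
qed

lemma box_cutoff_bounds: "0 \<le> box_cutoff a c n z" "box_cutoff a c n z \<le> 1"
  unfolding box_cutoff_def
  by (auto intro!: prod_nonneg prod_le_1 mult_nonneg_nonneg mult_le_one flat_one_bounds)

lemma box_cutoff_eq_0: "z \<notin> box a c \<Longrightarrow> box_cutoff a c n z = 0"
  by (auto simp: box_cutoff_def mem_box flat_one inner_diff_left not_less mult_le_0_iff)

lemma box_cutoff_tendsto: "(\<lambda>n. box_cutoff a c n z) \<longlonglongrightarrow> indicator (box a c) z"
proof (cases "z \<in> box a c")
  case True
  have "(\<lambda>n. box_cutoff a c n z) \<longlonglongrightarrow> (\<Prod>b\<in>(Basis::'a set). 1 * 1)"
    unfolding box_cutoff_def
    using True by (intro tendsto_intros flat_one_scaled_tendsto) (auto simp: mem_box inner_diff_left)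
  then show ?thesis using True by simp
qed (simp add: box_cutoff_eq_0)

lemma test_function_box_cutoff:
  fixes a c :: "'a::euclidean_space"
  assumes "cbox a c \<subseteq> \<Omega>" "\<And>k. Ck k \<eta>"
  shows "(\<lambda>z. \<eta> z * box_cutoff a c n z) \<in> test_functions \<Omega>"
proof -
  have "box_cutoff a c n \<in> test_functions \<Omega>"
    using assms(1) box_subset_cbox[of a c] box_cutoff_eq_0[of _ a c n]
    by (intro test_functionsI[of _ "cbox a c"] Ck_box_cutoff compact_cbox) blast+
  from test_functions_scaleR[OF assms(2) this] show ?thesis by simp
qed

text \<open>A Dynkin class argument: open boxes are stable under intersection and generate the Borel
  sets, so all Borel set integrals vanish. A Lebesgue set differs from a Borel set by a null set,
  and an integrable function with vanishing set integrals is zero almost everywhere.\<close>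

lemma set_integral_zero_on_boxes_imp:
  fixes f :: "'a::euclidean_space \<Rightarrow> 'b::{banach,second_countable_topology}"
  assumes f: "integrable lebesgue f" and 0: "\<And>a c. (LINT z:box a c|lebesgue. f z) = 0"
  shows "AE z in lebesgue. f z = 0"
proof -
  have fA: "set_integrable lebesgue A f" if "A \<in> sets lebesgue" for A
    using f that by (simp add: set_integrable_def integrable_mult_indicator)
  let ?E = "range (\<lambda>(a, b). box a b::'a set)"
  \<comment> \<open>The complement step of the induction subtracts from the integral over the whole
    space, which is the limit over growing cubes.\<close>
  have UNIV0: "(LINT z|lebesgue. f z) = 0"
  proof -
    let ?B = "\<lambda>n::nat. box (- (real n *\<^sub>R One)) (real n *\<^sub>R One) :: 'a set"
    have "(\<lambda>n. LINT z:?B n|lebesgue. f z) \<longlonglongrightarrow> (LINT z:(\<Union>n. ?B n)|lebesgue. f z)"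
    proof (rule set_integral_cont_up)
      show "incseq ?B"
      proof (rule incseq_SucI)
        show "?B n \<subseteq> ?B (Suc n)" for n
          by (rule subset_box_imp) simp
      qed
    qed (auto intro: fA)
    then have "(\<lambda>n::nat. 0::'b) \<longlonglongrightarrow> (LINT z|lebesgue. f z)"
      unfolding UN_box_eq_UNIV 0 by (simp add: set_lebesgue_integral_def)
    then show ?thesis using LIMSEQ_unique tendsto_const by blast
  qed
  have borel0: "(LINT z:A|lebesgue. f z) = 0" if "A \<in> sets borel" for A
  proof -
    have "Int_stable ?E" by (auto simp: Int_stable_def box_Int_box)
    moreover have "?E \<subseteq> Pow UNIV" by simp
    moreover have "A \<in> sigma_sets UNIV ?E" using that by (simp add: borel_eq_box)
    ultimately show ?thesis
    proof (induction rule: sigma_sets_induct_disjoint)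
      case (basic A)
      then show ?case using 0 by auto
    next
      case empty
      show ?case by (simp add: set_lebesgue_integral_def)
    next
      case (compl A)
      then have A: "A \<in> sets lebesgue" by (simp add: borel_eq_box)
      have "(LINT z|lebesgue. f z) = (LINT z:A \<union> (UNIV - A)|lebesgue. f z)"
        by (simp add: set_lebesgue_integral_def)
      also have "\<dots> = (LINT z:A|lebesgue. f z) + (LINT z:UNIV - A|lebesgue. f z)"
        using A by (intro set_integral_Un fA) auto
      finally show ?case using UNIV0 compl by simp
    next
      case (union A)
      then have "A i \<in> sigma_sets UNIV ?E" for i by blast
      then have A: "A i \<in> sets lebesgue" for i by (auto simp: borel_eq_box)
      have "(LINT z:(\<Union>i. A i)|lebesgue. f z) = (\<Sum>i. (LINT z:(A i)|lebesgue. f z))"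
        using A union by (intro lebesgue_integral_countable_add fA) (auto simp: disjoint_family_on_def)
      then show ?case using union by simp
    qed
  qed
  show ?thesis
  proof (rule sigma_finite_measure.density_zero[OF _ f])
    obtain \<A> :: "'a set set" where "countable \<A>" "\<A> \<subseteq> sets lborel" "\<Union>\<A> = space lborel"
        "\<forall>A\<in>\<A>. emeasure lborel A \<noteq> \<infinity>"
      using lborel.sigma_finite_countable by metis
    then show "sigma_finite_measure (lebesgue :: 'a measure)"
      by (intro sigma_finite_measure.intro exI[of _ \<A>]) auto
    fix A :: "'a set" assume "A \<in> sets lebesgue"
    then obtain S N N' where A: "A = S \<union> N" "N \<subseteq> N'" "N' \<in> null_sets lborel" "S \<in> sets lborel"
      by (rule sets_completionE)
    have "AE z in lebesgue. z \<notin> N'"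
      using A(3) by (intro AE_not_in null_sets_completionI)
    then have "AE z in lebesgue. indicator A z *\<^sub>R f z = indicator S z *\<^sub>R f z"
      by eventually_elim (use A in \<open>auto simp: indicator_def\<close>)
    then have "(LINT z:A|lebesgue. f z) = (LINT z:S|lebesgue. f z)"
      unfolding set_lebesgue_integral_def using f A \<open>A \<in> sets lebesgue\<close>
      by (intro integral_cong_AE borel_measurable_scaleR borel_measurable_indicator borel_measurable_integrable) auto
    then show "(LINT z:A|lebesgue. f z) = 0" using borel0 A by simp
  qed
qed

lemma integrable_scaleR_test_function:
  fixes v :: "'a::euclidean_space \<Rightarrow> 'b::{banach,second_countable_topology}"
  assumes \<phi>: "(\<phi> :: 'a \<Rightarrow> real) \<in> test_functions \<Omega>" and \<Omega>: "\<Omega> \<in> sets lebesgue"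
    and v: "\<And>K. compact K \<Longrightarrow> K \<subseteq> \<Omega> \<Longrightarrow> v absolutely_integrable_on K"
  shows "integrable (lebesgue_on \<Omega>) (\<lambda>z. \<phi> z *\<^sub>R v z)"
proof -
  obtain K where K: "compact K" "K \<subseteq> \<Omega>" "\<And>z. z \<notin> K \<Longrightarrow> \<phi> z = 0"
    using test_functionsD[OF \<phi>] by metis
  obtain C where C: "\<And>z. norm (\<phi> z) \<le> C"
    using test_functions_bounded[OF \<phi>] by metis
  have [measurable]: "\<phi> \<in> borel_measurable borel" by (rule test_functions_measurable[OF \<phi>])
  have [measurable]: "\<phi> \<in> borel_measurable lebesgue" by (rule measurable_completion) simp
  have vK: "integrable lebesgue (\<lambda>z. indicator K z *\<^sub>R v z)"
    using v[OF K(1,2)] by (simp add: set_integrable_def)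
  have "integrable lebesgue (\<lambda>z. \<phi> z *\<^sub>R (indicator K z *\<^sub>R v z))"
  proof (rule Bochner_Integration.integrable_bound)
    show "integrable lebesgue (\<lambda>z. C *\<^sub>R (indicator K z *\<^sub>R v z))"
      by (intro integrable_scaleR_right vK)
    show "(\<lambda>z. \<phi> z *\<^sub>R indicat_real K z *\<^sub>R v z) \<in> borel_measurable lebesgue"
      using borel_measurable_integrable[OF vK] by measurable
    show "AE z in lebesgue. norm (\<phi> z *\<^sub>R indicat_real K z *\<^sub>R v z) \<le> norm (C *\<^sub>R indicat_real K z *\<^sub>R v z)"
    proof -
      have "\<bar>\<phi> z\<bar> \<le> \<bar>C\<bar>" for z using C[of z] by simp
      then have "norm (\<phi> z *\<^sub>R x) \<le> norm (C *\<^sub>R x)" for z and x :: 'b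
        by (simp add: mult_right_mono)
      then show ?thesis by blast
    qed
  qed
  also have "(\<lambda>z. \<phi> z *\<^sub>R (indicator K z *\<^sub>R v z)) = (\<lambda>z. indicator \<Omega> z *\<^sub>R (\<phi> z *\<^sub>R v z))"
    using K by (auto simp: indicator_def fun_eq_iff)
  finally show ?thesis
    using \<Omega> by (subst integrable_restrict_space) auto
qed

text \<open>Locally, on a closed box inside \<Omega>, limits of test functions produce the integrals
  of \<open>u\<close> over all smaller boxes; then \<Omega> is covered by countably many closed
  boxes.\<close>

lemma fundamental_lemma_calculus_of_variations:
  fixes u :: "'a::euclidean_space \<Rightarrow> 'b::{banach,second_countable_topology}"
  assumes \<Omega>: "open \<Omega>"
    and u: "\<And>K. compact K \<Longrightarrow> K \<subseteq> \<Omega> \<Longrightarrow> u absolutely_integrable_on K"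
    and 0: "\<And>\<phi> :: 'a \<Rightarrow> real. \<phi> \<in> test_functions \<Omega> \<Longrightarrow> (LINT z|lebesgue_on \<Omega>. \<phi> z *\<^sub>R u z) = 0"
  shows "AE z in lebesgue_on \<Omega>. u z = 0"
proof -
  have \<Omega>s: "\<Omega> \<in> sets lebesgue" using \<Omega> by (simp add: borel_open)
  have box0: "AE z in lebesgue. z \<in> cbox a c \<longrightarrow> u z = 0" if ac: "cbox a c \<subseteq> \<Omega>" for a c
  proof -
    let ?U = "\<lambda>z. indicat_real (cbox a c) z *\<^sub>R u z"
    have U: "integrable lebesgue ?U" using u[OF compact_cbox ac] by (simp add: set_integrable_def)
    have "(LINT z:box p q|lebesgue. indicat_real (box a c) z *\<^sub>R u z) = 0" for p q
    proof -
      \<comment> \<open>The first cutoff selects an arbitrary box, which may leave \<Omega>; the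
        second keeps the support in \<open>cbox a c\<close>. The product is therefore an admissible
        test function for all \<open>p\<close> and \<open>q\<close>, as the box criterion on the
        whole space demands.\<close>
      let ?\<phi> = "\<lambda>n z. box_cutoff p q n z * box_cutoff a c n z"
      have "(\<lambda>n. LINT z|lebesgue. ?\<phi> n z *\<^sub>R ?U z) \<longlonglongrightarrow>
            (LINT z|lebesgue. (indicator (box p q) z * indicator (box a c) z) *\<^sub>R ?U z)"
      proof (rule integral_dominated_convergence[where w="\<lambda>z. norm (?U z)"])
        have m: "?\<phi> n \<in> borel_measurable lebesgue" for n
        proof -
          have "box_cutoff x y n \<in> borel_measurable borel" for x y :: 'a
            by (intro borel_measurable_continuous_onI Ck_imp_continuous[OF Ck_box_cutoff[of 0]])
          then show ?thesis
            by (intro borel_measurable_times measurable_completion) simp_all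
        qed
        show "(\<lambda>z. ?\<phi> n z *\<^sub>R ?U z) \<in> borel_measurable lebesgue" for n
          by (rule borel_measurable_scaleR[OF m borel_measurable_integrable[OF U]])
        show "(\<lambda>z. (indicator (box p q) z * indicator (box a c) z) *\<^sub>R ?U z) \<in> borel_measurable lebesgue"
          by (intro borel_measurable_scaleR[OF _ borel_measurable_integrable[OF U]]
                borel_measurable_times borel_measurable_indicator) auto
        show "integrable lebesgue (\<lambda>z. norm (?U z))" by (rule integrable_norm[OF U])
        show "AE z in lebesgue. (\<lambda>n. ?\<phi> n z *\<^sub>R ?U z) \<longlonglongrightarrow>
            (indicator (box p q) z * indicator (box a c) z) *\<^sub>R ?U z"
          by (intro AE_I2 tendsto_intros box_cutoff_tendsto)
        have "\<bar>?\<phi> n z\<bar> \<le> 1" for n z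
          using box_cutoff_bounds[of p q n z] box_cutoff_bounds[of a c n z] by (simp add: abs_mult mult_le_one)
        then show "AE z in lebesgue. norm (?\<phi> n z *\<^sub>R ?U z) \<le> norm (?U z)" for n
          by (intro AE_I2) (simp only: norm_scaleR[of "?\<phi> n _"] mult_left_le_one_le[OF norm_ge_zero abs_ge_zero])
      qed
      moreover have "(LINT z|lebesgue. ?\<phi> n z *\<^sub>R ?U z) = 0" for n
      proof -
        have "(\<lambda>z. ?\<phi> n z *\<^sub>R ?U z) = (\<lambda>z. indicator \<Omega> z *\<^sub>R (?\<phi> n z *\<^sub>R u z))"
          using ac box_subset_cbox[of a c] box_cutoff_eq_0[of _ a c n] by (auto simp: indicator_def fun_eq_iff)
        then have "(LINT z|lebesgue. ?\<phi> n z *\<^sub>R ?U z) = (LINT z|lebesgue_on \<Omega>. ?\<phi> n z *\<^sub>R u z)"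
          using \<Omega>s by (simp add: integral_restrict_space)
        also have "\<dots> = 0"
          by (intro 0 test_function_box_cutoff ac Ck_box_cutoff)
        finally show ?thesis .
      qed
      ultimately have "(LINT z|lebesgue. (indicator (box p q) z * indicator (box a c) z) *\<^sub>R ?U z) = 0"
        by (simp only: LIMSEQ_const_iff)
      also have "(\<lambda>z. (indicat_real (box p q) z * indicator (box a c) z) *\<^sub>R ?U z) =
          (\<lambda>z. indicat_real (box p q) z *\<^sub>R indicat_real (box a c) z *\<^sub>R u z)"
        using box_subset_cbox[of a c] by (auto simp: indicator_def fun_eq_iff)
      finally show ?thesis by (simp add: set_lebesgue_integral_def)
    qed
    moreover have "integrable lebesgue (\<lambda>z. indicat_real (box a c) z *\<^sub>R u z)"
    proof -
      have "integrable lebesgue (\<lambda>z. indicat_real (box a c) z *\<^sub>R ?U z)"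
        by (intro integrable_mult_indicator U) auto
      also have "(\<lambda>z. indicat_real (box a c) z *\<^sub>R ?U z) = (\<lambda>z. indicat_real (box a c) z *\<^sub>R u z)"
        using box_subset_cbox[of a c] by (auto simp: indicator_def fun_eq_iff)
      finally show ?thesis .
    qed
    ultimately have "AE z in lebesgue. indicat_real (box a c) z *\<^sub>R u z = 0"
      by (intro set_integral_zero_on_boxes_imp)
    moreover have "AE z in lebesgue. z \<notin> cbox a c - box a c"
      using negligible_frontier_interval[of a c] by (intro AE_not_in) (simp add: negligible_iff_null_sets)
    ultimately show ?thesis by eventually_elim (auto simp: indicator_def)
  qed
  obtain \<D> where \<D>: "countable \<D>" "\<D> \<subseteq> Pow \<Omega>" "\<And>X. X \<in> \<D> \<Longrightarrow> \<exists>a b. X = cbox a b" "\<Union>\<D> = \<Omega>"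
    using open_countable_Union_open_cbox[OF \<Omega>] by metis
  have "AE z in lebesgue. \<forall>X\<in>\<D>. z \<in> X \<longrightarrow> u z = 0"
    using \<D>(2,3) box0 by (subst AE_ball_countable[OF \<D>(1)]) blast
  then have "AE z in lebesgue. z \<in> \<Omega> \<longrightarrow> u z = 0"
    by eventually_elim (use \<D>(4) in blast)
  then show ?thesis using \<Omega>s by (subst AE_restrict_space_iff) auto
qed

text \<open>Sobolev space, trace and weak Laplacian each choose their own representatives of the
  derivatives. This lemma identifies them, and it allows almost everywhere equal \<open>u\<close>
  and \<open>u'\<close> so that it can be iterated to second derivatives.\<close>

lemma has_weak_deriv_unique:
  fixes u u' v v' :: "'a::euclidean_space \<Rightarrow> 'b::{banach,second_countable_topology}"
  assumes \<Omega>: "open \<Omega>" and b: "b \<in> Basis"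
    and v: "has_weak_deriv \<Omega> b u v" and v': "has_weak_deriv \<Omega> b u' v'"
    and u: "AE z in lebesgue_on \<Omega>. u z = u' z"
  shows "AE z in lebesgue_on \<Omega>. v z = v' z"
proof -
  have "AE z in lebesgue_on \<Omega>. v z - v' z = 0"
  proof (rule fundamental_lemma_calculus_of_variations[OF \<Omega>])
    show "(\<lambda>z. v z - v' z) absolutely_integrable_on K" if "compact K" "K \<subseteq> \<Omega>" for K
      using v v' that by (intro set_integral_diff) (auto simp: has_weak_deriv_def)
    fix \<phi> :: "'a \<Rightarrow> real" assume \<phi>: "\<phi> \<in> test_functions \<Omega>"
    have \<Omega>s: "\<Omega> \<in> sets lebesgue" using \<Omega> by (simp add: borel_open)
    note d = test_functions_partial_deriv[OF \<phi> b]
    have "integrable (lebesgue_on \<Omega>) (\<lambda>z. partial_deriv b \<phi> z *\<^sub>R u z)"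
      "integrable (lebesgue_on \<Omega>) (\<lambda>z. partial_deriv b \<phi> z *\<^sub>R u' z)"
      using v v' by (auto simp: has_weak_deriv_def intro!: integrable_scaleR_test_function[OF d \<Omega>s])
    then have "(LINT z|lebesgue_on \<Omega>. partial_deriv b \<phi> z *\<^sub>R u z) = (LINT z|lebesgue_on \<Omega>. partial_deriv b \<phi> z *\<^sub>R u' z)"
      using u by (intro integral_cong_AE borel_measurable_integrable) auto
    then have "(LINT z|lebesgue_on \<Omega>. \<phi> z *\<^sub>R v z) = (LINT z|lebesgue_on \<Omega>. \<phi> z *\<^sub>R v' z)"
      using v v' \<phi> by (simp add: has_weak_deriv_def)
    then show "(LINT z|lebesgue_on \<Omega>. \<phi> z *\<^sub>R (v z - v' z)) = 0"
      using v v' integrable_scaleR_test_function[OF \<phi> \<Omega>s, of v] integrable_scaleR_test_function[OF \<phi> \<Omega>s, of v']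
      by (simp add: scaleR_diff_right has_weak_deriv_def)
  qed
  then show ?thesis by simp
qed

subsection \<open>Integration by parts\<close>

text \<open>Weak derivatives are defined by real test functions only. A vector-valued \<phi> is
  handled through its components, each of which is a real test function.\<close>

lemma ip_weak_deriv:
  fixes u v \<phi> :: "'a::euclidean_space \<Rightarrow> 'b::euclidean_space"
  assumes \<Omega>: "\<Omega> \<in> sets lebesgue" and b: "b \<in> Basis"
    and uv: "has_weak_deriv \<Omega> b u v" and \<phi>: "\<phi> \<in> test_functions \<Omega>"
  shows "ip \<Omega> \<phi> v = - ip \<Omega> (partial_deriv b \<phi>) u"
proof -
  have split: "ip \<Omega> \<psi> w = (\<Sum>i\<in>Basis. (LINT z|lebesgue_on \<Omega>. (\<psi> z \<bullet> i) *\<^sub>R w z) \<bullet> i)"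
    if \<psi>: "\<psi> \<in> test_functions \<Omega>" and w: "\<And>K. compact K \<Longrightarrow> K \<subseteq> \<Omega> \<Longrightarrow> w absolutely_integrable_on K" for \<psi> w :: "'a \<Rightarrow> 'b"
  proof -
    have int: "integrable (lebesgue_on \<Omega>) (\<lambda>z. (\<psi> z \<bullet> i) *\<^sub>R w z)" for i
      by (intro integrable_scaleR_test_function \<Omega> w test_functions_bounded_linear[OF _ \<psi>] bounded_linear_intros)
    have "ip \<Omega> \<psi> w = (LINT z|lebesgue_on \<Omega>. (\<Sum>i\<in>Basis. ((\<psi> z \<bullet> i) *\<^sub>R w z) \<bullet> i))"
      unfolding ip_def by (subst euclidean_inner) simp
    also have "\<dots> = (\<Sum>i\<in>Basis. (LINT z|lebesgue_on \<Omega>. (\<psi> z \<bullet> i) *\<^sub>R w z) \<bullet> i)"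
      by (subst Bochner_Integration.integral_sum) (auto intro!: int sum.cong integral_inner_left simp del: inner_scaleR_left)
    finally show ?thesis .
  qed
  have "(LINT z|lebesgue_on \<Omega>. (\<phi> z \<bullet> i) *\<^sub>R v z) = - (LINT z|lebesgue_on \<Omega>. (partial_deriv b \<phi> z \<bullet> i) *\<^sub>R u z)" for i
  proof -
    have "(\<lambda>z. \<phi> z \<bullet> i) \<in> test_functions \<Omega>"
      by (intro test_functions_bounded_linear[OF _ \<phi>] bounded_linear_intros)
    moreover have "partial_deriv b (\<lambda>z. \<phi> z \<bullet> i) = (\<lambda>z. partial_deriv b \<phi> z \<bullet> i)"
      by (intro partial_deriv_eq has_derivative_inner_left test_functions_has_derivative[OF \<phi>])
    moreover have "(LINT z|lebesgue_on \<Omega>. partial_deriv b \<phi>' z *\<^sub>R u z) = - (LINT z|lebesgue_on \<Omega>. \<phi>' z *\<^sub>R v z)"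
      if "\<phi>' \<in> test_functions \<Omega>" for \<phi>' :: "'a \<Rightarrow> real"
      using uv that unfolding has_weak_deriv_def by blast
    ultimately show ?thesis by (metis (no_types) minus_minus)
  qed
  then show ?thesis
    using uv split[OF \<phi>, of v] split[OF test_functions_partial_deriv[OF \<phi> b], of u]
    by (simp add: has_weak_deriv_def sum_negf)
qed

lemma ip_cutoff_tendsto:
  fixes f g :: "'a::euclidean_space \<Rightarrow> 'b::euclidean_space"
  assumes f: "f \<in> L2 \<Omega>" and g: "g \<in> L2 \<Omega>"
    and \<eta>: "\<And>n::nat. \<eta> n \<in> borel_measurable borel" "\<And>n z. \<bar>\<eta> n z\<bar> \<le> 1" "\<And>z. z \<in> \<Omega> \<Longrightarrow> (\<lambda>n. \<eta> n z) \<longlonglongrightarrow> 1"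
  shows "(\<lambda>n. ip \<Omega> (\<lambda>z. \<eta> n z *\<^sub>R f z) g) \<longlonglongrightarrow> ip \<Omega> f g"
  unfolding ip_def
proof (rule integral_dominated_convergence[where w="\<lambda>z. norm (f z \<bullet> g z)"])
  show "(\<lambda>z. (\<eta> n z *\<^sub>R f z) \<bullet> g z) \<in> borel_measurable (lebesgue_on \<Omega>)" for n
    using f g borel_measurable_lebesgue_on[OF \<eta>(1)] by (auto simp: L2_def)
  show "AE z in lebesgue_on \<Omega>. norm ((\<eta> n z *\<^sub>R f z) \<bullet> g z) \<le> norm (f z \<bullet> g z)" for n
    using \<eta>(2) by (auto simp: abs_mult mult_left_le_one_le)
  have "(\<lambda>n. (\<eta> n z *\<^sub>R f z) \<bullet> g z) \<longlonglongrightarrow> (1 *\<^sub>R f z) \<bullet> g z" if "z \<in> \<Omega>" for z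
    by (intro tendsto_intros \<eta> that)
  then show "AE z in lebesgue_on \<Omega>. (\<lambda>n. (\<eta> n z *\<^sub>R f z) \<bullet> g z) \<longlonglongrightarrow> f z \<bullet> g z"
    by (intro AE_I2) simp
  show "(\<lambda>z. f z \<bullet> g z) \<in> borel_measurable (lebesgue_on \<Omega>)"
    using f g by (auto simp: L2_def)
qed (use integrable_inner_L2[OF f g] in auto)

section \<open>Integration by parts in the strip and boundary values\<close>

lemma open_strip: "open (strip \<epsilon>)"
  by (simp add: strip_def open_Times)

lemma strip_sets: "strip \<epsilon> \<in> sets lebesgue" "strip \<epsilon> \<in> sets borel"
  using borel_open[OF open_strip] by simp_all

lemma Basis_plane: "(1, 0) \<in> (Basis :: (real \<times> real) set)" "(0, 1) \<in> (Basis :: (real \<times> real) set)"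
  "(Basis :: (real \<times> real) set) = {(1, 0), (0, 1)}"
  by (auto simp add: Basis_prod_def)

lemma has_vector_derivative_slice:
  fixes f :: "real \<times> real \<Rightarrow> 'b::real_normed_vector"
  assumes "(f has_derivative f') (at (x, y))"
  shows "((\<lambda>x. f (x, y)) has_vector_derivative f' (1, 0)) (at x)"
    and "((\<lambda>y. f (x, y)) has_vector_derivative f' (0, 1)) (at y)"
proof -
  have "((\<lambda>x. f (x, y)) has_derivative (\<lambda>h. f' (h, 0))) (at x)"
    by (rule has_derivative_compose[where g=f and f="\<lambda>x. (x, y)"])
       (use assms in \<open>auto intro!: derivative_eq_intros\<close>)
  moreover have "(\<lambda>h. f' (h, 0)) = (\<lambda>h. h *\<^sub>R f' (1, 0))"
  proof
    show "f' (h, 0) = h *\<^sub>R f' (1, 0)" for h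
      using linear_scale[OF has_derivative_linear[OF assms], of h "(1, 0)"] by simp
  qed
  ultimately show "((\<lambda>x. f (x, y)) has_vector_derivative f' (1, 0)) (at x)"
    by (simp only: has_vector_derivative_def)
  have "((\<lambda>y. f (x, y)) has_derivative (\<lambda>h. f' (0, h))) (at y)"
    by (rule has_derivative_compose[where g=f and f="\<lambda>y. (x, y)"])
       (use assms in \<open>auto intro!: derivative_eq_intros\<close>)
  moreover have "(\<lambda>h. f' (0, h)) = (\<lambda>h. h *\<^sub>R f' (0, 1))"
  proof
    show "f' (0, h) = h *\<^sub>R f' (0, 1)" for h
      using linear_scale[OF has_derivative_linear[OF assms], of h "(0, 1)"] by simp
  qed
  ultimately show "((\<lambda>y. f (x, y)) has_vector_derivative f' (0, 1)) (at y)"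
    by (simp only: has_vector_derivative_def)
qed

text \<open>The test function need not vanish on the boundary of the strip: since only tangential
  derivatives are involved, cutting off near the boundary costs nothing.\<close>

lemma ip_weak_deriv_tangential:
  fixes u v \<phi> :: "real \<times> real \<Rightarrow> 'b::euclidean_space"
  assumes u: "u \<in> L2 (strip \<epsilon>)" and v: "v \<in> L2 (strip \<epsilon>)"
    and uv: "has_weak_deriv (strip \<epsilon>) (1, 0) u v" and \<phi>: "\<phi> \<in> test_functions UNIV"
  shows "ip (strip \<epsilon>) \<phi> v = - ip (strip \<epsilon>) (partial_deriv (1, 0) \<phi>) u"
proof -
  \<comment> \<open>Subtracting 1 makes \<open>\<eta> n\<close> vanish at distance at most 1 / (n +
    1) from either boundary line, so its product with \<phi> has compact support inside the open
    strip. The cutoff depends on \<open>y\<close> alone, hence its growing derivative never meets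
    the derivative in \<open>x\<close>.\<close>
  define \<eta> :: "nat \<Rightarrow> real \<times> real \<Rightarrow> real" where
    "\<eta> n z = flat 1 (real (Suc n) * snd z - 1) * flat 1 (real (Suc n) * (\<epsilon> - snd z) - 1)" for n z
  have Ck\<eta>: "Ck k (\<eta> n)" for k n
  proof -
    have "Ck k (\<lambda>z::real \<times> real. flat 1 (real (Suc n) * snd z + - 1) *\<^sub>R
        flat 1 (- real (Suc n) * snd z + (real (Suc n) * \<epsilon> - 1)))"
      by (intro Ck_scaleR flat_smooth Ck_affine bounded_linear_const_mult bounded_linear_snd)
    then show ?thesis by (simp add: \<eta>_def[abs_def] algebra_simps)
  qed
  have bd: "\<bar>\<eta> n z\<bar> \<le> 1" for n z
    by (auto simp: \<eta>_def abs_mult abs_of_nonneg flat_one_bounds intro!: mult_le_one)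
  have lim: "(\<lambda>n. \<eta> n z) \<longlonglongrightarrow> 1" if z: "z \<in> strip \<epsilon>" for z
  proof -
    have *: "(\<lambda>n. flat 1 (real (Suc n) * t - 1)) \<longlonglongrightarrow> 1" if "t > 0" for t
    proof (rule filterlim_compose[OF flat_one_tendsto])
      show "filterlim (\<lambda>n. real (Suc n) * t - 1) at_top sequentially"
        using filterlim_tendsto_add_at_top[OF tendsto_const[of "-1"]
            filterlim_tendsto_pos_mult_at_top[OF tendsto_const that
              filterlim_compose[OF filterlim_real_sequentially filterlim_Suc]]]
        by (simp add: algebra_simps)
    qed
    have "(\<lambda>n. \<eta> n z) \<longlonglongrightarrow> 1 * 1"
      unfolding \<eta>_def using z by (intro tendsto_mult *) (auto simp: strip_def)
    then show ?thesis by simp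
  qed
  have meas: "\<eta> n \<in> borel_measurable borel" for n
    by (intro borel_measurable_continuous_onI Ck_imp_continuous[OF Ck\<eta>[of 0]])
  have eq: "ip (strip \<epsilon>) (\<lambda>z. \<eta> n z *\<^sub>R \<phi> z) v = - ip (strip \<epsilon>) (\<lambda>z. \<eta> n z *\<^sub>R partial_deriv (1, 0) \<phi> z) u" for n
  proof -
    obtain K where K: "compact K" "\<And>z. z \<notin> K \<Longrightarrow> \<phi> z = 0" "\<And>k. Ck k \<phi>"
      using test_functionsD[OF \<phi>] by metis
    have "(\<lambda>z. \<eta> n z *\<^sub>R \<phi> z) \<in> test_functions (strip \<epsilon>)"
    proof (rule test_functionsI)
      let ?L = "K \<inter> (UNIV \<times> {1 / real (Suc n)..\<epsilon> - 1 / real (Suc n)})"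
      show "{z. \<eta> n z *\<^sub>R \<phi> z \<noteq> 0} \<subseteq> ?L"
        using K(2) by (force simp: \<eta>_def flat_one field_simps split: if_splits)
      show "compact ?L" by (intro compact_Int_closed K closed_Times) auto
      have "UNIV \<times> {d..\<epsilon> - d} \<subseteq> strip \<epsilon>" if "d > 0" for d
        using that by (auto simp: strip_def)
      from this[of "1 / real (Suc n)"] show "?L \<subseteq> strip \<epsilon>" by auto
    qed (intro Ck_scaleR Ck\<eta> K)
    from ip_weak_deriv[OF strip_sets(1) Basis_plane(1) uv this]
    have "ip (strip \<epsilon>) (\<lambda>z. \<eta> n z *\<^sub>R \<phi> z) v = - ip (strip \<epsilon>) (partial_deriv (1, 0) (\<lambda>z. \<eta> n z *\<^sub>R \<phi> z)) u" .
    also have "partial_deriv (1, 0) (\<lambda>z. \<eta> n z *\<^sub>R \<phi> z) = (\<lambda>z. \<eta> n z *\<^sub>R partial_deriv (1, 0) \<phi> z)"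
    proof
      fix z :: "real \<times> real"
      obtain x y where z: "z = (x, y)" by (cases z)
      note d\<eta> = Ck_Suc_has_derivative[OF Ck\<eta>[of "Suc 0" n], of z]
      have "((\<lambda>x. \<eta> n (x, y)) has_vector_derivative frechet_derivative (\<eta> n) (at z) (1, 0)) (at x)"
        using has_vector_derivative_slice(1)[OF d\<eta>[unfolded z]] unfolding z .
      moreover have "((\<lambda>x. \<eta> n (x, y)) has_vector_derivative 0) (at x)"
        by (simp add: \<eta>_def)
      ultimately have 0: "frechet_derivative (\<eta> n) (at z) (1, 0) = 0"
        by (rule vector_derivative_unique_at)
      have "((\<lambda>z. \<eta> n z *\<^sub>R \<phi> z) has_derivative (\<lambda>h. \<eta> n z *\<^sub>R frechet_derivative \<phi> (at z) h +
            frechet_derivative (\<eta> n) (at z) h *\<^sub>R \<phi> z)) (at z)"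
        by (intro has_derivative_scaleR d\<eta> test_functions_has_derivative[OF \<phi>])
      from fun_cong[OF frechet_derivative_at[OF this], of "(1, 0)"] 0
      show "partial_deriv (1, 0) (\<lambda>z. \<eta> n z *\<^sub>R \<phi> z) z = \<eta> n z *\<^sub>R partial_deriv (1, 0) \<phi> z" by simp
    qed
    finally show ?thesis .
  qed
  have "(\<lambda>n. ip (strip \<epsilon>) (\<lambda>z. \<eta> n z *\<^sub>R \<phi> z) v) \<longlonglongrightarrow> ip (strip \<epsilon>) \<phi> v"
    by (intro ip_cutoff_tendsto test_functions_L2[OF \<phi>] strip_sets v meas bd lim)
  moreover have "(\<lambda>n. - ip (strip \<epsilon>) (\<lambda>z. \<eta> n z *\<^sub>R partial_deriv (1, 0) \<phi> z) u) \<longlonglongrightarrow>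
      - ip (strip \<epsilon>) (partial_deriv (1, 0) \<phi>) u"
    by (intro tendsto_minus ip_cutoff_tendsto test_functions_L2[OF test_functions_partial_deriv[OF \<phi> Basis_plane(1)]]
          strip_sets u meas bd lim)
  ultimately show ?thesis unfolding eq by (rule LIMSEQ_unique)
qed

text \<open>Fubini's theorem, followed by the fundamental theorem of calculus in \<open>y\<close>.
  The weight may be merely bounded and measurable because it is constant in \<open>y\<close>.
  Vanishing off \<open>K\<close> is asked only inside the strip, since the integrands
  \<open>g1\<close> and \<open>g2\<close> of the trial function are not cut off in
  \<open>y\<close>.\<close>

lemma integral_strip_derivative:
  fixes \<beta> :: "real \<Rightarrow> real" and g G :: "real \<times> real \<Rightarrow> real"
  assumes \<epsilon>: "\<epsilon> > 0" and \<beta>: "\<beta> \<in> borel_measurable borel" "\<And>x. \<bar>\<beta> x\<bar> \<le> C"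
    and g: "continuous_on UNIV g" "compact K" "\<And>z. z \<in> strip \<epsilon> \<Longrightarrow> z \<notin> K \<Longrightarrow> g z = 0"
    and G: "\<And>x y. ((\<lambda>y. G (x, y)) has_vector_derivative g (x, y)) (at y)"
  shows "integrable (lebesgue_on (strip \<epsilon>)) (\<lambda>z. \<beta> (fst z) * g z)"
    and "(LINT z|lebesgue_on (strip \<epsilon>). \<beta> (fst z) * g z) = (LINT x|lborel. \<beta> x * (G (x, \<epsilon>) - G (x, 0)))"
proof -
  have gm [measurable]: "g \<in> borel_measurable borel"
    by (rule borel_measurable_continuous_onI[OF g(1)])
  have fstm [measurable]: "fst \<in> borel_measurable (borel :: (real \<times> real) measure)"
    by (rule borel_measurable_continuous_onI) (intro continuous_intros)
  have \<beta>m: "(\<lambda>z::real \<times> real. \<beta> (fst z)) \<in> borel_measurable borel"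
    using \<beta>(1) by (rule measurable_compose[OF fstm])
  have S [measurable]: "strip \<epsilon> \<in> sets borel" by (rule strip_sets)
  have int: "integrable lborel (\<lambda>z. indicator (strip \<epsilon>) z * (\<beta> (fst z) * g z))"
  proof (rule Bochner_Integration.integrable_bound)
    have "integrable lborel (\<lambda>z. indicator K z *\<^sub>R g z)"
      by (intro borel_integrable_compact g continuous_on_subset[OF g(1)]) simp
    then show "integrable lborel (\<lambda>z. C * (indicator K z *\<^sub>R g z))" by (intro integrable_mult_right)
    have "\<bar>indicator (strip \<epsilon>) z * (\<beta> (fst z) * g z)\<bar> \<le> \<bar>C * (indicator K z *\<^sub>R g z)\<bar>" for z
    proof -
      have "\<bar>\<beta> (fst z)\<bar> * \<bar>g z\<bar> \<le> \<bar>C\<bar> * \<bar>g z\<bar>"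
        using \<beta>(2)[of "fst z"] by (intro mult_right_mono) auto
      then show ?thesis using g(3)[of z] by (auto simp: indicator_def abs_mult)
    qed
    then show "AE z in lborel. norm (indicator (strip \<epsilon>) z * (\<beta> (fst z) * g z)) \<le> norm (C * (indicator K z *\<^sub>R g z))"
      by simp
    show "(\<lambda>z. indicator (strip \<epsilon>) z * (\<beta> (fst z) * g z)) \<in> borel_measurable lborel"
      using \<beta>m by simp
  qed
  have "integrable lebesgue (\<lambda>z. indicator (strip \<epsilon>) z * (\<beta> (fst z) * g z))"
    using int by (subst integrable_completion) (use \<beta>m in auto)
  then show "integrable (lebesgue_on (strip \<epsilon>)) (\<lambda>z. \<beta> (fst z) * g z)"
    by (subst integrable_restrict_space) (auto simp: strip_sets)
  have "(LINT z|lebesgue_on (strip \<epsilon>). \<beta> (fst z) * g z) = (LINT z|lborel. indicator (strip \<epsilon>) z * (\<beta> (fst z) * g z))"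
    using \<beta>m by (subst integral_lebesgue_on_borel) auto
  also have "\<dots> = (LINT x|lborel. LINT y|lborel. indicator (strip \<epsilon>) (x, y) * (\<beta> (fst (x, y)) * g (x, y)))"
    using lborel_pair.integral_fst'[OF int[folded lborel_prod]] by (simp only: lborel_prod)
  also have "\<dots> = (LINT x|lborel. \<beta> x * (G (x, \<epsilon>) - G (x, 0)))"
  proof (rule Bochner_Integration.integral_cong[OF refl])
    fix x :: real
    have AE: "AE y in lborel. indicator (strip \<epsilon>) (x, y) * (\<beta> (fst (x, y)) * g (x, y)) =
        \<beta> x * (indicator {0..\<epsilon>} y *\<^sub>R g (x, y))"
      using AE_lborel_singleton[of 0] AE_lborel_singleton[of \<epsilon>]
      by eventually_elim (auto simp: strip_def indicator_def)
    have gx [measurable]: "(\<lambda>y. g (x, y)) \<in> borel_measurable borel"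
      by (intro borel_measurable_continuous_onI continuous_on_compose2[OF g(1)]) (auto intro!: continuous_intros)
    have "(\<lambda>y. indicat_real (strip \<epsilon>) (x, y)) = indicator {0<..<\<epsilon>}"
      by (auto simp: strip_def indicator_def)
    then have [measurable]: "(\<lambda>y. indicat_real (strip \<epsilon>) (x, y)) \<in> borel_measurable borel"
      by simp
    have "(LINT y|lborel. indicator (strip \<epsilon>) (x, y) * (\<beta> (fst (x, y)) * g (x, y))) =
        (LINT y|lborel. \<beta> x * (indicator {0..\<epsilon>} y *\<^sub>R g (x, y)))"
      by (rule integral_cong_AE[OF _ _ AE]) auto
    also have "\<dots> = \<beta> x * (LINT y|lborel. indicator {0..\<epsilon>} y *\<^sub>R g (x, y))"
      by (rule integral_mult_right_zero)
    also have "(LINT y|lborel. indicator {0..\<epsilon>} y *\<^sub>R g (x, y)) = G (x, \<epsilon>) - G (x, 0)"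
    proof (rule integral_FTC_atLeastAtMost)
      show "continuous_on {0..\<epsilon>} (\<lambda>y. g (x, y))"
        by (intro continuous_on_compose2[OF g(1)]) (auto intro!: continuous_intros)
    qed (use \<epsilon> in \<open>auto intro: has_vector_derivative_at_within[OF G]\<close>)
    finally show "(LINT y|lborel. indicator (strip \<epsilon>) (x, y) * (\<beta> (fst (x, y)) * g (x, y))) =
        \<beta> x * (G (x, \<epsilon>) - G (x, 0))" .
  qed
  finally show "(LINT z|lebesgue_on (strip \<epsilon>). \<beta> (fst z) * g z) = (LINT x|lborel. \<beta> x * (G (x, \<epsilon>) - G (x, 0)))" .
qed

lemma strip_weight_measurable:
  fixes \<beta> w :: "real \<Rightarrow> real"
  assumes "\<beta> \<in> borel_measurable borel" "continuous_on UNIV w"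
  shows "(\<lambda>z. \<beta> (fst z) * w (snd z)) \<in> borel_measurable (lebesgue_on (strip \<epsilon>))"
proof (rule borel_measurable_lebesgue_on)
  have 1: "fst \<in> borel_measurable (borel :: (real \<times> real) measure)"
    by (rule borel_measurable_continuous_onI) (intro continuous_intros)
  have 2: "snd \<in> borel_measurable (borel :: (real \<times> real) measure)"
    by (rule borel_measurable_continuous_onI) (intro continuous_intros)
  show "(\<lambda>z. \<beta> (fst z) * w (snd z)) \<in> borel_measurable borel"
    by (intro borel_measurable_times measurable_compose[OF 1 assms(1)]
          measurable_compose[OF 2 borel_measurable_continuous_onI[OF assms(2)]])
qed

lemma L2_strip_weight:
  fixes f :: "real \<times> real \<Rightarrow> 'b::euclidean_space"
  assumes "\<beta> \<in> borel_measurable borel" "\<And>x. \<bar>\<beta> x\<bar> \<le> C" "f \<in> L2 (strip \<epsilon>)"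
  shows "(\<lambda>z. \<beta> (fst z) *\<^sub>R f z) \<in> L2 (strip \<epsilon>)"
  using strip_weight_measurable[OF assms(1), of "\<lambda>_. 1"]
  by (intro L2_mult_bounded[OF assms(3) _ strip_sets(1) assms(2)]) auto

lemma L2_test_function_slice:
  fixes \<phi> :: "real \<times> real \<Rightarrow> 'b::euclidean_space"
  assumes \<phi>: "\<phi> \<in> test_functions UNIV"
  shows "(\<lambda>x. \<phi> (x, s)) \<in> L2 UNIV"
proof -
  obtain K where K: "compact K" "\<And>z. z \<notin> K \<Longrightarrow> \<phi> z = 0"
    using test_functionsD[OF \<phi>] by metis
  show ?thesis
  proof (rule L2_compact_support)
    show "continuous_on UNIV (\<lambda>x. \<phi> (x, s))"
      by (intro continuous_on_compose2[OF test_functions_continuous[OF \<phi>]]) (auto intro!: continuous_intros)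
    show "compact (fst ` K)"
      by (intro compact_continuous_image K continuous_intros)
    show "\<phi> (x, s) = 0" if "x \<notin> fst ` K" for x
      using that K(2)[of "(x, s)"] by force
  qed simp
qed

lemma trace_weight_bound:
  assumes "\<epsilon> > 0" "s = 0 \<or> s = \<epsilon>" "z \<in> strip \<epsilon>" "\<bar>b\<bar> \<le> C"
  shows "\<bar>b * ((snd z - (\<epsilon> - s)) / \<epsilon>)\<bar> \<le> C"
proof -
  have "\<bar>(snd z - (\<epsilon> - s)) / \<epsilon>\<bar> \<le> 1"
    using assms(1-3) by (auto simp: strip_def)
  then have "\<bar>b * ((snd z - (\<epsilon> - s)) / \<epsilon>)\<bar> \<le> \<bar>b\<bar> * 1"
    unfolding abs_mult by (intro mult_left_mono) auto
  then show ?thesis using assms(4) by simp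
qed

text \<open>The weight \<open>(y - (\<epsilon> - s)) / \<epsilon>\<close> vanishes on the boundary line opposite to \<open>y = s\<close>, so that
  integrating the \<open>y\<close>-derivative over the strip isolates the trace on \<open>y = s\<close>.\<close>

lemma trace_identity:
  fixes u uy \<phi> :: "real \<times> real \<Rightarrow> complex"
  assumes \<epsilon>: "\<epsilon> > 0" and s: "s = 0 \<or> s = \<epsilon>"
    and \<beta>: "\<beta> \<in> borel_measurable borel" "\<And>x. \<bar>\<beta> x\<bar> \<le> C"
    and tr: "has_trace \<epsilon> s u g" and \<phi>: "\<phi> \<in> test_functions UNIV"
    and uy: "uy \<in> L2 (strip \<epsilon>)" "has_weak_deriv (strip \<epsilon>) (0, 1) u uy"
  shows "ip (strip \<epsilon>) (\<lambda>z. (\<beta> (fst z) * ((snd z - (\<epsilon> - s)) / \<epsilon>)) *\<^sub>R \<phi> z) uy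
       + ip (strip \<epsilon>) (\<lambda>z. (\<beta> (fst z) * ((snd z - (\<epsilon> - s)) / \<epsilon>)) *\<^sub>R partial_deriv (0, 1) \<phi> z
           + (1 / \<epsilon>) *\<^sub>R (\<beta> (fst z) *\<^sub>R \<phi> z)) u
       = ip UNIV (\<lambda>x. \<beta> x *\<^sub>R \<phi> (x, s)) g"
proof -
  let ?S = "strip \<epsilon>" and ?w = "\<lambda>y. (y - (\<epsilon> - s)) / \<epsilon>" and ?\<phi>y = "partial_deriv (0, 1) \<phi>"
  obtain du \<Phi> where g: "g \<in> L2 UNIV" and u: "u \<in> L2 ?S"
    and du: "\<And>b. b \<in> Basis \<Longrightarrow> du b \<in> L2 ?S \<and> has_weak_deriv ?S b u (du b)"
    and \<Phi>: "\<And>n::nat. \<Phi> n \<in> test_functions UNIV"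
    and lim: "(\<lambda>n. L2_norm ?S (\<lambda>z. \<Phi> n z - u z)) \<longlonglongrightarrow> 0"
    and limy: "\<And>b. b \<in> Basis \<Longrightarrow> (\<lambda>n. L2_norm ?S (\<lambda>z. partial_deriv b (\<Phi> n) z - du b z)) \<longlonglongrightarrow> 0"
    and limg: "(\<lambda>n. L2_norm UNIV (\<lambda>x. \<Phi> n (x, s) - g x)) \<longlonglongrightarrow> 0"
    using tr unfolding has_trace_def by blast
  note e2 = Basis_plane(2)
  note \<phi>y = test_functions_partial_deriv[OF \<phi> e2] and \<Phi>y = test_functions_partial_deriv[OF \<Phi> e2]
  \<comment> \<open>The trace brings its own \<open>y\<close>-derivative of \<open>u\<close>, the
    one that the approximating sequence converges to.\<close>
  have duy: "AE z in lebesgue_on ?S. du (0, 1) z = uy z"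
    by (rule has_weak_deriv_unique[OF open_strip e2 conjunct2[OF du[OF e2]] uy(2)]) simp
  have wm: "(\<lambda>z. \<beta> (fst z) * ?w (snd z)) \<in> borel_measurable (lebesgue_on ?S)"
    using \<epsilon> by (intro strip_weight_measurable \<beta>) (auto intro!: continuous_intros)
  note wC = trace_weight_bound[OF \<epsilon> s _ \<beta>(2)]
  have w\<phi>: "(\<lambda>z. (\<beta> (fst z) * ?w (snd z)) *\<^sub>R \<phi> z) \<in> L2 ?S"
    and w\<phi>y: "(\<lambda>z. (\<beta> (fst z) * ?w (snd z)) *\<^sub>R ?\<phi>y z) \<in> L2 ?S"
    by (rule L2_mult_bounded[OF test_functions_L2[OF \<phi> strip_sets(1)] wm strip_sets(1)]
          L2_mult_bounded[OF test_functions_L2[OF \<phi>y strip_sets(1)] wm strip_sets(1)], erule wC)+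
  have \<psi>: "(\<lambda>z. (\<beta> (fst z) * ?w (snd z)) *\<^sub>R ?\<phi>y z + (1 / \<epsilon>) *\<^sub>R (\<beta> (fst z) *\<^sub>R \<phi> z)) \<in> L2 ?S" (is "?\<psi> \<in> _")
    by (intro L2_add w\<phi>y L2_scaleR L2_strip_weight[OF \<beta>] test_functions_L2[OF \<phi>] strip_sets)
  have \<beta>\<phi>: "(\<lambda>x. \<beta> x *\<^sub>R \<phi> (x, s)) \<in> L2 UNIV"
    using borel_measurable_lebesgue_on[OF \<beta>(1), of UNIV] \<beta>(2)
    by (intro L2_mult_bounded L2_test_function_slice \<phi>) auto
  have eq: "ip ?S (\<lambda>z. (\<beta> (fst z) * ?w (snd z)) *\<^sub>R \<phi> z) (partial_deriv (0, 1) (\<Phi> n)) + ip ?S ?\<psi> (\<Phi> n)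
      = ip UNIV (\<lambda>x. \<beta> x *\<^sub>R \<phi> (x, s)) (\<lambda>x. \<Phi> n (x, s))" for n
  proof -
    let ?\<theta> = "\<Phi> n" and ?\<theta>y = "partial_deriv (0, 1) (\<Phi> n)"
    let ?g = "\<lambda>z. ?w (snd z) * (\<phi> z \<bullet> ?\<theta>y z + ?\<phi>y z \<bullet> ?\<theta> z) + (1 / \<epsilon>) * (\<phi> z \<bullet> ?\<theta> z)"
    let ?G = "\<lambda>z. ?w (snd z) * (\<phi> z \<bullet> ?\<theta> z)"
    have \<theta>L: "?\<theta> \<in> L2 ?S" "?\<theta>y \<in> L2 ?S"
      using test_functions_L2[OF \<Phi> strip_sets(1)] test_functions_L2[OF \<Phi>y strip_sets(1)] by auto
    obtain K where K: "compact K" "\<And>z. z \<notin> K \<Longrightarrow> ?\<theta> z = 0"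
      using test_functionsD[OF \<Phi>[of n]] by metis
    obtain L where L: "compact L" "\<And>z. z \<notin> L \<Longrightarrow> ?\<theta>y z = 0"
      using test_functionsD[OF \<Phi>y[of n]] by metis
    have FTC: "(LINT z|lebesgue_on ?S. \<beta> (fst z) * ?g z) = (LINT x|lborel. \<beta> x * (?G (x, \<epsilon>) - ?G (x, 0)))"
    proof (rule integral_strip_derivative(2)[OF \<epsilon> \<beta>])
      show "continuous_on UNIV ?g"
        using \<epsilon> by (intro continuous_intros test_functions_continuous[OF \<phi>] test_functions_continuous[OF \<phi>y]
            test_functions_continuous[OF \<Phi>] test_functions_continuous[OF \<Phi>y]) auto
      show "compact (K \<union> L)" using K L by auto
      show "?g z = 0" if "z \<notin> K \<union> L" for z using that K(2) L(2) by simp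
      fix x y :: real
      have v\<phi>: "((\<lambda>y. \<phi> (x, y)) has_vector_derivative ?\<phi>y (x, y)) (at y)"
        and v\<theta>: "((\<lambda>y. ?\<theta> (x, y)) has_vector_derivative ?\<theta>y (x, y)) (at y)"
        by (intro has_vector_derivative_slice test_functions_has_derivative[OF \<phi>]
              test_functions_has_derivative[OF \<Phi>])+
      have "((\<lambda>y. \<phi> (x, y) \<bullet> ?\<theta> (x, y)) has_vector_derivative
          (\<phi> (x, y) \<bullet> ?\<theta>y (x, y) + ?\<phi>y (x, y) \<bullet> ?\<theta> (x, y))) (at y)"
        by (rule bounded_bilinear.has_vector_derivative[OF bounded_bilinear_inner v\<phi> v\<theta>])
      moreover have "(?w has_vector_derivative 1 / \<epsilon>) (at y)"
        unfolding has_real_derivative_iff_has_vector_derivative[symmetric]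
        using \<epsilon> by (auto intro!: derivative_eq_intros)
      ultimately have "((\<lambda>y. ?w y * (\<phi> (x, y) \<bullet> ?\<theta> (x, y))) has_vector_derivative
          ?w y * (\<phi> (x, y) \<bullet> ?\<theta>y (x, y) + ?\<phi>y (x, y) \<bullet> ?\<theta> (x, y)) + (1 / \<epsilon>) * (\<phi> (x, y) \<bullet> ?\<theta> (x, y))) (at y)"
        by (intro has_vector_derivative_mult)
      then show "((\<lambda>y. ?G (x, y)) has_vector_derivative ?g (x, y)) (at y)" by simp
    qed
    have "ip ?S (\<lambda>z. (\<beta> (fst z) * ?w (snd z)) *\<^sub>R \<phi> z) ?\<theta>y + ip ?S ?\<psi> ?\<theta> =
        (LINT z|lebesgue_on ?S. ((\<beta> (fst z) * ?w (snd z)) *\<^sub>R \<phi> z) \<bullet> ?\<theta>y z + ?\<psi> z \<bullet> ?\<theta> z)"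
      unfolding ip_def
      by (rule Bochner_Integration.integral_add[symmetric]; intro integrable_inner_L2 w\<phi> \<psi> \<theta>L)
    also have "\<dots> = (LINT z|lebesgue_on ?S. \<beta> (fst z) * ?g z)"
      by (intro Bochner_Integration.integral_cong refl) (simp add: inner_add_left algebra_simps)
    also have "\<dots> = (LINT x|lborel. \<beta> x * (?G (x, \<epsilon>) - ?G (x, 0)))" by (rule FTC)
    \<comment> \<open>The weight takes the values 0 and 1 at \<open>y = 0\<close> and
      \<open>y = \<epsilon>\<close> if \<open>s = \<epsilon>\<close>, and the values -1 and 0 if
      \<open>s = 0\<close>. In both cases the difference is the value on the line
      \<open>y = s\<close> with a plus sign.\<close>
    also have "\<dots> = (LINT x|lborel. (\<beta> x *\<^sub>R \<phi> (x, s)) \<bullet> ?\<theta> (x, s))"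
      using s \<epsilon> by (intro Bochner_Integration.integral_cong refl) (auto simp: diff_divide_distrib)
    also have "\<dots> = ip UNIV (\<lambda>x. \<beta> x *\<^sub>R \<phi> (x, s)) (\<lambda>x. ?\<theta> (x, s))"
    proof -
      have c: "continuous_on UNIV (\<lambda>x. f (x, s))" if "f \<in> test_functions UNIV" for f :: "real \<times> real \<Rightarrow> complex"
        by (intro continuous_on_compose2[OF test_functions_continuous[OF that]]) (auto intro!: continuous_intros)
      have "(\<lambda>x. (\<beta> x *\<^sub>R \<phi> (x, s)) \<bullet> ?\<theta> (x, s)) \<in> borel_measurable borel"
        by (intro borel_measurable_inner borel_measurable_scaleR \<beta> borel_measurable_continuous_onI c \<phi> \<Phi>)
      then show ?thesis unfolding ip_def by (subst integral_lebesgue_on_borel) auto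
    qed
    finally show ?thesis .
  qed
  have "(\<lambda>n. ip ?S (\<lambda>z. (\<beta> (fst z) * ?w (snd z)) *\<^sub>R \<phi> z) (partial_deriv (0, 1) (\<Phi> n)) + ip ?S ?\<psi> (\<Phi> n))
      \<longlonglongrightarrow> ip ?S (\<lambda>z. (\<beta> (fst z) * ?w (snd z)) *\<^sub>R \<phi> z) (du (0, 1)) + ip ?S ?\<psi> u"
    by (intro tendsto_add ip_tendsto[OF _ _ L2_norm_const] w\<phi> \<psi> u lim limy e2
          test_functions_L2[OF \<Phi>] test_functions_L2[OF \<Phi>y] strip_sets conjunct1[OF du[OF e2]])
  moreover have "(\<lambda>n. ip UNIV (\<lambda>x. \<beta> x *\<^sub>R \<phi> (x, s)) (\<lambda>x. \<Phi> n (x, s))) \<longlonglongrightarrow> ip UNIV (\<lambda>x. \<beta> x *\<^sub>R \<phi> (x, s)) g"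
    by (intro ip_tendsto[OF _ _ L2_norm_const] \<beta>\<phi> g limg L2_test_function_slice \<Phi>)
  ultimately have "ip ?S (\<lambda>z. (\<beta> (fst z) * ?w (snd z)) *\<^sub>R \<phi> z) (du (0, 1)) + ip ?S ?\<psi> u
      = ip UNIV (\<lambda>x. \<beta> x *\<^sub>R \<phi> (x, s)) g"
    unfolding eq by (rule LIMSEQ_unique)
  moreover have "ip ?S (\<lambda>z. (\<beta> (fst z) * ?w (snd z)) *\<^sub>R \<phi> z) (du (0, 1)) =
      ip ?S (\<lambda>z. (\<beta> (fst z) * ?w (snd z)) *\<^sub>R \<phi> z) uy"
    unfolding ip_commute[of _ "\<lambda>z. (\<beta> (fst z) * ?w (snd z)) *\<^sub>R \<phi> z"]
    by (intro ip_cong_AE conjunct1[OF du[OF e2]] uy w\<phi> duy)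
  ultimately show ?thesis by simp
qed

text \<open>The traces on the two lines come with separate approximating sequences, so
  \<open>trace_identity\<close> is used once for each line and the results are subtracted. The two
  weights differ by exactly 1, and the terms with the factor \<open>1 / \<epsilon>\<close>
  cancel.\<close>

lemma boundary_identity:
  fixes u uy \<phi> :: "real \<times> real \<Rightarrow> complex"
  assumes \<epsilon>: "\<epsilon> > 0"
    and \<beta>: "\<beta> \<in> borel_measurable borel" "\<And>x. \<bar>\<beta> x\<bar> \<le> C"
    and tr: "has_trace \<epsilon> 0 u g0" "has_trace \<epsilon> \<epsilon> u g1" and \<phi>: "\<phi> \<in> test_functions UNIV"
    and uy: "uy \<in> L2 (strip \<epsilon>)" "has_weak_deriv (strip \<epsilon>) (0, 1) u uy"
  shows "ip (strip \<epsilon>) (\<lambda>z. \<beta> (fst z) *\<^sub>R \<phi> z) uy + ip (strip \<epsilon>) (\<lambda>z. \<beta> (fst z) *\<^sub>R partial_deriv (0, 1) \<phi> z) u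
       = ip UNIV (\<lambda>x. \<beta> x *\<^sub>R \<phi> (x, \<epsilon>)) g1 - ip UNIV (\<lambda>x. \<beta> x *\<^sub>R \<phi> (x, 0)) g0"
proof -
  let ?S = "strip \<epsilon>" and ?w = "\<lambda>s y. (y - (\<epsilon> - s)) / \<epsilon>" and ?\<phi>y = "partial_deriv (0, 1) \<phi>"
  note \<phi>y = test_functions_partial_deriv[OF \<phi> Basis_plane(2)]
  have wm: "(\<lambda>z. \<beta> (fst z) * ?w s (snd z)) \<in> borel_measurable (lebesgue_on ?S)" for s
    using \<epsilon> by (intro strip_weight_measurable \<beta>) (auto intro!: continuous_intros)
  have w: "(\<lambda>z. (\<beta> (fst z) * ?w s (snd z)) *\<^sub>R f z) \<in> L2 ?S"
    if "f \<in> test_functions UNIV" "s = 0 \<or> s = \<epsilon>" for f :: "real \<times> real \<Rightarrow> complex" and s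
    by (rule L2_mult_bounded[OF test_functions_L2[OF that(1) strip_sets(1)] wm strip_sets(1)],
        erule trace_weight_bound[OF \<epsilon> that(2) _ \<beta>(2)])
  have \<beta>\<phi>: "(\<lambda>z. (1 / \<epsilon>) *\<^sub>R (\<beta> (fst z) *\<^sub>R \<phi> z)) \<in> L2 ?S"
    by (intro L2_scaleR L2_strip_weight[OF \<beta>] test_functions_L2[OF \<phi>] strip_sets)
  have u: "u \<in> L2 ?S" using tr(1) by (simp add: has_trace_def)
  have diff: "a *\<^sub>R v - b *\<^sub>R v = (a - b) *\<^sub>R v" for a b and v :: complex
    by (simp add: scaleR_diff_left)
  have w1: "\<beta> x * ((y - (\<epsilon> - \<epsilon>)) / \<epsilon>) - \<beta> x * ((y - (\<epsilon> - 0)) / \<epsilon>) = \<beta> x" for x y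
    using \<epsilon> by (simp add: field_simps)
  have "ip ?S (\<lambda>z. \<beta> (fst z) *\<^sub>R \<phi> z) uy =
      ip ?S (\<lambda>z. (\<beta> (fst z) * ?w \<epsilon> (snd z)) *\<^sub>R \<phi> z) uy - ip ?S (\<lambda>z. (\<beta> (fst z) * ?w 0 (snd z)) *\<^sub>R \<phi> z) uy"
    by (subst ip_diff_left[symmetric]) (use w \<phi> uy in \<open>auto simp only: diff w1\<close>)
  moreover have "ip ?S (\<lambda>z. \<beta> (fst z) *\<^sub>R ?\<phi>y z) u =
      ip ?S (\<lambda>z. (\<beta> (fst z) * ?w \<epsilon> (snd z)) *\<^sub>R ?\<phi>y z + (1 / \<epsilon>) *\<^sub>R (\<beta> (fst z) *\<^sub>R \<phi> z)) u
      - ip ?S (\<lambda>z. (\<beta> (fst z) * ?w 0 (snd z)) *\<^sub>R ?\<phi>y z + (1 / \<epsilon>) *\<^sub>R (\<beta> (fst z) *\<^sub>R \<phi> z)) u"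
  proof -
    let ?A = "\<lambda>s z. (\<beta> (fst z) * ?w s (snd z)) *\<^sub>R ?\<phi>y z + (1 / \<epsilon>) *\<^sub>R (\<beta> (fst z) *\<^sub>R \<phi> z)"
    have A: "?A \<epsilon> \<in> L2 ?S" "?A 0 \<in> L2 ?S"
      by (rule L2_add[OF w[OF \<phi>y] \<beta>\<phi>]; simp)+
    have "(\<lambda>z. \<beta> (fst z) *\<^sub>R ?\<phi>y z) = (\<lambda>z. ?A \<epsilon> z - ?A 0 z)"
      by (rule ext) (simp only: add_diff_cancel_right diff w1)
    then show ?thesis using ip_diff_left[OF A u] by simp
  qed
  ultimately show ?thesis
    using trace_identity[OF \<epsilon> _ \<beta> tr(1) \<phi> uy] trace_identity[OF \<epsilon> _ \<beta> tr(2) \<phi> uy] by simp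
qed

text \<open>The part of \<open>has_trace\<close> on which the variational argument relies:
  approximation in H^1 of the strip by functions smooth across the boundary, with \<open>p\<close>
  and \<open>q\<close> standing for the derivatives of \<open>u\<close> in \<open>x\<close> and
  \<open>y\<close>.\<close>

definition H1_limit :: "real \<Rightarrow> (real \<times> real \<Rightarrow> complex) \<Rightarrow> (real \<times> real \<Rightarrow> complex) \<Rightarrow> (real \<times> real \<Rightarrow> complex)
    \<Rightarrow> (nat \<Rightarrow> real \<times> real \<Rightarrow> complex) \<Rightarrow> bool" where
  "H1_limit \<epsilon> u p q \<Phi> \<longleftrightarrow> u \<in> L2 (strip \<epsilon>) \<and> p \<in> L2 (strip \<epsilon>) \<and> q \<in> L2 (strip \<epsilon>) \<and>
    (\<forall>n. \<Phi> n \<in> test_functions UNIV) \<and>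
    (\<lambda>n. L2_norm (strip \<epsilon>) (\<lambda>z. \<Phi> n z - u z)) \<longlonglongrightarrow> 0 \<and>
    (\<lambda>n. L2_norm (strip \<epsilon>) (\<lambda>z. partial_deriv (1, 0) (\<Phi> n) z - p z)) \<longlonglongrightarrow> 0 \<and>
    (\<lambda>n. L2_norm (strip \<epsilon>) (\<lambda>z. partial_deriv (0, 1) (\<Phi> n) z - q z)) \<longlonglongrightarrow> 0"

text \<open>Integrating by parts in \<open>y\<close> leaves the traces of the
  \<open>y\<close>-derivative of \<psi>. The Robin condition replaces them by
  \<open>- \<alpha>\<close> times the traces of \<psi>, and \<open>boundary_identity\<close> with
  weight \<alpha> turns these back into integrals over the strip, so the final formula contains no
  trace.\<close>

lemma robin_laplacian_green:
  assumes \<epsilon>: "\<epsilon> > 0"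
    and \<alpha>: "\<alpha> \<in> borel_measurable borel" "\<And>x. \<bar>\<alpha> x\<bar> \<le> C"
    and T: "(\<psi>, f) \<in> robin_laplacian \<epsilon> \<alpha>"
  obtains p q \<Phi> where "H1_limit \<epsilon> \<psi> p q \<Phi>"
    "\<forall>\<phi>\<in>test_functions UNIV. ip (strip \<epsilon>) \<phi> f =
       ip (strip \<epsilon>) (partial_deriv (1, 0) \<phi>) p + ip (strip \<epsilon>) (partial_deriv (0, 1) \<phi>) q
       + ip (strip \<epsilon>) (\<lambda>z. \<alpha> (fst z) *\<^sub>R \<phi> z) q + ip (strip \<epsilon>) (\<lambda>z. \<alpha> (fst z) *\<^sub>R partial_deriv (0, 1) \<phi> z) \<psi>"
proof -
  let ?S = "strip \<epsilon>"
  note e1 = Basis_plane(1) and e2 = Basis_plane(2)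
  note uniq = has_weak_deriv_unique[OF open_strip]
  have sob: "\<psi> \<in> sobolev ?S (L2 ?S) (Suc (Suc 0))" and rc: "robin_condition \<epsilon> \<alpha> \<psi>" and f: "f \<in> L2 ?S"
    and lap: "has_weak_laplacian ?S \<psi> (\<lambda>z. - f z)"
    using T by (auto simp: robin_laplacian_def numeral_2_eq_2)
  obtain \<psi>y g0 h0 g1 h1 where \<psi>y: "has_weak_deriv ?S (0, 1) \<psi> \<psi>y"
    and tr: "has_trace \<epsilon> 0 \<psi> g0" "has_trace \<epsilon> 0 \<psi>y h0" "has_trace \<epsilon> \<epsilon> \<psi> g1" "has_trace \<epsilon> \<epsilon> \<psi>y h1"
    and bc: "AE x in lebesgue. - h0 x - complex_of_real (\<alpha> x) * g0 x = 0 \<and> h1 x + complex_of_real (\<alpha> x) * g1 x = 0"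
    using rc unfolding robin_condition_def by blast
  have \<psi>: "\<psi> \<in> L2 ?S" and \<psi>yL: "\<psi>y \<in> L2 ?S" and gL: "g0 \<in> L2 UNIV" "g1 \<in> L2 UNIV" "h0 \<in> L2 UNIV" "h1 \<in> L2 UNIV"
    using tr by (auto simp: has_trace_def)
  obtain du \<Phi> where
        du: "\<And>b. b \<in> Basis \<Longrightarrow> du b \<in> L2 ?S \<and> has_weak_deriv ?S b \<psi> (du b)"
    and \<Phi>: "\<And>n::nat. \<Phi> n \<in> test_functions UNIV"
    and lim: "(\<lambda>n. L2_norm ?S (\<lambda>z. \<Phi> n z - \<psi> z)) \<longlonglongrightarrow> 0"
    and limd: "\<And>b. b \<in> Basis \<Longrightarrow> (\<lambda>n. L2_norm ?S (\<lambda>z. partial_deriv b (\<Phi> n) z - du b z)) \<longlonglongrightarrow> 0"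
    using tr(1) unfolding has_trace_def by blast
  obtain d1 d2 where d: "\<And>b. b \<in> Basis \<Longrightarrow> has_weak_deriv ?S b \<psi> (d1 b) \<and> has_weak_deriv ?S b (d1 b) (d2 b)"
    and fd: "AE z in lebesgue_on ?S. - f z = (\<Sum>b\<in>Basis. d2 b z)"
    using lap unfolding has_weak_laplacian_def by blast
  \<comment> \<open>The second derivatives \<open>d2\<close> in the weak Laplacian carry no
    \<open>L2\<close> bound of their own. It is inherited from the representatives \<open>v\<close>
    and \<open>w\<close> given by the Sobolev space.\<close>
  have ex: "\<exists>v w. v \<in> L2 ?S \<and> w \<in> L2 ?S \<and> has_weak_deriv ?S b v w \<and>
      (AE z in lebesgue_on ?S. v z = du b z) \<and> (AE z in lebesgue_on ?S. w z = d2 b z)" if b: "b \<in> Basis" for b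
  proof -
    obtain v where v: "v \<in> sobolev ?S (L2 ?S) (Suc 0)" "has_weak_deriv ?S b \<psi> v"
      using sob b by auto
    obtain w where w: "w \<in> L2 ?S" "has_weak_deriv ?S b v w"
      using v(1) b by auto
    have "AE z in lebesgue_on ?S. v z = du b z"
      by (rule uniq[OF b v(2) conjunct2[OF du[OF b]]]) simp
    moreover have "AE z in lebesgue_on ?S. v z = d1 b z"
      by (rule uniq[OF b v(2) conjunct1[OF d[OF b]]]) simp
    ultimately show ?thesis
      using v w uniq[OF b w(2) conjunct2[OF d[OF b]]] by auto
  qed
  obtain v1 w1 where vw1: "v1 \<in> L2 ?S" "w1 \<in> L2 ?S" "has_weak_deriv ?S (1, 0) v1 w1"
      "AE z in lebesgue_on ?S. v1 z = du (1, 0) z" "AE z in lebesgue_on ?S. w1 z = d2 (1, 0) z"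
    using ex[OF e1] by blast
  obtain v2 w2 where vw2: "has_weak_deriv ?S (0, 1) v2 w2"
      "AE z in lebesgue_on ?S. v2 z = du (0, 1) z" "AE z in lebesgue_on ?S. w2 z = d2 (0, 1) z"
    using ex[OF e2] by blast
  have AE\<psi>y: "AE z in lebesgue_on ?S. \<psi>y z = du (0, 1) z"
    by (rule uniq[OF e2 \<psi>y conjunct2[OF du[OF e2]]]) simp
  have AE\<psi>v: "AE z in lebesgue_on ?S. \<psi>y z = v2 z"
    using vw2(2) AE\<psi>y by eventually_elim simp
  \<comment> \<open>\<open>boundary_identity\<close> will be applied to \<open>\<psi>y\<close>
    itself, whose traces are \<open>h0\<close> and \<open>h1\<close>; hence its weak derivative is
    taken from there and then compared with \<open>w2\<close>.\<close>
  obtain dy where dy: "dy \<in> L2 ?S" "has_weak_deriv ?S (0, 1) \<psi>y dy"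
    using tr(2) e2 unfolding has_trace_def by blast
  have AEdy: "AE z in lebesgue_on ?S. dy z = w2 z"
    by (rule uniq[OF e2 dy(2) vw2(1) AE\<psi>v])
  have AEf: "AE z in lebesgue_on ?S. f z = (- 1) *\<^sub>R (w1 z + dy z)"
    using fd AEdy vw1(5) vw2(3)
    by eventually_elim (simp add: Basis_plane(3) minus_equation_iff[of "f _"])
  show ?thesis
  proof (rule that)
    have "L2_norm ?S (\<lambda>z. partial_deriv (0, 1) (\<Phi> n) z - \<psi>y z) =
        L2_norm ?S (\<lambda>z. partial_deriv (0, 1) (\<Phi> n) z - du (0, 1) z)" for n
    proof -
      have m: "partial_deriv (0, 1) (\<Phi> n) \<in> borel_measurable (lebesgue_on ?S)"
        "\<psi>y \<in> borel_measurable (lebesgue_on ?S)" "du (0, 1) \<in> borel_measurable (lebesgue_on ?S)"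
        using test_functions_L2[OF test_functions_partial_deriv[OF \<Phi> e2] strip_sets(1)] \<psi>yL du[OF e2]
        by (auto simp: L2_def)
      show ?thesis unfolding L2_norm_def using m AE\<psi>y
        by (intro arg_cong[of _ _ sqrt] integral_cong_AE) (auto elim!: eventually_mono)
    qed
    then show "H1_limit \<epsilon> \<psi> (du (1, 0)) \<psi>y \<Phi>"
      unfolding H1_limit_def using \<psi> du[OF e1] \<psi>yL \<Phi> lim limd[OF e1] limd[OF e2] by simp
    show "\<forall>\<phi>\<in>test_functions UNIV. ip ?S \<phi> f = ip ?S (partial_deriv (1, 0) \<phi>) (du (1, 0)) + ip ?S (partial_deriv (0, 1) \<phi>) \<psi>y
       + ip ?S (\<lambda>z. \<alpha> (fst z) *\<^sub>R \<phi> z) \<psi>y + ip ?S (\<lambda>z. \<alpha> (fst z) *\<^sub>R partial_deriv (0, 1) \<phi> z) \<psi>"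
    proof
    fix \<phi> :: "real \<times> real \<Rightarrow> complex" assume \<phi>: "\<phi> \<in> test_functions UNIV"
    note \<phi>x = test_functions_partial_deriv[OF \<phi> e1]
    note \<phi>L = test_functions_L2[OF \<phi> strip_sets(1)]
    have "ip ?S \<phi> f = ip ?S (\<lambda>z. (- 1) *\<^sub>R (w1 z + dy z)) \<phi>"
      unfolding ip_commute[of ?S \<phi>] by (intro ip_cong_AE AEf \<phi>L f L2_scaleR L2_add vw1 dy)
    also have "\<dots> = - ip ?S \<phi> w1 - ip ?S \<phi> dy"
      unfolding ip_scaleR_left ip_add_left[OF vw1(2) dy(1) \<phi>L] by (simp add: ip_commute)
    also have "ip ?S \<phi> w1 = - ip ?S (partial_deriv (1, 0) \<phi>) v1"
      by (rule ip_weak_deriv_tangential[OF vw1(1-3) \<phi>])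
    also have "ip ?S (partial_deriv (1, 0) \<phi>) v1 = ip ?S (partial_deriv (1, 0) \<phi>) (du (1, 0))"
      unfolding ip_commute[of ?S "partial_deriv (1, 0) \<phi>"]
      using du[OF e1] by (intro ip_cong_AE vw1 test_functions_L2[OF \<phi>x strip_sets(1)]) auto
    finally have 1: "ip ?S \<phi> f = ip ?S (partial_deriv (1, 0) \<phi>) (du (1, 0)) - ip ?S \<phi> dy" by simp
    have 2: "ip ?S \<phi> dy + ip ?S (partial_deriv (0, 1) \<phi>) \<psi>y = ip UNIV (\<lambda>x. \<phi> (x, \<epsilon>)) h1 - ip UNIV (\<lambda>x. \<phi> (x, 0)) h0"
      using boundary_identity[OF \<epsilon>, of "\<lambda>_. 1" 1, OF _ _ tr(2,4) \<phi> dy] by simp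
    have 3: "ip ?S (\<lambda>z. \<alpha> (fst z) *\<^sub>R \<phi> z) \<psi>y + ip ?S (\<lambda>z. \<alpha> (fst z) *\<^sub>R partial_deriv (0, 1) \<phi> z) \<psi>
        = ip UNIV (\<lambda>x. \<alpha> x *\<^sub>R \<phi> (x, \<epsilon>)) g1 - ip UNIV (\<lambda>x. \<alpha> x *\<^sub>R \<phi> (x, 0)) g0"
      by (rule boundary_identity[OF \<epsilon> \<alpha> tr(1,3) \<phi> \<psi>yL \<psi>y])
    \<comment> \<open>Both boundary conditions read \<open>h = - \<alpha> g\<close>. The sign due to
      the opposite outer normals sits in the difference between the two lines, so one statement
      serves both.\<close>
    have bcs: "ip UNIV (\<lambda>x. \<phi> (x, s)) h = - ip UNIV (\<lambda>x. \<alpha> x *\<^sub>R \<phi> (x, s)) g"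
      if AE: "AE x in lebesgue. h x = - (complex_of_real (\<alpha> x) * g x)" and L: "g \<in> L2 UNIV" "h \<in> L2 UNIV" for s g h
    proof -
      have \<alpha>\<phi>: "(\<lambda>x. \<alpha> x *\<^sub>R \<phi> (x, s)) \<in> L2 UNIV"
        using borel_measurable_lebesgue_on[OF \<alpha>(1), of UNIV] \<alpha>(2)
        by (intro L2_mult_bounded L2_test_function_slice \<phi>) auto
      have "ip UNIV (\<lambda>x. \<phi> (x, s)) h = (LINT x|lebesgue_on UNIV. - ((\<alpha> x *\<^sub>R \<phi> (x, s)) \<bullet> g x))"
        unfolding ip_def
      proof (rule integral_cong_AE)
        show "(\<lambda>x. \<phi> (x, s) \<bullet> h x) \<in> borel_measurable (lebesgue_on UNIV)"
          by (intro borel_measurable_integrable integrable_inner_L2 L2_test_function_slice \<phi> L)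
        show "(\<lambda>x. - ((\<alpha> x *\<^sub>R \<phi> (x, s)) \<bullet> g x)) \<in> borel_measurable (lebesgue_on UNIV)"
          by (intro borel_measurable_uminus borel_measurable_integrable integrable_inner_L2 \<alpha>\<phi> L)
        show "AE x in lebesgue_on UNIV. \<phi> (x, s) \<bullet> h x = - ((\<alpha> x *\<^sub>R \<phi> (x, s)) \<bullet> g x)"
          using AE unfolding lebesgue_on_UNIV_eq
          by eventually_elim (simp add: scaleR_conv_of_real[symmetric])
      qed
      then show ?thesis by (simp add: ip_def)
    qed
    have "ip UNIV (\<lambda>x. \<phi> (x, \<epsilon>)) h1 = - ip UNIV (\<lambda>x. \<alpha> x *\<^sub>R \<phi> (x, \<epsilon>)) g1"
      by (intro bcs gL eventually_mono[OF bc]) (metis eq_neg_iff_add_eq_0)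
    moreover have "ip UNIV (\<lambda>x. \<phi> (x, 0)) h0 = - ip UNIV (\<lambda>x. \<alpha> x *\<^sub>R \<phi> (x, 0)) g0"
      by (intro bcs gL eventually_mono[OF bc]) (metis eq_iff_diff_eq_0 minus_equation_iff)
    ultimately show "ip ?S \<phi> f = ip ?S (partial_deriv (1, 0) \<phi>) (du (1, 0)) + ip ?S (partial_deriv (0, 1) \<phi>) \<psi>y
       + ip ?S (\<lambda>z. \<alpha> (fst z) *\<^sub>R \<phi> z) \<psi>y + ip ?S (\<lambda>z. \<alpha> (fst z) *\<^sub>R partial_deriv (0, 1) \<phi> z) \<psi>"
      using 1 2 3 by simp
    qed
  qed
qed

subsection \<open>The variational argument\<close>

text \<open>The form of \<open>T - m\<close>, in terms of functions \<open>v\<close>, \<open>v'\<close> and their partial derivatives \<open>p\<close>, \<open>p'\<close> in \<open>x\<close>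
  and \<open>q\<close>, \<open>q'\<close> in \<open>y\<close>, with the boundary term written as an integral over the strip. Only real parts
  matter: \<open>\<bullet>\<close> is the real inner product on the complex numbers.\<close>

definition robin_form ::
  "real \<Rightarrow> (real \<Rightarrow> real) \<Rightarrow> real \<Rightarrow> (real \<times> real \<Rightarrow> complex) \<Rightarrow> (real \<times> real \<Rightarrow> complex) \<Rightarrow> (real \<times> real \<Rightarrow> complex)
    \<Rightarrow> (real \<times> real \<Rightarrow> complex) \<Rightarrow> (real \<times> real \<Rightarrow> complex) \<Rightarrow> (real \<times> real \<Rightarrow> complex) \<Rightarrow> real" where
  "robin_form \<epsilon> \<alpha> m v p q v' p' q' = (LINT z|lebesgue_on (strip \<epsilon>).
     p z \<bullet> p' z + q z \<bullet> q' z + \<alpha> (fst z) * (v z \<bullet> q' z + q z \<bullet> v' z) - m * (v z \<bullet> v' z))"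

abbreviation robin_form_smooth ::
  "real \<Rightarrow> (real \<Rightarrow> real) \<Rightarrow> real \<Rightarrow> (real \<times> real \<Rightarrow> complex) \<Rightarrow> real" where
  "robin_form_smooth \<epsilon> \<alpha> m v \<equiv>
     robin_form \<epsilon> \<alpha> m v (partial_deriv (1, 0) v) (partial_deriv (0, 1) v) v (partial_deriv (1, 0) v) (partial_deriv (0, 1) v)"

context
  fixes \<epsilon> C :: real and \<alpha> :: "real \<Rightarrow> real"
  assumes \<epsilon>: "\<epsilon> > 0" and \<alpha>: "\<alpha> \<in> borel_measurable borel" "\<And>x. \<bar>\<alpha> x\<bar> \<le> C"
begin

section \<open>Bilinearity, continuity and lower bound of the form\<close>

lemma robin_form_integrable:
  assumes "v \<in> L2 (strip \<epsilon>)" "p \<in> L2 (strip \<epsilon>)" "q \<in> L2 (strip \<epsilon>)"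
    "v' \<in> L2 (strip \<epsilon>)" "p' \<in> L2 (strip \<epsilon>)" "q' \<in> L2 (strip \<epsilon>)"
  shows "integrable (lebesgue_on (strip \<epsilon>)) (\<lambda>z.
     p z \<bullet> p' z + q z \<bullet> q' z + \<alpha> (fst z) * (v z \<bullet> q' z + q z \<bullet> v' z) - m * (v z \<bullet> v' z))"
    and "robin_form \<epsilon> \<alpha> m v p q v' p' q' = ip (strip \<epsilon>) p p' + ip (strip \<epsilon>) q q'
     + ip (strip \<epsilon>) (\<lambda>z. \<alpha> (fst z) *\<^sub>R v z) q' + ip (strip \<epsilon>) (\<lambda>z. \<alpha> (fst z) *\<^sub>R q z) v' - m * ip (strip \<epsilon>) v v'"
proof -
  have i: "integrable (lebesgue_on (strip \<epsilon>)) (\<lambda>z. p z \<bullet> p' z)"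
    "integrable (lebesgue_on (strip \<epsilon>)) (\<lambda>z. q z \<bullet> q' z)"
    "integrable (lebesgue_on (strip \<epsilon>)) (\<lambda>z. (\<alpha> (fst z) *\<^sub>R v z) \<bullet> q' z)"
    "integrable (lebesgue_on (strip \<epsilon>)) (\<lambda>z. (\<alpha> (fst z) *\<^sub>R q z) \<bullet> v' z)"
    "integrable (lebesgue_on (strip \<epsilon>)) (\<lambda>z. v z \<bullet> v' z)"
    by (intro integrable_inner_L2 L2_strip_weight[OF \<alpha>] assms)+
  have eq: "(\<lambda>z. p z \<bullet> p' z + q z \<bullet> q' z + \<alpha> (fst z) * (v z \<bullet> q' z + q z \<bullet> v' z) - m * (v z \<bullet> v' z)) =
    (\<lambda>z. p z \<bullet> p' z + q z \<bullet> q' z + (\<alpha> (fst z) *\<^sub>R v z) \<bullet> q' z + (\<alpha> (fst z) *\<^sub>R q z) \<bullet> v' z - m * (v z \<bullet> v' z))"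
    by (rule ext) (simp add: algebra_simps)
  show "integrable (lebesgue_on (strip \<epsilon>)) (\<lambda>z.
     p z \<bullet> p' z + q z \<bullet> q' z + \<alpha> (fst z) * (v z \<bullet> q' z + q z \<bullet> v' z) - m * (v z \<bullet> v' z))"
    unfolding eq by (intro Bochner_Integration.integrable_add Bochner_Integration.integrable_diff integrable_mult_right i)
  show "robin_form \<epsilon> \<alpha> m v p q v' p' q' = ip (strip \<epsilon>) p p' + ip (strip \<epsilon>) q q'
     + ip (strip \<epsilon>) (\<lambda>z. \<alpha> (fst z) *\<^sub>R v z) q' + ip (strip \<epsilon>) (\<lambda>z. \<alpha> (fst z) *\<^sub>R q z) v' - m * ip (strip \<epsilon>) v v'"
    unfolding robin_form_def eq ip_def using i by simp
qed

lemma robin_form_expand: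
  assumes "v \<in> L2 (strip \<epsilon>)" "p \<in> L2 (strip \<epsilon>)" "q \<in> L2 (strip \<epsilon>)"
    "v' \<in> L2 (strip \<epsilon>)" "p' \<in> L2 (strip \<epsilon>)" "q' \<in> L2 (strip \<epsilon>)"
  shows "robin_form \<epsilon> \<alpha> m (\<lambda>z. v z + t *\<^sub>R v' z) (\<lambda>z. p z + t *\<^sub>R p' z) (\<lambda>z. q z + t *\<^sub>R q' z)
      (\<lambda>z. v z + t *\<^sub>R v' z) (\<lambda>z. p z + t *\<^sub>R p' z) (\<lambda>z. q z + t *\<^sub>R q' z)
    = robin_form \<epsilon> \<alpha> m v p q v p q + 2 * robin_form \<epsilon> \<alpha> m v p q v' p' q' * t
      + robin_form \<epsilon> \<alpha> m v' p' q' v' p' q' * t\<^sup>2"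
proof -
  note i = robin_form_integrable(1)[of _ _ _ _ _ _ m]
  let ?e = "\<lambda>v p q v' p' q' z. p z \<bullet> p' z + q z \<bullet> q' z + \<alpha> (fst z) * (v z \<bullet> q' z + q z \<bullet> v' z) - m * (v z \<bullet> v' z)"
  have "robin_form \<epsilon> \<alpha> m (\<lambda>z. v z + t *\<^sub>R v' z) (\<lambda>z. p z + t *\<^sub>R p' z) (\<lambda>z. q z + t *\<^sub>R q' z)
      (\<lambda>z. v z + t *\<^sub>R v' z) (\<lambda>z. p z + t *\<^sub>R p' z) (\<lambda>z. q z + t *\<^sub>R q' z)
    = (LINT z|lebesgue_on (strip \<epsilon>). ?e v p q v p q z + 2 * ?e v p q v' p' q' z * t + ?e v' p' q' v' p' q' z * t\<^sup>2)"
    unfolding robin_form_def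
  proof (intro Bochner_Integration.integral_cong refl)
    fix z :: "real \<times> real"
    have c: "v' z \<bullet> v z = v z \<bullet> v' z" "p' z \<bullet> p z = p z \<bullet> p' z" "q' z \<bullet> q z = q z \<bullet> q' z"
      "v' z \<bullet> q z = q z \<bullet> v' z" "q' z \<bullet> v z = v z \<bullet> q' z" "q z \<bullet> v z = v z \<bullet> q z" "q' z \<bullet> v' z = v' z \<bullet> q' z"
      by (rule inner_commute)+
    show "?e (\<lambda>z. v z + t *\<^sub>R v' z) (\<lambda>z. p z + t *\<^sub>R p' z) (\<lambda>z. q z + t *\<^sub>R q' z)
      (\<lambda>z. v z + t *\<^sub>R v' z) (\<lambda>z. p z + t *\<^sub>R p' z) (\<lambda>z. q z + t *\<^sub>R q' z) z =
      ?e v p q v p q z + 2 * ?e v p q v' p' q' z * t + ?e v' p' q' v' p' q' z * t\<^sup>2"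
      unfolding inner_add_left inner_add_right inner_scaleR_left inner_scaleR_right c by algebra
  qed
  also have "\<dots> = robin_form \<epsilon> \<alpha> m v p q v p q + 2 * robin_form \<epsilon> \<alpha> m v p q v' p' q' * t
      + robin_form \<epsilon> \<alpha> m v' p' q' v' p' q' * t\<^sup>2"
  proof -
    note I = i[OF assms(1-3) assms(1-3)] i[OF assms] i[OF assms(4-6) assms(4-6)]
    have J2: "integrable (lebesgue_on (strip \<epsilon>)) (\<lambda>z. 2 * ?e v p q v' p' q' z * t)"
      by (intro integrable_mult_left integrable_mult_right I)
    have J3: "integrable (lebesgue_on (strip \<epsilon>)) (\<lambda>z. ?e v' p' q' v' p' q' z * t\<^sup>2)"
      by (intro integrable_mult_left I)
    show ?thesis
      unfolding robin_form_def Bochner_Integration.integral_add[OF Bochner_Integration.integrable_add[OF I(1) J2] J3]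
        Bochner_Integration.integral_add[OF I(1) J2] integral_mult_left_zero integral_mult_right_zero ..
  qed
  finally show ?thesis .
qed

lemma robin_form_tendsto:
  assumes "v \<in> L2 (strip \<epsilon>)" "\<And>n::nat. V n \<in> L2 (strip \<epsilon>)" "(\<lambda>n. L2_norm (strip \<epsilon>) (\<lambda>z. V n z - v z)) \<longlonglongrightarrow> 0"
    and "p \<in> L2 (strip \<epsilon>)" "\<And>n::nat. P n \<in> L2 (strip \<epsilon>)" "(\<lambda>n. L2_norm (strip \<epsilon>) (\<lambda>z. P n z - p z)) \<longlonglongrightarrow> 0"
    and "q \<in> L2 (strip \<epsilon>)" "\<And>n::nat. Q n \<in> L2 (strip \<epsilon>)" "(\<lambda>n. L2_norm (strip \<epsilon>) (\<lambda>z. Q n z - q z)) \<longlonglongrightarrow> 0"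
    and "v' \<in> L2 (strip \<epsilon>)" "\<And>n::nat. V' n \<in> L2 (strip \<epsilon>)" "(\<lambda>n. L2_norm (strip \<epsilon>) (\<lambda>z. V' n z - v' z)) \<longlonglongrightarrow> 0"
    and "p' \<in> L2 (strip \<epsilon>)" "\<And>n::nat. P' n \<in> L2 (strip \<epsilon>)" "(\<lambda>n. L2_norm (strip \<epsilon>) (\<lambda>z. P' n z - p' z)) \<longlonglongrightarrow> 0"
    and "q' \<in> L2 (strip \<epsilon>)" "\<And>n::nat. Q' n \<in> L2 (strip \<epsilon>)" "(\<lambda>n. L2_norm (strip \<epsilon>) (\<lambda>z. Q' n z - q' z)) \<longlonglongrightarrow> 0"
  shows "(\<lambda>n. robin_form \<epsilon> \<alpha> m (V n) (P n) (Q n) (V' n) (P' n) (Q' n)) \<longlonglongrightarrow> robin_form \<epsilon> \<alpha> m v p q v' p' q'"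
proof -
  have w: "(\<lambda>n. ip (strip \<epsilon>) (\<lambda>z. \<alpha> (fst z) *\<^sub>R F n z) (G n)) \<longlonglongrightarrow> ip (strip \<epsilon>) (\<lambda>z. \<alpha> (fst z) *\<^sub>R f z) g"
    if F: "f \<in> L2 (strip \<epsilon>)" "\<And>n::nat. F n \<in> L2 (strip \<epsilon>)" "(\<lambda>n. L2_norm (strip \<epsilon>) (\<lambda>z. F n z - f z)) \<longlonglongrightarrow> 0"
      and G: "g \<in> L2 (strip \<epsilon>)" "\<And>n::nat. G n \<in> L2 (strip \<epsilon>)" "(\<lambda>n. L2_norm (strip \<epsilon>) (\<lambda>z. G n z - g z)) \<longlonglongrightarrow> 0"
    for F G :: "nat \<Rightarrow> real \<times> real \<Rightarrow> complex" and f g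
  proof -
    have "(\<lambda>n. L2_norm (strip \<epsilon>) (\<lambda>z. \<alpha> (fst z) *\<^sub>R F n z - \<alpha> (fst z) *\<^sub>R f z)) \<longlonglongrightarrow> 0"
    proof (rule Lim_null_comparison)
      have "L2_norm (strip \<epsilon>) (\<lambda>z. \<alpha> (fst z) *\<^sub>R (F n z - f z)) \<le> \<bar>C\<bar> * L2_norm (strip \<epsilon>) (\<lambda>z. F n z - f z)" for n
        using strip_weight_measurable[OF \<alpha>(1), of "\<lambda>_. 1"]
        by (intro L2_norm_mult_bounded_le L2_diff F strip_sets \<alpha>(2)) auto
      then show "\<forall>\<^sub>F n in sequentially. norm (L2_norm (strip \<epsilon>) (\<lambda>z. \<alpha> (fst z) *\<^sub>R F n z - \<alpha> (fst z) *\<^sub>R f z))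
          \<le> \<bar>C\<bar> * L2_norm (strip \<epsilon>) (\<lambda>z. F n z - f z)"
        by (simp add: scaleR_diff_right L2_norm_nonneg)
      show "(\<lambda>n. \<bar>C\<bar> * L2_norm (strip \<epsilon>) (\<lambda>z. F n z - f z)) \<longlonglongrightarrow> 0"
        by (rule tendsto_mult_right_zero[OF F(3)])
    qed
    then show ?thesis
      by (intro ip_tendsto L2_strip_weight[OF \<alpha>] F G)
  qed
  show ?thesis
    unfolding robin_form_integrable(2)[OF assms(2,5,8,11,14,17)] robin_form_integrable(2)[OF assms(1,4,7,10,13,16)]
    by (intro tendsto_add tendsto_diff tendsto_mult tendsto_const ip_tendsto w assms)
qed

text \<open>Completing the square pointwise: the square of \<open>q + \<alpha> v\<close>, with
  \<open>q\<close> the \<open>y\<close>-derivative of \<open>v\<close>, absorbs the boundary term at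
  the price of \<open>\<alpha>\<^sup>2\<close> times the square of \<open>v\<close>. The bound does
  not depend on the width of the strip.\<close>

lemma robin_form_lower_bound:
  assumes v: "v \<in> test_functions UNIV"
  shows "robin_form_smooth \<epsilon> \<alpha> 0 v \<ge> - C\<^sup>2 * ip (strip \<epsilon>) v v"
proof -
  let ?p = "partial_deriv (1, 0) v" and ?q = "partial_deriv (0, 1) v"
  have L: "v \<in> L2 (strip \<epsilon>)" "?p \<in> L2 (strip \<epsilon>)" "?q \<in> L2 (strip \<epsilon>)"
    by (intro test_functions_L2[OF v] test_functions_L2[OF test_functions_partial_deriv[OF v Basis_plane(1)]]
          test_functions_L2[OF test_functions_partial_deriv[OF v Basis_plane(2)]] strip_sets)+
  have "(LINT z|lebesgue_on (strip \<epsilon>). - C\<^sup>2 * (v z \<bullet> v z)) \<le> robin_form_smooth \<epsilon> \<alpha> 0 v"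
    unfolding robin_form_def
  proof (rule integral_mono)
    fix z :: "real \<times> real"
    let ?a = "\<alpha> (fst z)"
    have "0 \<le> (?q z + ?a *\<^sub>R v z) \<bullet> (?q z + ?a *\<^sub>R v z)" by (rule inner_ge_zero)
    also have "\<dots> = ?q z \<bullet> ?q z + ?a * (v z \<bullet> ?q z + ?q z \<bullet> v z) + ?a\<^sup>2 * (v z \<bullet> v z)"
      unfolding inner_add_left inner_add_right inner_scaleR_left inner_scaleR_right by algebra
    finally have 1: "0 \<le> ?q z \<bullet> ?q z + ?a * (v z \<bullet> ?q z + ?q z \<bullet> v z) + ?a\<^sup>2 * (v z \<bullet> v z)" .
    have "?a\<^sup>2 * (v z \<bullet> v z) \<le> C\<^sup>2 * (v z \<bullet> v z)"
      using power_mono[OF \<alpha>(2)[of "fst z"] abs_ge_zero, of 2] by (intro mult_right_mono) auto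
    with 1 inner_ge_zero[of "?p z"]
    show "- C\<^sup>2 * (v z \<bullet> v z) \<le> ?p z \<bullet> ?p z + ?q z \<bullet> ?q z + ?a * (v z \<bullet> ?q z + ?q z \<bullet> v z) - 0 * (v z \<bullet> v z)"
      by linarith
  qed (intro robin_form_integrable(1) integrable_mult_right integrable_inner_L2 L)+
  then show ?thesis by (simp add: ip_def)
qed

text \<open>Nonnegativity is given on test functions only, whereas \<xi> is a limit of them. For
  each fixed \<open>t\<close> the form at \<open>\<Phi> n + t v\<close> is nonnegative; the limit in
  \<open>n\<close> leaves a nonnegative quadratic polynomial in \<open>t\<close>, and its
  discriminant gives the claim.\<close>

lemma robin_form_Cauchy_Schwarz:
  assumes nonneg: "\<And>v. v \<in> test_functions UNIV \<Longrightarrow> robin_form_smooth \<epsilon> \<alpha> m v \<ge> 0"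
    and H1: "H1_limit \<epsilon> \<xi> p q \<Phi>"
    and v: "v \<in> test_functions UNIV"
  shows "(robin_form \<epsilon> \<alpha> m \<xi> p q v (partial_deriv (1, 0) v) (partial_deriv (0, 1) v))\<^sup>2
      \<le> robin_form \<epsilon> \<alpha> m \<xi> p q \<xi> p q * robin_form_smooth \<epsilon> \<alpha> m v"
proof (rule quadratic_nonneg_imp)
  fix t
  have L: "\<xi> \<in> L2 (strip \<epsilon>)" "p \<in> L2 (strip \<epsilon>)" "q \<in> L2 (strip \<epsilon>)" and \<Phi>: "\<And>n. \<Phi> n \<in> test_functions UNIV"
    and lim: "(\<lambda>n. L2_norm (strip \<epsilon>) (\<lambda>z. \<Phi> n z - \<xi> z)) \<longlonglongrightarrow> 0"
      "(\<lambda>n. L2_norm (strip \<epsilon>) (\<lambda>z. partial_deriv (1, 0) (\<Phi> n) z - p z)) \<longlonglongrightarrow> 0"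
      "(\<lambda>n. L2_norm (strip \<epsilon>) (\<lambda>z. partial_deriv (0, 1) (\<Phi> n) z - q z)) \<longlonglongrightarrow> 0"
    using H1 unfolding H1_limit_def by blast+
  note D = test_functions_partial_deriv[OF _ Basis_plane(1)] test_functions_partial_deriv[OF _ Basis_plane(2)]
  let ?p = "partial_deriv (1, 0)" and ?q = "partial_deriv (0, 1)"
  have TL: "w \<in> L2 (strip \<epsilon>)" "?p w \<in> L2 (strip \<epsilon>)" "?q w \<in> L2 (strip \<epsilon>)"
    if w: "w \<in> test_functions UNIV" for w :: "real \<times> real \<Rightarrow> complex"
    by (intro test_functions_L2[OF w] test_functions_L2[OF D(1)[OF w]] test_functions_L2[OF D(2)[OF w]] strip_sets)+
  have nn: "0 \<le> robin_form_smooth \<epsilon> \<alpha> m (\<Phi> n) + 2 * robin_form \<epsilon> \<alpha> m (\<Phi> n) (?p (\<Phi> n)) (?q (\<Phi> n)) v (?p v) (?q v) * t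
      + robin_form_smooth \<epsilon> \<alpha> m v * t\<^sup>2" for n
  proof -
    have tv: "(\<lambda>z. t *\<^sub>R v z) \<in> test_functions UNIV"
      by (intro test_functions_scaleR Ck_const v)
    have D': "partial_deriv b (\<lambda>z. \<Phi> n z + t *\<^sub>R v z) = (\<lambda>z. partial_deriv b (\<Phi> n) z + t *\<^sub>R partial_deriv b v z)" for b
      by (intro partial_deriv_eq has_derivative_add has_derivative_scaleR_right test_functions_has_derivative[OF \<Phi>]
            test_functions_has_derivative[OF v])
    have "0 \<le> robin_form_smooth \<epsilon> \<alpha> m (\<lambda>z. \<Phi> n z + t *\<^sub>R v z)"
      by (intro nonneg test_functions_add \<Phi> tv)
    then show ?thesis
      unfolding D' robin_form_expand[OF TL[OF \<Phi>] TL[OF v]] .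
  qed
  have "(\<lambda>n. robin_form_smooth \<epsilon> \<alpha> m (\<Phi> n) + 2 * robin_form \<epsilon> \<alpha> m (\<Phi> n) (?p (\<Phi> n)) (?q (\<Phi> n)) v (?p v) (?q v) * t
      + robin_form_smooth \<epsilon> \<alpha> m v * t\<^sup>2) \<longlonglongrightarrow>
      robin_form \<epsilon> \<alpha> m \<xi> p q \<xi> p q + 2 * robin_form \<epsilon> \<alpha> m \<xi> p q v (?p v) (?q v) * t + robin_form_smooth \<epsilon> \<alpha> m v * t\<^sup>2"
    by (intro tendsto_add tendsto_mult tendsto_const robin_form_tendsto L lim TL[OF \<Phi>] TL[OF v] L2_norm_const)
  then show "0 \<le> robin_form \<epsilon> \<alpha> m \<xi> p q \<xi> p q + 2 * robin_form \<epsilon> \<alpha> m \<xi> p q v (?p v) (?q v) * t + robin_form_smooth \<epsilon> \<alpha> m v * t\<^sup>2"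
    by (rule LIMSEQ_le_const) (use nn in blast)
qed

lemma robin_form_shift:
  assumes "v \<in> L2 (strip \<epsilon>)" "p \<in> L2 (strip \<epsilon>)" "q \<in> L2 (strip \<epsilon>)"
    "v' \<in> L2 (strip \<epsilon>)" "p' \<in> L2 (strip \<epsilon>)" "q' \<in> L2 (strip \<epsilon>)"
  shows "robin_form \<epsilon> \<alpha> m v p q v' p' q' = robin_form \<epsilon> \<alpha> 0 v p q v' p' q' - m * ip (strip \<epsilon>) v v'"
  by (simp add: robin_form_integrable(2)[OF assms])

text \<open>The infimum \<open>m\<close> of the Rayleigh quotient over test functions is a spectral point: if \<open>T - m\<close> had
  a bounded inverse, solving \<open>(T - m) \<xi> = v\<close> and applying the Cauchy--Schwarz inequality of the
  nonnegative form of \<open>T - m\<close> to \<open>v\<close> and \<open>\<xi>\<close> would bound the form below by a positive multiple of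
  \<open>\<parallel>v\<parallel>\<^sup>2\<close>.\<close>

lemma spectrum_below_Rayleigh_quotient:
  assumes u: "u \<in> test_functions UNIV" and neg: "robin_form_smooth \<epsilon> \<alpha> c u < 0"
  shows "\<exists>t<c. complex_of_real t \<in> spectrum (strip \<epsilon>) (robin_laplacian \<epsilon> \<alpha>)"
proof -
  let ?S = "strip \<epsilon>" and ?p = "partial_deriv (1, 0)" and ?q = "partial_deriv (0, 1)"
  let ?T = "test_functions UNIV :: (real \<times> real \<Rightarrow> complex) set"
  note D = test_functions_partial_deriv[OF _ Basis_plane(1)] test_functions_partial_deriv[OF _ Basis_plane(2)]
  have TL: "w \<in> L2 ?S" "?p w \<in> L2 ?S" "?q w \<in> L2 ?S"
    if w: "w \<in> ?T" for w :: "real \<times> real \<Rightarrow> complex"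
    by (intro test_functions_L2[OF w] test_functions_L2[OF D(1)[OF w]] test_functions_L2[OF D(2)[OF w]] strip_sets)+
  have shift: "robin_form_smooth \<epsilon> \<alpha> k v = robin_form_smooth \<epsilon> \<alpha> 0 v - k * ip ?S v v" if "v \<in> ?T" for v k
    by (rule robin_form_shift[OF TL[OF that] TL[OF that]])
  \<comment> \<open>Test functions of the plane may vanish on the strip; the condition on the norm
    excludes the quotient 0 / 0.\<close>
  define A where "A = {robin_form_smooth \<epsilon> \<alpha> 0 v / ip ?S v v | v. v \<in> ?T \<and> ip ?S v v > 0}"
  define m where "m = Inf A"
  have below: "- C\<^sup>2 \<le> r" if "r \<in> A" for r
    using that robin_form_lower_bound by (auto simp: A_def pos_le_divide_eq)
  then have bdd: "bdd_below A" by (rule bdd_belowI)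
  have u0: "ip ?S u u > 0"
  proof (rule ccontr)
    assume "\<not> ip ?S u u > 0"
    then have "ip ?S u u = 0" using ip_nonneg[of ?S u] by simp
    then show False
      using robin_form_lower_bound[OF u] neg shift[OF u, of c] by simp
  qed
  then have uA: "robin_form_smooth \<epsilon> \<alpha> 0 u / ip ?S u u \<in> A" using u by (auto simp: A_def)
  have "m \<le> robin_form_smooth \<epsilon> \<alpha> 0 u / ip ?S u u"
    unfolding m_def by (rule cInf_lower[OF uA bdd])
  also have "\<dots> < c"
    using neg u0 shift[OF u, of c] by (simp add: pos_divide_less_eq)
  finally have "m < c" .
  moreover have "complex_of_real m \<notin> resolvent_set ?S (robin_laplacian \<epsilon> \<alpha>)"
  proof
    assume "complex_of_real m \<in> resolvent_set ?S (robin_laplacian \<epsilon> \<alpha>)"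
    then obtain C' where
      surj: "\<And>f. f \<in> L2 ?S \<Longrightarrow> \<exists>(\<psi>, h)\<in>robin_laplacian \<epsilon> \<alpha>. AE z in lebesgue_on ?S. h z - complex_of_real m * \<psi> z = f z"
      and bnd: "\<And>\<psi> h. (\<psi>, h) \<in> robin_laplacian \<epsilon> \<alpha> \<Longrightarrow> L2_norm ?S \<psi> \<le> C' * L2_norm ?S (\<lambda>z. h z - complex_of_real m * \<psi> z)"
      unfolding resolvent_set_def by blast
    \<comment> \<open>The maximum with 1 makes the constant positive, so that \<open>1 / B\<close>
      can serve as the gap above \<open>m\<close>.\<close>
    define B where "B = max C' 1"
    have nonneg: "robin_form_smooth \<epsilon> \<alpha> m v \<ge> 0" if v: "v \<in> ?T" for v
    proof (cases "ip ?S v v > 0")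
      case True
      then have "m \<le> robin_form_smooth \<epsilon> \<alpha> 0 v / ip ?S v v"
        unfolding m_def using v by (intro cInf_lower bdd) (auto simp: A_def)
      then show ?thesis using True shift[OF v, of m] by (simp add: pos_le_divide_eq)
    next
      case False
      then have "ip ?S v v = 0" using ip_nonneg[of ?S v] by simp
      then show ?thesis using robin_form_lower_bound[OF v] shift[OF v, of m] by simp
    qed
    \<comment> \<open>Write b for the form shifted by \<open>m\<close>. Then b(\<xi>, v) is the
      square of the norm of \<open>v\<close> and b(\<xi>, \<xi>) is the product of \<xi> and
      \<open>v\<close>, at most \<open>B\<close> times that square. Cauchy-Schwarz for b gives the
      fourth power of the norm of \<open>v\<close> at most \<open>B\<close> times its square times
      b(v, v), and one square cancels.\<close>
    have coercive: "ip ?S v v \<le> B * robin_form_smooth \<epsilon> \<alpha> m v" if v: "v \<in> ?T" and pos: "ip ?S v v > 0" for v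
    proof -
      obtain \<xi> h where T: "(\<xi>, h) \<in> robin_laplacian \<epsilon> \<alpha>"
        and AE0: "AE z in lebesgue_on ?S. h z - complex_of_real m * \<xi> z = v z"
        using surj[OF TL(1)[OF v]] by blast
      have AE: "AE z in lebesgue_on ?S. h z - m *\<^sub>R \<xi> z = v z"
        using AE0 by (simp add: scaleR_conv_of_real)
      have h: "h \<in> L2 ?S" using T by (simp add: robin_laplacian_def)
      obtain p q \<Phi> where H1: "H1_limit \<epsilon> \<xi> p q \<Phi>"
        and green: "\<forall>\<phi>\<in>test_functions UNIV. ip ?S \<phi> h = ip ?S (?p \<phi>) p + ip ?S (?q \<phi>) q
           + ip ?S (\<lambda>z. \<alpha> (fst z) *\<^sub>R \<phi> z) q + ip ?S (\<lambda>z. \<alpha> (fst z) *\<^sub>R ?q \<phi> z) \<xi>"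
        using robin_laplacian_green[OF \<epsilon> \<alpha> T] by blast
      have L: "\<xi> \<in> L2 (strip \<epsilon>)" "p \<in> L2 (strip \<epsilon>)" "q \<in> L2 (strip \<epsilon>)" and \<Phi>: "\<And>n. \<Phi> n \<in> test_functions UNIV"
        and lim: "(\<lambda>n. L2_norm (strip \<epsilon>) (\<lambda>z. \<Phi> n z - \<xi> z)) \<longlonglongrightarrow> 0"
          "(\<lambda>n. L2_norm (strip \<epsilon>) (\<lambda>z. partial_deriv (1, 0) (\<Phi> n) z - p z)) \<longlonglongrightarrow> 0"
          "(\<lambda>n. L2_norm (strip \<epsilon>) (\<lambda>z. partial_deriv (0, 1) (\<Phi> n) z - q z)) \<longlonglongrightarrow> 0"
        using H1 unfolding H1_limit_def by blast+
      have G: "ip ?S \<phi> h = robin_form \<epsilon> \<alpha> 0 \<phi> (?p \<phi>) (?q \<phi>) \<xi> p q" if \<phi>: "\<phi> \<in> ?T" for \<phi>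
        by (simp add: green[rule_format, OF \<phi>] robin_form_integrable(2)[OF TL[OF \<phi>] L])
      \<comment> \<open>Green's formula admits only test functions on the left. It reaches \<xi>
        along the sequence that approximates \<xi> in H^1.\<close>
      have G\<xi>: "ip ?S \<xi> h = robin_form \<epsilon> \<alpha> 0 \<xi> p q \<xi> p q"
      proof (rule LIMSEQ_unique)
        show "(\<lambda>n. ip ?S (\<Phi> n) h) \<longlonglongrightarrow> ip ?S \<xi> h"
          by (intro ip_tendsto L lim TL[OF \<Phi>] h L2_norm_const)
        show "(\<lambda>n. ip ?S (\<Phi> n) h) \<longlonglongrightarrow> robin_form \<epsilon> \<alpha> 0 \<xi> p q \<xi> p q"
          unfolding G[OF \<Phi>] by (intro robin_form_tendsto L lim TL[OF \<Phi>] L2_norm_const)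
      qed
      have res: "ip ?S w v = ip ?S w h - m * ip ?S w \<xi>" if w: "w \<in> L2 ?S" for w
      proof -
        have "ip ?S (\<lambda>z. h z - m *\<^sub>R \<xi> z) w = ip ?S v w"
          by (intro ip_cong_AE L2_diff L2_scaleR h L TL v w AE)
        then show ?thesis
          unfolding ip_diff_left[OF h L2_scaleR[OF L(1)] w] ip_scaleR_left by (simp add: ip_commute)
      qed
      have sym: "robin_form \<epsilon> \<alpha> m \<xi> p q v (?p v) (?q v) = ip ?S v v"
      proof -
        have "robin_form \<epsilon> \<alpha> m \<xi> p q v (?p v) (?q v) = robin_form \<epsilon> \<alpha> m v (?p v) (?q v) \<xi> p q"
          unfolding robin_form_def by (simp add: inner_commute add.commute)
        also have "\<dots> = ip ?S v h - m * ip ?S v \<xi>"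
          using robin_form_shift[OF TL[OF v] L, of m] G[OF v] by simp
        finally show ?thesis using res[OF TL(1)[OF v]] by simp
      qed
      have "robin_form \<epsilon> \<alpha> m \<xi> p q \<xi> p q = ip ?S \<xi> v"
        using robin_form_shift[OF L L, of m] G\<xi> res[OF L(1)] by simp
      also have "\<dots> \<le> L2_norm ?S \<xi> * L2_norm ?S v"
        using ip_Cauchy_Schwarz[OF L(1) TL(1)[OF v]] by simp
      also have "L2_norm ?S \<xi> \<le> B * L2_norm ?S v"
      proof -
        have "L2_norm ?S (\<lambda>z. h z - complex_of_real m * \<xi> z) = L2_norm ?S v"
        proof -
          have "(\<lambda>z. h z - complex_of_real m * \<xi> z) = (\<lambda>z. h z - m *\<^sub>R \<xi> z)"
            by (simp add: scaleR_conv_of_real)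
          then have "(\<lambda>z. h z - complex_of_real m * \<xi> z) \<in> borel_measurable (lebesgue_on ?S)"
            using L2_diff[OF h L2_scaleR[OF L(1), of m]] by (simp add: L2_def)
          moreover have "v \<in> borel_measurable (lebesgue_on ?S)" using TL(1)[OF v] by (simp add: L2_def)
          ultimately show ?thesis
            unfolding L2_norm_def using AE0
            by (intro arg_cong[of _ _ sqrt] integral_cong_AE) (auto elim!: eventually_mono)
        qed
        then have "L2_norm ?S \<xi> \<le> C' * L2_norm ?S v" using bnd[OF T] by simp
        also have "\<dots> \<le> B * L2_norm ?S v"
          by (intro mult_right_mono L2_norm_nonneg) (simp add: B_def)
        finally show ?thesis .
      qed
      finally have "robin_form \<epsilon> \<alpha> m \<xi> p q \<xi> p q \<le> B * ip ?S v v"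
        using L2_norm_nonneg[of ?S v] by (simp add: mult_right_mono L2_norm_square[symmetric] power2_eq_square mult.assoc)
      then have "robin_form \<epsilon> \<alpha> m \<xi> p q \<xi> p q * robin_form_smooth \<epsilon> \<alpha> m v \<le> B * ip ?S v v * robin_form_smooth \<epsilon> \<alpha> m v"
        by (rule mult_right_mono[OF _ nonneg[OF v]])
      with robin_form_Cauchy_Schwarz[OF nonneg H1 v]
      have "(ip ?S v v)\<^sup>2 \<le> ip ?S v v * (B * robin_form_smooth \<epsilon> \<alpha> m v)"
        unfolding sym by (simp add: mult_ac)
      then show ?thesis using pos by (simp add: power2_eq_square)
    qed
    \<comment> \<open>Coercivity raises every Rayleigh quotient to at least
      \<open>m + 1 / B\<close>, contradicting that \<open>m\<close> is the greatest lower
      bound.\<close>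
    have "m + 1 / B \<le> m"
    proof (subst (2) m_def, rule cInf_greatest)
      show "A \<noteq> {}" using uA by auto
      fix r assume "r \<in> A"
      then obtain v where v: "v \<in> ?T" and pos: "ip ?S v v > 0" and r: "r = robin_form_smooth \<epsilon> \<alpha> 0 v / ip ?S v v"
        by (auto simp: A_def)
      have "B > 0" by (simp add: B_def)
      then have "ip ?S v v / B \<le> robin_form_smooth \<epsilon> \<alpha> 0 v - m * ip ?S v v"
        using coercive[OF v pos] shift[OF v, of m] by (simp add: pos_divide_le_eq mult.commute)
      then show "m + 1 / B \<le> r"
        unfolding r pos_le_divide_eq[OF pos] by (simp add: algebra_simps)
    qed
    then show False by (simp add: B_def)
  qed
  ultimately show ?thesis by (auto simp: spectrum_def)
qed

end

subsection \<open>The trial function\<close>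

lemma continuous_on_flat: "continuous_on UNIV (flat p)"
  using DERIV_continuous_on[of UNIV "flat p"] flat_has_derivative by blast

definition bump :: "real \<Rightarrow> real" where
  "bump t = flat 1 (1 + t) * flat 1 (1 - t)"

text \<open>Written out through \<open>flat_step\<close>, so that continuity and vanishing outside
  the interval from -1 to 1 can be read off.\<close>

definition bump' :: "real \<Rightarrow> real" where
  "bump' t = flat (flat_step 1) (1 + t) * flat 1 (1 - t) - flat 1 (1 + t) * flat (flat_step 1) (1 - t)"

lemma bump_has_derivative: "(bump has_field_derivative bump' t) (at t)"
proof -
  have p: "((\<lambda>t. 1 + t) has_field_derivative 1) (at t)" and m: "((\<lambda>t. 1 - t) has_field_derivative - 1) (at t)"
    by (auto intro!: derivative_eq_intros)
  show ?thesis
    using DERIV_mult[OF DERIV_chain2[OF flat_has_derivative p] DERIV_chain2[OF flat_has_derivative m], of 1 1]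
    by (simp add: bump_def[abs_def] bump'_def mult.commute)
qed

lemma bump_outside: "\<bar>t\<bar> > 1 \<Longrightarrow> bump t = 0 \<and> bump' t = 0"
  by (auto simp: bump_def bump'_def flat_def)

lemma bump_bounds: "0 \<le> bump t" "bump t \<le> 1" "bump 0 > 0"
  by (auto simp: bump_def flat_one_bounds intro!: mult_le_one) (simp add: flat_one)

lemma continuous_on_bump: "continuous_on UNIV bump" "continuous_on UNIV bump'"
  unfolding bump_def[abs_def] bump'_def[abs_def]
  by (intro continuous_intros continuous_on_compose2[OF continuous_on_flat]; simp)+

lemma bump'_bounded: "\<exists>K. \<forall>t. \<bar>bump' t\<bar> \<le> K"
proof -
  have "compact (bump' ` {-1..1})"
    by (intro compact_continuous_image continuous_on_subset[OF continuous_on_bump(2)]) auto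
  then obtain K where K: "\<forall>s\<in>bump' ` {-1..1}. norm s \<le> K"
    using compact_imp_bounded bounded_iff by metis
  have "\<bar>bump' t\<bar> \<le> K" for t
  proof (cases "\<bar>t\<bar> > 1")
    case True
    have "\<bar>bump' 0\<bar> \<le> K" using K by simp
    then show ?thesis using bump_outside[OF True] by simp
  next
    case False
    then have "t \<in> {-1..1}" by auto
    then show ?thesis using K by force
  qed
  then show ?thesis by blast
qed

text \<open>A smooth step made by composing \<open>flat 1\<close> with itself. The constant
  \<open>exp (- 1)\<close> is \<open>flat 1 1\<close>: for \<open>t \<ge> 1\<close> the outer
  argument is nonpositive, and for \<open>t \<le> 0\<close> the inner function is 0, so the outer
  argument is constant.\<close>

definition plateau :: "real \<Rightarrow> real" where
  "plateau t = flat 1 (exp (- 1) - flat 1 t)"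

lemma plateau_eq: "t \<le> 0 \<Longrightarrow> plateau t = plateau 0" "t \<ge> 1 \<Longrightarrow> plateau t = 0" "plateau 0 > 0"
  by (auto simp: plateau_def flat_one)

text \<open>The exponential solves the Robin condition with constant \<open>a\<close> on both lines.
  The two plateau factors give compact support in the plane and are constant on the strip, so they
  leave the form unaffected up to a positive factor.\<close>

definition trial :: "real \<Rightarrow> real \<Rightarrow> real \<Rightarrow> real \<times> real \<Rightarrow> real" where
  "trial \<epsilon> a L z = bump (fst z / L) * (exp (- a * snd z) * (plateau (- snd z) * plateau (snd z - \<epsilon>)))"

lemma Ck_trial: "Ck k (trial \<epsilon> a L)"
proof -
  have f: "Ck k (\<lambda>z::real \<times> real. c * fst z + d)" and s: "Ck k (\<lambda>z::real \<times> real. c * snd z + d)" for c d k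
    by (intro Ck_affine bounded_linear_const_mult bounded_linear_fst bounded_linear_snd)+
  have e: "Ck k (\<lambda>z::real \<times> real. exp (- a * snd z + 0))" for k
    using Ck_compose_real[of "\<lambda>_. exp", OF _ s] DERIV_exp by blast
  have p: "Ck k (\<lambda>z::real \<times> real. flat 1 (exp (- 1) + - 1 *\<^sub>R flat 1 (c * snd z + d)))" for c d k
    by (intro flat_smooth Ck_add Ck_const Ck_scaleR s)
  have "Ck k (\<lambda>z. (flat 1 (1 / L * fst z + 1) *\<^sub>R flat 1 (- 1 / L * fst z + 1)) *\<^sub>R
      exp (- a * snd z + 0) *\<^sub>R
      (flat 1 (exp (- 1) + - 1 *\<^sub>R flat 1 (- 1 * snd z + 0)) *\<^sub>R
       flat 1 (exp (- 1) + - 1 *\<^sub>R flat 1 (1 * snd z + - \<epsilon>))))"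
    by (intro Ck_scaleR flat_smooth f e p)
  then show ?thesis
    by (simp add: trial_def[abs_def] bump_def plateau_def add.commute)
qed

lemma trial_test_function:
  assumes "L > 0"
  shows "(\<lambda>z. trial \<epsilon> a L z *\<^sub>R (1::complex)) \<in> test_functions UNIV"
proof (rule test_functionsI)
  show "Ck k (\<lambda>z. trial \<epsilon> a L z *\<^sub>R (1::complex))" for k
    by (intro Ck_scaleR Ck_trial Ck_const)
  show "compact ({- L..L} \<times> {- 1..\<epsilon> + 1})" by (intro compact_Times compact_Icc)
  have "trial \<epsilon> a L (x, y) = 0" if "(x, y) \<notin> {- L..L} \<times> {- 1..\<epsilon> + 1}" for x y
  proof (cases "x \<in> {- L..L}")
    case False
    then have "\<bar>x / L\<bar> > 1" using assms by (auto simp: abs_if field_simps)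
    then show ?thesis using bump_outside by (simp add: trial_def)
  next
    case True
    with that have "- y \<ge> 1 \<or> y - \<epsilon> \<ge> 1" by auto
    then show ?thesis using plateau_eq(2) by (auto simp: trial_def)
  qed
  then have "z \<in> {- L..L} \<times> {- 1..\<epsilon> + 1}" if "trial \<epsilon> a L z \<noteq> 0" for z
    using that by (cases z) blast
  then show "{z. trial \<epsilon> a L z *\<^sub>R (1::complex) \<noteq> 0} \<subseteq> {- L..L} \<times> {- 1..\<epsilon> + 1}" by auto
qed simp

text \<open>The constant is what the two plateau factors leave on the strip; only its positivity
  matters.\<close>

definition transverse_mode :: "real \<Rightarrow> real \<Rightarrow> real" where
  "transverse_mode a y = (plateau 0)\<^sup>2 * exp (- a * y)"

text \<open>The plateau factors are constant on the open strip, so the derivatives there are those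
  of a product of a function of \<open>x\<close> and an exponential in \<open>y\<close>.\<close>

lemma trial_on_strip:
  assumes L: "L > 0" and z: "z \<in> strip \<epsilon>"
  shows "trial \<epsilon> a L z = bump (fst z / L) * transverse_mode a (snd z)"
    and "partial_deriv (1, 0) (\<lambda>z. trial \<epsilon> a L z *\<^sub>R (1::complex)) z = (bump' (fst z / L) / L * transverse_mode a (snd z)) *\<^sub>R 1"
    and "partial_deriv (0, 1) (\<lambda>z. trial \<epsilon> a L z *\<^sub>R (1::complex)) z = (- a * (bump (fst z / L) * transverse_mode a (snd z))) *\<^sub>R 1"
proof -
  have eq: "trial \<epsilon> a L z = bump (fst z / L) * transverse_mode a (snd z)" if "z \<in> strip \<epsilon>" for z
    using that plateau_eq(1)[of "- snd z"] plateau_eq(1)[of "snd z - \<epsilon>"]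
    by (simp add: trial_def transverse_mode_def strip_def mem_Times_iff power2_eq_square)
  show "trial \<epsilon> a L z = bump (fst z / L) * transverse_mode a (snd z)" by (rule eq[OF z])
  have db: "((\<lambda>z. bump (fst z / L)) has_derivative (\<lambda>h. fst h / L * bump' (fst z / L))) (at z)"
    by (rule DERIV_compose_FDERIV[OF bump_has_derivative]) (use L in \<open>auto intro!: derivative_eq_intros\<close>)
  have dk: "((\<lambda>z. transverse_mode a (snd z)) has_derivative (\<lambda>h. snd h * (- a * transverse_mode a (snd z)))) (at z)"
  proof (rule DERIV_compose_FDERIV[where f="transverse_mode a" and g=snd])
    show "(transverse_mode a has_field_derivative - a * transverse_mode a (snd z)) (at (snd z))"
      unfolding transverse_mode_def[abs_def] by (auto intro!: derivative_eq_intros)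
  qed (auto intro!: derivative_eq_intros)
  have "((\<lambda>z. (bump (fst z / L) * transverse_mode a (snd z)) *\<^sub>R (1::complex)) has_derivative
      (\<lambda>h. (bump (fst z / L) * (snd h * (- a * transverse_mode a (snd z))) + fst h / L * bump' (fst z / L) * transverse_mode a (snd z)) *\<^sub>R 1)) (at z)"
    by (intro has_derivative_scaleR_left has_derivative_mult db dk)
  then have "((\<lambda>z. trial \<epsilon> a L z *\<^sub>R (1::complex)) has_derivative
      (\<lambda>h. (bump (fst z / L) * (snd h * (- a * transverse_mode a (snd z))) + fst h / L * bump' (fst z / L) * transverse_mode a (snd z)) *\<^sub>R 1)) (at z)"
    by (rule has_derivative_transform_within_open[OF _ open_strip z]) (simp only: eq)
  note d = fun_cong[OF frechet_derivative_at[OF this], symmetric]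
  show "partial_deriv (1, 0) (\<lambda>z. trial \<epsilon> a L z *\<^sub>R (1::complex)) z = (bump' (fst z / L) / L * transverse_mode a (snd z)) *\<^sub>R 1"
    by (simp add: d)
  show "partial_deriv (0, 1) (\<lambda>z. trial \<epsilon> a L z *\<^sub>R (1::complex)) z = (- a * (bump (fst z / L) * transverse_mode a (snd z))) *\<^sub>R 1"
    by (simp add: d)
qed

lemma exists_trial_function:
  fixes \<epsilon> a C :: real and \<alpha> :: "real \<Rightarrow> real"
  assumes \<epsilon>: "\<epsilon> > 0" and a: "a \<noteq> 0" and \<alpha>: "\<alpha> \<in> borel_measurable borel" "\<And>x. \<bar>\<alpha> x\<bar> \<le> C"
    and int: "integrable lborel (\<lambda>x. \<alpha> x - a)" and pos: "a * (LINT x|lborel. \<alpha> x - a) > 0"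
  shows "\<exists>u\<in>test_functions UNIV. robin_form_smooth \<epsilon> \<alpha> (- a\<^sup>2) u < 0"
proof -
  define k where "k = transverse_mode a"
  \<comment> \<open>An antiderivative in \<open>y\<close> of the square of the transverse mode,
    whose prefactor squares to the fourth power of \<open>plateau 0\<close>; division by
    \<open>2 * a\<close> uses that \<open>a\<close> is nonzero. Thus \<open>N\<close> is the
    integral of that square over the width of the strip.\<close>
  define k2 where "k2 y = - ((plateau 0) ^ 4 * exp (- 2 * a * y) / (2 * a))" for y
  define N where "N = k2 \<epsilon> - k2 0"
  have k2: "(k2 has_field_derivative (k y)\<^sup>2) (at y)" for y
  proof -
    have "(k2 has_field_derivative (plateau 0) ^ 4 * exp (- 2 * a * y)) (at y)"
      unfolding k2_def using a by (auto intro!: derivative_eq_intros simp: field_simps)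
    also have "(plateau 0) ^ 4 * exp (- 2 * a * y) = (k y)\<^sup>2"
      by (simp add: k_def transverse_mode_def power_mult_distrib exp_double[symmetric] flip: power_mult)
    finally show ?thesis .
  qed
  have N: "N > 0"
  proof -
    have "0 < (k y)\<^sup>2" for y using plateau_eq(3) by (simp add: k_def transverse_mode_def)
    then have "k2 0 < k2 \<epsilon>" using DERIV_pos_imp_increasing[OF \<epsilon>, of k2] k2 by blast
    then show ?thesis by (simp add: N_def)
  qed
  have kc: "continuous_on UNIV k" unfolding k_def transverse_mode_def[abs_def] by (intro continuous_intros)
  obtain K where K: "\<And>t. \<bar>bump' t\<bar> \<le> K" using bump'_bounded by blast
  define I where "I n = (LINT x|lborel. (\<alpha> x - a) * (bump (x / real (Suc n)))\<^sup>2)" for n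
  have bm: "bump \<in> borel_measurable borel" "bump' \<in> borel_measurable borel"
    by (intro borel_measurable_continuous_onI continuous_on_bump)+
  have I: "I \<longlonglongrightarrow> (LINT x|lborel. (\<alpha> x - a) * (bump 0)\<^sup>2)"
    unfolding I_def
  proof (rule integral_dominated_convergence[where w="\<lambda>x. norm (\<alpha> x - a)"])
    show "(\<lambda>x. (\<alpha> x - a) * (bump (x / real (Suc n)))\<^sup>2) \<in> borel_measurable lborel" for n
      using \<alpha>(1) measurable_compose[OF _ bm(1), of "\<lambda>x. x / real (Suc n)" borel] by simp
    show "AE x in lborel. norm ((\<alpha> x - a) * (bump (x / real (Suc n)))\<^sup>2) \<le> norm (\<alpha> x - a)" for n
    proof (rule AE_I2)
      fix x
      have "(bump (x / real (Suc n)))\<^sup>2 \<le> 1" using bump_bounds by (intro power_le_one)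
      then show "norm ((\<alpha> x - a) * (bump (x / real (Suc n)))\<^sup>2) \<le> norm (\<alpha> x - a)"
        by (simp add: abs_mult mult_left_le)
    qed
    have "(\<lambda>n. bump (x / real (Suc n))) \<longlonglongrightarrow> bump 0" for x
    proof (rule continuous_on_tendsto_compose[OF continuous_on_bump(1)])
      show "(\<lambda>n. x / real (Suc n)) \<longlonglongrightarrow> 0"
        using tendsto_mult_right_zero[OF LIMSEQ_inverse_real_of_nat, of x] by (simp add: divide_inverse)
    qed auto
    then show "AE x in lborel. (\<lambda>n. (\<alpha> x - a) * (bump (x / real (Suc n)))\<^sup>2) \<longlonglongrightarrow> (\<alpha> x - a) * (bump 0)\<^sup>2"
      by (intro AE_I2 tendsto_intros)
  qed (use \<alpha>(1) int in \<open>auto intro!: integrable_norm\<close>)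
  \<comment> \<open>The first summand bounds the kinetic term at \<open>L = real (Suc n)\<close>:
    the derivative is at most \<open>K / L\<close> in modulus on an interval of length
    \<open>2 * L\<close>, so the integral of its square is at most 2 K^2 / L.\<close>
  have "(\<lambda>n. 2 * K\<^sup>2 * inverse (real (Suc n)) + - 2 * a * I n)
      \<longlonglongrightarrow> 2 * K\<^sup>2 * 0 + - 2 * a * (LINT x|lborel. (\<alpha> x - a) * (bump 0)\<^sup>2)"
    by (intro tendsto_intros I LIMSEQ_inverse_real_of_nat)
  moreover have "2 * K\<^sup>2 * 0 + - 2 * a * (LINT x|lborel. (\<alpha> x - a) * (bump 0)\<^sup>2) < 0"
    using mult_pos_pos[OF pos, of "(bump 0)\<^sup>2"] bump_bounds(3) by (simp add: mult.assoc)
  ultimately have "\<forall>\<^sub>F n in sequentially. 2 * K\<^sup>2 * inverse (real (Suc n)) + - 2 * a * I n < 0"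
    by (rule order_tendstoD(2))
  then obtain n where n: "2 * K\<^sup>2 * inverse (real (Suc n)) + - 2 * a * I n < 0"
    by (auto simp: eventually_sequentially)
  define L where "L = real (Suc n)"
  have L: "L > 0" by (simp add: L_def)
  define u where "u z = trial \<epsilon> a L z *\<^sub>R (1::complex)" for z
  have uT: "u \<in> test_functions UNIV" unfolding u_def by (rule trial_test_function[OF L])
  define g1 where "g1 z = (bump' (fst z / L) / L)\<^sup>2 * (k (snd z))\<^sup>2" for z :: "real \<times> real"
  define g2 where "g2 z = (bump (fst z / L))\<^sup>2 * (k (snd z))\<^sup>2" for z :: "real \<times> real"
  have c: "continuous_on UNIV g1" "continuous_on UNIV g2"
    unfolding g1_def g2_def using L
    by (intro continuous_intros continuous_on_compose2[OF continuous_on_bump(1)] continuous_on_compose2[OF continuous_on_bump(2)]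
          continuous_on_compose2[OF kc]; simp)+
  have out: "g1 z = 0" "g2 z = 0" if "z \<in> strip \<epsilon>" "z \<notin> {- L..L} \<times> {0..\<epsilon>}" for z
  proof -
    have "\<bar>fst z / L\<bar> > 1" using L that by (auto simp: strip_def abs_if field_simps)
    then show "g1 z = 0" "g2 z = 0" using bump_outside by (auto simp: g1_def g2_def)
  qed
  have cpt: "compact ({- L..L} \<times> {0..\<epsilon>})" by (intro compact_Times compact_Icc)
  have dk2: "((\<lambda>y. h * k2 y) has_vector_derivative h * (k y)\<^sup>2) (at y)" for h y
    using DERIV_cmult[OF k2, of h] by (simp add: has_real_derivative_iff_has_vector_derivative)
  let ?\<beta> = "\<lambda>x. - 2 * a * (\<alpha> x - a)"
  have \<beta>: "?\<beta> \<in> borel_measurable borel" "\<bar>?\<beta> x\<bar> \<le> \<bar>2 * a\<bar> * (C + \<bar>a\<bar>)" for x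
    using \<alpha>(1) \<alpha>(2)[of x] by (auto simp: abs_mult intro!: mult_left_mono)
  note F1 = integral_strip_derivative[OF \<epsilon>, of "\<lambda>_. 1" 1 g1 _ "\<lambda>z. (bump' (fst z / L) / L)\<^sup>2 * k2 (snd z)", OF _ _ c(1) cpt out(1)]
  note F2 = integral_strip_derivative[OF \<epsilon> \<beta> c(2) cpt out(2), of "\<lambda>z. (bump (fst z / L))\<^sup>2 * k2 (snd z)"]
  have F1': "integrable (lebesgue_on (strip \<epsilon>)) (\<lambda>z. 1 * g1 z)"
    "(LINT z|lebesgue_on (strip \<epsilon>). 1 * g1 z) = (LINT x|lborel. 1 * ((bump' (x / L) / L)\<^sup>2 * k2 \<epsilon> - (bump' (x / L) / L)\<^sup>2 * k2 0))"
    using F1 dk2 by (auto simp: g1_def)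
  have F2': "integrable (lebesgue_on (strip \<epsilon>)) (\<lambda>z. ?\<beta> (fst z) * g2 z)"
    "(LINT z|lebesgue_on (strip \<epsilon>). ?\<beta> (fst z) * g2 z) =
      (LINT x|lborel. ?\<beta> x * ((bump (x / L))\<^sup>2 * k2 \<epsilon> - (bump (x / L))\<^sup>2 * k2 0))"
    using F2 dk2 by (auto simp: g2_def)
  \<comment> \<open>On the strip the \<open>y\<close>-derivative of \<open>u\<close> is
    \<open>- a u\<close>. Besides the \<open>x\<close>-derivative, the integrand is therefore a^2 -
    2 a \<alpha> + a^2 times the square of \<open>u\<close>, that is,
    \<open>- 2 * a * (\<alpha> - a)\<close> times that square.\<close>
  have "robin_form_smooth \<epsilon> \<alpha> (- a\<^sup>2) u = (LINT z|lebesgue_on (strip \<epsilon>). 1 * g1 z + ?\<beta> (fst z) * g2 z)"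
    unfolding robin_form_def
  proof (rule Bochner_Integration.integral_cong[OF refl])
    fix z assume "z \<in> space (lebesgue_on (strip \<epsilon>))"
    then have z: "z \<in> strip \<epsilon>" by simp
    show "partial_deriv (1, 0) u z \<bullet> partial_deriv (1, 0) u z + partial_deriv (0, 1) u z \<bullet> partial_deriv (0, 1) u z
        + \<alpha> (fst z) * (u z \<bullet> partial_deriv (0, 1) u z + partial_deriv (0, 1) u z \<bullet> u z) - - a\<^sup>2 * (u z \<bullet> u z)
        = 1 * g1 z + ?\<beta> (fst z) * g2 z"
      unfolding u_def[abs_def] trial_on_strip[OF L z] g1_def g2_def k_def
      by (simp add: power2_eq_square algebra_simps)
  qed
  also have "\<dots> = (LINT z|lebesgue_on (strip \<epsilon>). 1 * g1 z) + (LINT z|lebesgue_on (strip \<epsilon>). ?\<beta> (fst z) * g2 z)"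
    by (rule Bochner_Integration.integral_add[OF F1'(1) F2'(1)])
  also have "(LINT z|lebesgue_on (strip \<epsilon>). 1 * g1 z) = (LINT x|lborel. N * (bump' (x / L) / L)\<^sup>2)"
    unfolding F1'(2) by (intro Bochner_Integration.integral_cong refl) (simp add: N_def algebra_simps)
  also have "\<dots> = N * (LINT x|lborel. (bump' (x / L) / L)\<^sup>2)"
    by (rule integral_mult_right_zero)
  also have "(LINT z|lebesgue_on (strip \<epsilon>). ?\<beta> (fst z) * g2 z) = (LINT x|lborel. N * (- 2 * a) * ((\<alpha> x - a) * (bump (x / L))\<^sup>2))"
    unfolding F2'(2) by (intro Bochner_Integration.integral_cong refl) (simp add: N_def algebra_simps)
  also have "\<dots> = N * (- 2 * a) * I n"
    unfolding I_def L_def by (rule integral_mult_right_zero)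
  also have "N * (LINT x|lborel. (bump' (x / L) / L)\<^sup>2) \<le> N * (2 * K\<^sup>2 * inverse L)"
  proof (rule mult_left_mono)
    have "(LINT x|lborel. (bump' (x / L) / L)\<^sup>2) \<le> (LINT x|lborel. (K / L)\<^sup>2 * indicator {- L..L} x)"
    proof (rule integral_mono')
      show "integrable lborel (\<lambda>x. (K / L)\<^sup>2 * indicat_real {- L..L} x)"
        by (intro integrable_mult_right integrable_real_indicator) (auto simp: emeasure_lborel_Icc_eq)
      fix x
      show "0 \<le> (K / L)\<^sup>2 * indicat_real {- L..L} x" by simp
      show "(bump' (x / L) / L)\<^sup>2 \<le> (K / L)\<^sup>2 * indicat_real {- L..L} x"
      proof (cases "x \<in> {- L..L}")
        case True
        have "\<bar>bump' (x / L) / L\<bar> \<le> K / L" using K[of "x / L"] L by (simp add: divide_right_mono)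
        from power_mono[OF this abs_ge_zero, of 2] have "(bump' (x / L) / L)\<^sup>2 \<le> (K / L)\<^sup>2"
          unfolding power2_abs .
        then show ?thesis using True by simp
      next
        case False
        then have "\<bar>x / L\<bar> > 1" using L by (auto simp: abs_if field_simps)
        then show ?thesis using bump_outside by simp
      qed
    qed
    also have "\<dots> = 2 * K\<^sup>2 * inverse L"
      using L by (simp add: power2_eq_square field_simps)
    finally show "(LINT x|lborel. (bump' (x / L) / L)\<^sup>2) \<le> 2 * K\<^sup>2 * inverse L" .
  qed (use N in simp)
  finally have "robin_form_smooth \<epsilon> \<alpha> (- a\<^sup>2) u \<le> N * (2 * K\<^sup>2 * inverse (real (Suc n)) + - 2 * a * I n)"
    by (simp add: L_def algebra_simps)
  also have "\<dots> < 0" using N n by (rule mult_pos_neg)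
  finally show ?thesis using uT by blast
qed

text \<open>The operator sees \<alpha> only through an almost everywhere condition on the boundary
  lines. This permits replacing \<alpha> by a bounded Borel function, as the integration lemmas
  require.\<close>

lemma robin_laplacian_cong_AE:
  assumes "AE x in lebesgue. \<alpha> x = \<alpha>' x"
  shows "robin_laplacian \<epsilon> \<alpha> = robin_laplacian \<epsilon> \<alpha>'"
proof -
  have "(AE x in lebesgue. - h0 x - complex_of_real (\<alpha> x) * g0 x = 0 \<and> h1 x + complex_of_real (\<alpha> x) * g1 x = 0) \<longleftrightarrow>
      (AE x in lebesgue. - h0 x - complex_of_real (\<alpha>' x) * g0 x = 0 \<and> h1 x + complex_of_real (\<alpha>' x) * g1 x = 0)"
    for h0 g0 h1 g1 :: "real \<Rightarrow> complex"
    by (rule eventually_cong[OF assms]) simp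
  then have "robin_condition \<epsilon> \<alpha> = robin_condition \<epsilon> \<alpha>'"
    unfolding robin_condition_def by (intro ext) simp
  then show ?thesis by (simp add: robin_laplacian_def)
qed

theorem theorem15:
  fixes \<epsilon> \<alpha>\<^sub>0 :: real and \<alpha> :: "real \<Rightarrow> real"
  assumes "\<epsilon> > 0"
    and "\<alpha>\<^sub>0 \<noteq> 0"
    and "(\<lambda>x. \<alpha> x - \<alpha>\<^sub>0) \<in> sobolev UNIV (Linf UNIV) 1"
    and "integrable lebesgue (\<lambda>x. \<alpha> x - \<alpha>\<^sub>0)"
    and "((\<lambda>x. \<alpha> x - \<alpha>\<^sub>0) \<longlongrightarrow> 0) at_infinity"
    and "(\<alpha>\<^sub>0 > 0 \<and> (LINT x|lebesgue. \<alpha> x - \<alpha>\<^sub>0) > 0) \<or>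
         (\<alpha>\<^sub>0 < 0 \<and> (LINT x|lebesgue. \<alpha> x - \<alpha>\<^sub>0) < 0)"
  shows "inf_spectrum (strip \<epsilon>) (robin_laplacian \<epsilon> \<alpha>) < ereal (- (\<alpha>\<^sub>0\<^sup>2))"
proof -
  have "(\<lambda>x. \<alpha> x - \<alpha>\<^sub>0) \<in> Linf UNIV" using assms(3) by simp
  then obtain C where m: "(\<lambda>x. \<alpha> x - \<alpha>\<^sub>0) \<in> borel_measurable lebesgue"
    and C: "AE x in lebesgue. \<bar>\<alpha> x - \<alpha>\<^sub>0\<bar> \<le> C"
    unfolding Linf_def lebesgue_on_UNIV_eq real_norm_def by blast
  obtain g where g: "g \<in> borel_measurable lborel" "AE x in lborel. \<alpha> x - \<alpha>\<^sub>0 = g x"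
    using completion_ex_borel_measurable_real[OF m] by blast
  \<comment> \<open>The Borel representative \<open>g\<close> obeys the bound \<open>C\<close> only
    almost everywhere; truncation makes it hold at every point without leaving the class of
    \<open>\<alpha> - \<alpha>\<^sub>0\<close>.\<close>
  define \<gamma> where "\<gamma> x = (if \<bar>g x\<bar> \<le> C then g x else 0)" for x
  have \<gamma>m: "\<gamma> \<in> borel_measurable borel" unfolding \<gamma>_def using g(1) by simp
  have \<gamma>C: "\<bar>\<gamma> x\<bar> \<le> \<bar>C\<bar>" for x by (simp add: \<gamma>_def)
  have AE: "AE x in lebesgue. \<alpha> x - \<alpha>\<^sub>0 = \<gamma> x"
    using AE_completion[OF g(2)] C by eventually_elim (simp add: \<gamma>_def)
  let ?\<alpha> = "\<lambda>x. \<alpha>\<^sub>0 + \<gamma> x"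
  have \<gamma>l: "\<gamma> \<in> borel_measurable lebesgue" using \<gamma>m by (intro measurable_completion) simp
  have "integrable lebesgue \<gamma>" using integrable_cong_AE[OF m \<gamma>l AE] assms(4) by simp
  then have int: "integrable lborel (\<lambda>x. ?\<alpha> x - \<alpha>\<^sub>0)" using integrable_completion[of \<gamma> lborel] \<gamma>m by simp
  have "(LINT x|lebesgue. \<alpha> x - \<alpha>\<^sub>0) = (LINT x|lebesgue. \<gamma> x)" by (rule integral_cong_AE[OF m \<gamma>l AE])
  also have "\<dots> = (LINT x|lborel. ?\<alpha> x - \<alpha>\<^sub>0)" using integral_completion[of \<gamma> lborel] \<gamma>m by simp
  \<comment> \<open>The two sign cases enter only through the positivity of this product.\<close>
  finally have pos: "\<alpha>\<^sub>0 * (LINT x|lborel. ?\<alpha> x - \<alpha>\<^sub>0) > 0"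
    using assms(6) by (auto intro: mult_pos_pos mult_neg_neg)
  have \<alpha>m: "?\<alpha> \<in> borel_measurable borel" using \<gamma>m by simp
  have \<alpha>C: "\<bar>?\<alpha> x\<bar> \<le> \<bar>\<alpha>\<^sub>0\<bar> + \<bar>C\<bar>" for x using \<gamma>C[of x] by linarith
  obtain u where "u \<in> test_functions UNIV" "robin_form_smooth \<epsilon> ?\<alpha> (- \<alpha>\<^sub>0\<^sup>2) u < 0"
    using exists_trial_function[OF assms(1,2) \<alpha>m \<alpha>C int pos] by blast
  then obtain t where "t < - \<alpha>\<^sub>0\<^sup>2" "complex_of_real t \<in> spectrum (strip \<epsilon>) (robin_laplacian \<epsilon> ?\<alpha>)"
    using spectrum_below_Rayleigh_quotient[OF assms(1) \<alpha>m \<alpha>C] by blast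
  moreover have "robin_laplacian \<epsilon> \<alpha> = robin_laplacian \<epsilon> ?\<alpha>"
    by (rule robin_laplacian_cong_AE) (use AE in \<open>auto elim!: eventually_mono\<close>)
  ultimately show ?thesis
    unfolding inf_spectrum_def INF_less_iff by (auto intro!: bexI[of _ t])
qed

end
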